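(* Let $d \le 3$ and let $\Omega \subset \mathbb{R}^d$ be a bounded domain with $C^{1,1}$ boundary. Let $M \ge 1$, let $\boldsymbol{x}_1,\dots,\boldsymbol{x}_M \in \Omega$ be observation points with observed values $u^\star(\boldsymbol{x}_1),\dots,u^\star(\boldsymbol{x}_M) \in \mathbb{R}$, let $K \subset \mathbb{R}^{d+1}$ be compact, and let $\alpha,\beta,\lambda,C,R>0$. For $f \in L^2(\Omega)$ let $(-\Delta)^{-1}f$ denote the solution of the homogeneous Dirichlet Poisson problem with source $f$, and for $\mu \in \mathcal{M}(K)$ let $\tilde u_\mu(\boldsymbol{x}) = \int_K \sigma(\langle a,\boldsymbol{x}\rangle + b)\,d\mu(a,b)$ with $\sigma(s)=\max\{s,0\}$. Define $$\mathsf{L}_1(f,\mu) := \frac{\beta}{M}\sum_{i=1}^M \big|((-\Delta)^{-1}f)(\boldsymbol{x}_i) - u^\star(\boldsymbol{x}_i)\big|^2 + \big\|(-\Delta)^{-1}f - \tilde u_\mu\big\|_{L^2(\Omega)}^2,$$ $$\mathsf{L}_2(f,\mu) := \lambda\|\mu\|_{TV} + \frac{\alpha}{M}\sum_{i=1}^M \big|\tilde u_\mu(\boldsymbol{x}_i) - u^\star(\boldsymbol{x}_i)\big|^2 + \big\|(-\Delta)^{-1}f - \tilde u_\mu\big\|_{L^2(\Omega)}^2,$$ and the strategy sets $$\mathcal{B}_C := \{f \in L^2(\Omega) : \|f\|_{L^2(\Omega)} \le C\}, \qquad \mathcal{A}_R := \{\mu \in \mathcal{M}(K) : \|\mu\|_{TV}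 \le R\}.$$ Then the two-player game in which the first player minimizes $\mathsf{L}_1$ over $f \in \mathcal{B}_C$ and the second player minimizes $\mathsf{L}_2$ over $\mu \in \mathcal{A}_R$ admits at least one Nash equilibrium; that is, there exists $(f^\star,\mu^\star) \in \mathcal{B}_C \times \mathcal{A}_R$ such that $$\mathsf{L}_1(f^\star,\mu^\star) \le \mathsf{L}_1(f,\mu^\star) \quad \text{for all } f \in \mathcal{B}_C, \qquad \mathsf{L}_2(f^\star,\mu^\star) \le \mathsf{L}_2(f^\star,\mu) \quad \text{for all } \mu \in \mathcal{A}_R.$$
   Context: All functions and measures are real valued. For $f \in L^2(\Omega)$, $(-\Delta)^{-1}f$ is the unique weak solution $u \in H^1_0(\Omega)$ of $-\Delta u = f$ in $\Omega$, $u = 0$ on $\partial\Omega$. By elliptic regularity $u \in H^2(\Omega)$, and since $d \le 3$, $H^2(\Omega) \hookrightarrow C^0(\overline{\Omega})$; the pointwise values $((-\Delta)^{-1}f)(\boldsymbol{x}_i)$ are those of the continuous representative. $\mathcal{M}(K)$ is the space of finite signed Borel (Radon) measures on the compact set $K$, identified with the dual $C(K)^*$, and $\|\mu\|_{TV}$ is the total variation norm. Points of $K \subset \mathbb{R}^{d+1}$ are written $(a,b)$ with $a \in \mathbb{R}^d$, $b \in \mathbb{R}$, and $\langle\cdot,\cdot\rangle$ is the Euclidean inner product on $\mathbb{R}^d$. *)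

theory Defs
  imports "HOL-Analysis.Analysis"
begin

section \<open>Domains with $C^{1,1}$ boundary\<close>

definition C11_function :: "('a::euclidean_space \<Rightarrow> real) \<Rightarrow> bool" where
  "C11_function \<gamma> \<longleftrightarrow>
     (\<exists>\<gamma>' L. (\<forall>x. GDERIV \<gamma> x :> \<gamma>' x) \<and> L-lipschitz_on UNIV \<gamma>')"

text \<open>Near every boundary point, and in suitably rotated coordinates, the set is the strict
  epigraph of a \<open>C\<^sup>1\<^sup>,\<^sup>1\<close> function of the remaining \<open>d - 1\<close> coordinates. The rotated last axis is the
  unit vector \<open>e\<close>, and \<open>x - (x \<bullet> e) *\<^sub>R e\<close> is the orthogonal projection of \<open>x\<close> to the hyperplane
  \<open>e\<^sup>\<bottom>\<close>, so that only the values of \<open>\<gamma>\<close> on this hyperplane matter.\<close>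

definition C11_boundary :: "'a::euclidean_space set \<Rightarrow> bool" where
  "C11_boundary \<Omega> \<longleftrightarrow>
     (\<forall>p\<in>frontier \<Omega>. \<exists>r>0. \<exists>e \<gamma>. norm e = 1 \<and> C11_function \<gamma> \<and>
        \<Omega> \<inter> ball p r = {x \<in> ball p r. \<gamma> (x - (x \<bullet> e) *\<^sub>R e) < x \<bullet> e})"

definition bounded_C11_domain :: "'a::euclidean_space set \<Rightarrow> bool" where
  "bounded_C11_domain \<Omega> \<longleftrightarrow>
     \<Omega> \<noteq> {} \<and> open \<Omega> \<and> connected \<Omega> \<and> bounded \<Omega> \<and> C11_boundary \<Omega>"


section \<open>Lebesgue and Sobolev spaces\<close>

text \<open>Elements of the function spaces are represented by functions on the whole space of which
  only the restriction to \<open>\<Omega>\<close> matters; functions that agree almost everywhere in \<open>\<Omega>\<close> are not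
  identified.\<close>

definition L2 :: "'a::euclidean_space set \<Rightarrow> ('a \<Rightarrow> 'b::euclidean_space) set" where
  "L2 \<Omega> = {f \<in> borel_measurable (lebesgue_on \<Omega>). integrable (lebesgue_on \<Omega>) (\<lambda>x. (norm (f x))\<^sup>2)}"

definition L2_norm :: "'a::euclidean_space set \<Rightarrow> ('a \<Rightarrow> 'b::euclidean_space) \<Rightarrow> real" where
  "L2_norm \<Omega> f = sqrt (integral\<^sup>L (lebesgue_on \<Omega>) (\<lambda>x. (norm (f x))\<^sup>2))"

primrec C_k :: "nat \<Rightarrow> ('a::euclidean_space \<Rightarrow> real) \<Rightarrow> bool" where
  "C_k 0 f \<longleftrightarrow> continuous_on UNIV f"
| "C_k (Suc k) f \<longleftrightarrow>
     f differentiable_on UNIV \<and> (\<forall>i\<in>Basis. C_k k (\<lambda>x. frechet_derivative f (at x) i))"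

definition test_functions :: "'a::euclidean_space set \<Rightarrow> ('a \<Rightarrow> real) set" where
  "test_functions \<Omega> =
     {\<phi>. (\<forall>k. C_k k \<phi>) \<and> compact (closure {x. \<phi> x \<noteq> 0}) \<and> closure {x. \<phi> x \<noteq> 0} \<subseteq> \<Omega>}"

definition has_weak_gradient ::
  "'a::euclidean_space set \<Rightarrow> ('a \<Rightarrow> real) \<Rightarrow> ('a \<Rightarrow> 'a) \<Rightarrow> bool" where
  "has_weak_gradient \<Omega> u g \<longleftrightarrow>
     (\<forall>\<phi>\<in>test_functions \<Omega>. \<forall>i\<in>Basis.
        integral\<^sup>L (lebesgue_on \<Omega>) (\<lambda>x. u x * frechet_derivative \<phi> (at x) i)
          = - integral\<^sup>L (lebesgue_on \<Omega>) (\<lambda>x. (g x \<bullet> i) * \<phi> x))"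

definition H1 :: "'a::euclidean_space set \<Rightarrow> ('a \<Rightarrow> real) set" where
  "H1 \<Omega> = {u \<in> L2 \<Omega>. \<exists>g\<in>L2 \<Omega>. has_weak_gradient \<Omega> u g}"

text \<open>The weak gradient is unique up to null sets, so the choice is immaterial.\<close>

definition weak_grad :: "'a::euclidean_space set \<Rightarrow> ('a \<Rightarrow> real) \<Rightarrow> 'a \<Rightarrow> 'a" where
  "weak_grad \<Omega> u = (SOME g. g \<in> L2 \<Omega> \<and> has_weak_gradient \<Omega> u g)"

definition H1_norm :: "'a::euclidean_space set \<Rightarrow> ('a \<Rightarrow> real) \<Rightarrow> real" where
  "H1_norm \<Omega> u = sqrt ((L2_norm \<Omega> u)\<^sup>2 + (L2_norm \<Omega> (weak_grad \<Omega> u))\<^sup>2)"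

definition H10 :: "'a::euclidean_space set \<Rightarrow> ('a \<Rightarrow> real) set" where
  "H10 \<Omega> = {u \<in> H1 \<Omega>. \<exists>\<phi>. (\<forall>n. \<phi> n \<in> test_functions \<Omega>) \<and>
                             (\<lambda>n::nat. H1_norm \<Omega> (\<lambda>x. \<phi> n x - u x)) \<longlonglongrightarrow> 0}"


section \<open>The Dirichlet problem for the Poisson equation\<close>

definition weak_poisson_solution ::
  "'a::euclidean_space set \<Rightarrow> ('a \<Rightarrow> real) \<Rightarrow> ('a \<Rightarrow> real) \<Rightarrow> bool" where
  "weak_poisson_solution \<Omega> f u \<longleftrightarrow>
     u \<in> H10 \<Omega> \<and>
     (\<forall>v\<in>H10 \<Omega>. integral\<^sup>L (lebesgue_on \<Omega>) (\<lambda>x. weak_grad \<Omega> u x \<bullet> weak_grad \<Omega> v x)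
                 = integral\<^sup>L (lebesgue_on \<Omega>) (\<lambda>x. f x * v x))"

text \<open>The operator \<open>(-\<Delta>)\<^sup>-\<^sup>1\<close>: the continuous representative of the weak solution. Weak solutions
  are unique up to null sets, and functions that are continuous on the open set \<open>\<Omega>\<close> and agree
  almost everywhere in \<open>\<Omega>\<close> agree on \<open>\<Omega>\<close>; so the values on \<open>\<Omega>\<close> do not depend on the choice. In
  particular they are those of the representative that is continuous up to the boundary.\<close>

definition inv_neg_laplacian ::
  "'a::euclidean_space set \<Rightarrow> ('a \<Rightarrow> real) \<Rightarrow> 'a \<Rightarrow> real" where
  "inv_neg_laplacian \<Omega> f = (SOME u. weak_poisson_solution \<Omega> f u \<and> continuous_on \<Omega> u)"


section \<open>Finite signed Borel measures\<close>

abbreviation borel_subsets :: "'b::topological_space set \<Rightarrow> 'b set set" where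
  "borel_subsets K \<equiv> sets (restrict_space borel K)"

text \<open>Set functions are normalised to vanish outside the \<open>\<sigma>\<close>-algebra, so that two elements are
  equal iff they are equal as measures.\<close>

definition signed_measures :: "'b::topological_space set \<Rightarrow> ('b set \<Rightarrow> real) set" where
  "signed_measures K =
     {\<mu>. (\<forall>A. A \<notin> borel_subsets K \<longrightarrow> \<mu> A = 0) \<and>
         (\<forall>A::nat \<Rightarrow> 'b set. range A \<subseteq> borel_subsets K \<and> disjoint_family A \<longrightarrow>
            (\<lambda>n. \<mu> (A n)) sums \<mu> (\<Union>n. A n))}"

text \<open>The variation \<open>|\<mu>|(A)\<close>. The supremum is over a bounded set for every \<open>\<mu>\<close> in
  \<open>signed_measures K\<close> and Borel subset \<open>A\<close> of \<open>K\<close>.\<close>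

definition variation :: "'b::topological_space set \<Rightarrow> ('b set \<Rightarrow> real) \<Rightarrow> 'b set \<Rightarrow> real" where
  "variation K \<mu> A =
     (SUP P \<in> {P. finite P \<and> P \<subseteq> borel_subsets K \<and> partition_on A P}. \<Sum>B\<in>P. \<bar>\<mu> B\<bar>)"

definition TV_norm :: "'b::topological_space set \<Rightarrow> ('b set \<Rightarrow> real) \<Rightarrow> real" where
  "TV_norm K \<mu> = variation K \<mu> K"

text \<open>The Jordan decomposition \<open>\<mu>\<^sup>\<plusminus> = (|\<mu>| \<plusminus> \<mu>) / 2\<close>.\<close>

definition pos_part :: "'b::topological_space set \<Rightarrow> ('b set \<Rightarrow> real) \<Rightarrow> 'b measure" where
  "pos_part K \<mu> = measure_of K (borel_subsets K) (\<lambda>A. ennreal ((variation K \<mu> A + \<mu> A) / 2))"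

definition neg_part :: "'b::topological_space set \<Rightarrow> ('b set \<Rightarrow> real) \<Rightarrow> 'b measure" where
  "neg_part K \<mu> = measure_of K (borel_subsets K) (\<lambda>A. ennreal ((variation K \<mu> A - \<mu> A) / 2))"

definition signed_integral ::
  "'b::topological_space set \<Rightarrow> ('b set \<Rightarrow> real) \<Rightarrow> ('b \<Rightarrow> real) \<Rightarrow> real" where
  "signed_integral K \<mu> h = integral\<^sup>L (pos_part K \<mu>) h - integral\<^sup>L (neg_part K \<mu>) h"


section \<open>The game\<close>

definition relu :: "real \<Rightarrow> real" where
  "relu s = max s 0"

definition network ::
  "('a::euclidean_space \<times> real) set \<Rightarrow> (('a \<times> real) set \<Rightarrow> real) \<Rightarrow> 'a \<Rightarrow> real" where
  "network K \<mu> x = signed_integral K \<mu> (\<lambda>(a, b). relu (a \<bullet> x + b))"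

definition loss1 ::
  "'a::euclidean_space set \<Rightarrow> ('a \<times> real) set \<Rightarrow> nat \<Rightarrow> (nat \<Rightarrow> 'a) \<Rightarrow> ('a \<Rightarrow> real) \<Rightarrow> real
     \<Rightarrow> ('a \<Rightarrow> real) \<Rightarrow> (('a \<times> real) set \<Rightarrow> real) \<Rightarrow> real" where
  "loss1 \<Omega> K M x ustar \<beta> f \<mu> =
     \<beta> / real M * (\<Sum>i=1..M. \<bar>inv_neg_laplacian \<Omega> f (x i) - ustar (x i)\<bar>\<^sup>2)
     + (L2_norm \<Omega> (\<lambda>y. inv_neg_laplacian \<Omega> f y - network K \<mu> y))\<^sup>2"

definition loss2 ::
  "'a::euclidean_space set \<Rightarrow> ('a \<times> real) set \<Rightarrow> nat \<Rightarrow> (nat \<Rightarrow> 'a) \<Rightarrow> ('a \<Rightarrow> real) \<Rightarrow> real \<Rightarrow> real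
     \<Rightarrow> ('a \<Rightarrow> real) \<Rightarrow> (('a \<times> real) set \<Rightarrow> real) \<Rightarrow> real" where
  "loss2 \<Omega> K M x ustar lam \<alpha> f \<mu> =
     lam * TV_norm K \<mu>
     + \<alpha> / real M * (\<Sum>i=1..M. \<bar>network K \<mu> (x i) - ustar (x i)\<bar>\<^sup>2)
     + (L2_norm \<Omega> (\<lambda>y. inv_neg_laplacian \<Omega> f y - network K \<mu> y))\<^sup>2"

definition strategies1 :: "'a::euclidean_space set \<Rightarrow> real \<Rightarrow> ('a \<Rightarrow> real) set" where
  "strategies1 \<Omega> C = {f \<in> L2 \<Omega>. L2_norm \<Omega> f \<le> C}"

definition strategies2 :: "'b::topological_space set \<Rightarrow> real \<Rightarrow> ('b set \<Rightarrow> real) set" where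
  "strategies2 K R = {\<mu> \<in> signed_measures K. TV_norm K \<mu> \<le> R}"

end

theory Submission imports Defs "HOL-Probability.Probability" begin

text \<open>The game has an exact potential: both losses share the term \<open>\<parallel>(-\<Delta>)\<^sup>-\<^sup>1 f - u\<^sub>\<mu>\<parallel>\<^sup>2\<close>, and adding to it the remaining
  terms of both players gives a jointly convex functional of \<open>(f, \<mu>)\<close> whose minimisers are Nash equilibria.
  A minimiser exists by the direct method. In \<open>f\<close> the parallelogram law provides a strongly
  convergent minimising sequence; in \<open>\<mu>\<close> one needs weak-star sequential compactness of the total
  variation ball, which follows from Helly's theorem on the line after lifting measures along a
  continuous map of \<open>[0, 1]\<close> onto a set containing \<open>K\<close>.

  It remains to see that point evaluations of \<open>u = (-\<Delta>)\<^sup>-\<^sup>1 f\<close> are well defined and bounded on \<open>L\<^sup>2\<close>. For a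
  suitable mollifier \<open>\<eta>\<close> there is a test function \<open>W\<close> with \<open>\<Delta> W = \<eta> - \<eta>\<^bsub>1/2\<^esub>\<close>, where
  \<open>\<eta>\<^sub>t = t\<^bsup>-d\<^esup> \<eta>(\<cdot>/t)\<close>. By scaling, the weak equation turns the difference of the averages of \<open>u\<close> at the scales
  \<open>t\<close> and \<open>t/2\<close> into \<open>\<integral> f W\<^sub>t = O(t\<^bsup>2 - d/2\<^esup>) \<parallel>f\<parallel>\<close>. For \<open>d \<le> 3\<close> this is summable over dyadic scales, so the averages
  converge locally uniformly to a continuous representative of \<open>u\<close> (up to the factor \<open>\<integral> \<eta>\<close>).\<close>

section \<open>Smooth functions\<close>

text \<open>\<open>inv_neg_laplacian\<close> is a Hilbert choice made separately for each source, so
  nothing about its point values, not even linearity, is known before a continuous weak solution has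
  been exhibited; this is why the regularity argument carries so much of the weight.

  The function W is the difference of the Newtonian potentials of two radial charges of equal mass.
  Outside the unit ball these potentials agree, so W has compact support, and its rescaled copies
  are test functions on any ball inside \<Omega>. The exponent comes from t^(2-d) W(./t): height
  t^(2-d) on a ball of volume t^d gives the norm t^(2-d/2), at most sqrt t for d \<le> 3 and t \<le>
  1.

  The map of [0, 1] onto a set containing K has no continuous inverse. A Borel right inverse is
  enough to move measures to the interval, because only the way back has to respect limits, and that
  uses the continuous map.

  In the weak-star limit positive and negative mass may cancel, so the total variation can drop; for
  a minimisation this does no harm.\<close>

abbreviation pd :: "'a::euclidean_space \<Rightarrow> ('a \<Rightarrow> real) \<Rightarrow> 'a \<Rightarrow> real" where
  "pd i f x \<equiv> frechet_derivative f (at x) i"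

text \<open>\<open>C_k\<close> speaks of \<open>frechet_derivative\<close>, which is a Hilbert
  choice. Uniqueness of the derivative lets any explicit candidate \<open>f'\<close> take its place,
  so that inductions on \<open>k\<close> can use the ordinary rules of calculus.\<close>

lemma C_k_SucI:
  assumes "\<And>x. (f has_derivative f' x) (at x)" "\<And>i. i \<in> Basis \<Longrightarrow> C_k k (\<lambda>x. f' x i)"
  shows "C_k (Suc k) f"
proof -
  have eq: "frechet_derivative f (at x) = f' x" for x
    using frechet_derivative_at[OF assms(1)] by simp
  show ?thesis
    using assms by (auto simp: eq differentiable_on_def differentiable_def)
qed

lemma C_k_Suc_has_derivative:
  "C_k (Suc k) f \<Longrightarrow> (f has_derivative frechet_derivative f (at x)) (at x)"
  by (auto simp: differentiable_on_def frechet_derivative_works[symmetric])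

lemma C_k_Suc_pd: "C_k (Suc k) f \<Longrightarrow> i \<in> Basis \<Longrightarrow> C_k k (pd i f)"
  by auto

lemma C_k_continuous: "C_k k f \<Longrightarrow> continuous_on UNIV f"
  by (cases k) (auto intro: differentiable_imp_continuous_on)

lemma C_k_Suc_imp: "C_k (Suc k) f \<Longrightarrow> C_k k f"
proof (induction k arbitrary: f)
  case 0
  then show ?case using C_k_continuous[OF 0] by simp
next
  case (Suc k)
  then show ?case by (metis C_k.simps(2))
qed

lemma C_k_const: "C_k k (\<lambda>x. c)"
  by (induction k arbitrary: c) (auto simp: frechet_derivative_const)

lemma C_k_add: "C_k k f \<Longrightarrow> C_k k g \<Longrightarrow> C_k k (\<lambda>x. f x + g x)"
proof (induction k arbitrary: f g)
  case 0 then show ?case by (auto intro: continuous_on_add)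
next
  case (Suc k)
  show ?case
  proof (rule C_k_SucI)
    show "((\<lambda>x. f x + g x) has_derivative
        (\<lambda>h. frechet_derivative f (at x) h + frechet_derivative g (at x) h)) (at x)" for x
      by (intro has_derivative_add C_k_Suc_has_derivative[OF Suc.prems(1)]
          C_k_Suc_has_derivative[OF Suc.prems(2)])
    show "C_k k (\<lambda>x. pd i f x + pd i g x)" if "i \<in> Basis" for i
      using Suc that by auto
  qed
qed

lemma C_k_mult: "C_k k f \<Longrightarrow> C_k k g \<Longrightarrow> C_k k (\<lambda>x. f x * g x)"
proof (induction k arbitrary: f g)
  case 0 then show ?case by (auto intro: continuous_on_mult)
next
  case (Suc k)
  show ?case
  proof (rule C_k_SucI)
    show "((\<lambda>x. f x * g x) has_derivative
        (\<lambda>h. f x * frechet_derivative g (at x) h + frechet_derivative f (at x) h * g x)) (at x)" for x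
      by (intro has_derivative_mult C_k_Suc_has_derivative[OF Suc.prems(1)]
          C_k_Suc_has_derivative[OF Suc.prems(2)])
    show "C_k k (\<lambda>x. f x * pd i g x + pd i f x * g x)" if "i \<in> Basis" for i
      using that by (intro C_k_add Suc.IH C_k_Suc_imp[OF Suc.prems(1)] C_k_Suc_imp[OF Suc.prems(2)]
          C_k_Suc_pd[OF Suc.prems(1)] C_k_Suc_pd[OF Suc.prems(2)])
  qed
qed

lemma C_k_inner: "C_k k (\<lambda>x. x \<bullet> v)"
proof (cases k)
  case 0 then show ?thesis by (auto intro!: continuous_intros)
next
  case (Suc l)
  show ?thesis unfolding Suc
    by (rule C_k_SucI[where f' = "\<lambda>x h. h \<bullet> v"])
      (auto intro!: derivative_eq_intros C_k_const)
qed

lemma C_k_sum: "(\<And>i. i \<in> I \<Longrightarrow> C_k k (f i)) \<Longrightarrow> C_k k (\<lambda>x. \<Sum>i\<in>I. f i x)"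
  by (induction I rule: infinite_finite_induct) (auto intro: C_k_const C_k_add)

definition smooth :: "('a::euclidean_space \<Rightarrow> real) \<Rightarrow> bool" where
  "smooth f \<longleftrightarrow> (\<forall>k. C_k k f)"

lemma smooth_const [intro]: "smooth (\<lambda>x. c)"
  and smooth_add [intro]: "smooth f \<Longrightarrow> smooth g \<Longrightarrow> smooth (\<lambda>x. f x + g x)"
  and smooth_mult [intro]: "smooth f \<Longrightarrow> smooth g \<Longrightarrow> smooth (\<lambda>x. f x * g x)"
  and smooth_inner [intro]: "smooth (\<lambda>x. x \<bullet> v)"
  by (auto simp: smooth_def C_k_const C_k_add C_k_mult C_k_inner)

lemma smooth_sum [intro]: "(\<And>i. i \<in> I \<Longrightarrow> smooth (f i)) \<Longrightarrow> smooth (\<lambda>x. \<Sum>i\<in>I. f i x)"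
  by (auto simp: smooth_def intro: C_k_sum)

lemma smooth_cmult [intro]: "smooth f \<Longrightarrow> smooth (\<lambda>x. c * f x)"
  by (intro smooth_mult smooth_const)

lemma smooth_minus [intro]: "smooth f \<Longrightarrow> smooth (\<lambda>x. - f x)"
  using smooth_cmult[of f "-1"] by simp

lemma smooth_diff [intro]: "smooth f \<Longrightarrow> smooth g \<Longrightarrow> smooth (\<lambda>x. f x - g x)"
  using smooth_add[OF _ smooth_minus, of f g] by simp

lemma smooth_inner_self [intro]: "smooth (\<lambda>x. x \<bullet> x)"
proof -
  have "smooth (\<lambda>x::'a. \<Sum>i\<in>Basis. (x \<bullet> i) * (x \<bullet> i))"
    by (intro smooth_sum smooth_mult smooth_inner)
  then show ?thesis by (simp add: euclidean_inner[symmetric])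
qed

lemma smooth_pd [intro]: "smooth f \<Longrightarrow> i \<in> Basis \<Longrightarrow> smooth (pd i f)"
  unfolding smooth_def using C_k_Suc_pd by blast

lemma smooth_has_derivative:
  "smooth f \<Longrightarrow> (f has_derivative frechet_derivative f (at x)) (at x)"
  unfolding smooth_def using C_k_Suc_has_derivative by blast

lemma smooth_continuous: "smooth f \<Longrightarrow> continuous_on S f"
  unfolding smooth_def using C_k_continuous continuous_on_subset by blast

lemma smoothI:
  assumes "\<And>x. (f has_derivative f' x) (at x)" "\<And>i. i \<in> Basis \<Longrightarrow> smooth (\<lambda>x. f' x i)"
  shows "smooth f"
proof -
  have "C_k (Suc k) f" for k
    using assms by (intro C_k_SucI) (auto simp: smooth_def)
  then show ?thesis unfolding smooth_def using C_k_Suc_imp by blast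
qed

lemma smooth_affine:
  fixes f :: "'a::euclidean_space \<Rightarrow> real"
  assumes "smooth f"
  shows "smooth (\<lambda>x. f (c *\<^sub>R x + v))"
    and "i \<in> Basis \<Longrightarrow> pd i (\<lambda>x. f (c *\<^sub>R x + v)) x = c * pd i f (c *\<^sub>R x + v)"
proof -
  have der: "((\<lambda>x. f (c *\<^sub>R x + v)) has_derivative
      (\<lambda>h. frechet_derivative f (at (c *\<^sub>R x + v)) (c *\<^sub>R h))) (at x)"
    if "(f has_derivative frechet_derivative f (at (c *\<^sub>R x + v))) (at (c *\<^sub>R x + v))"
    for f :: "'a \<Rightarrow> real" and x
    by (rule has_derivative_compose[of "\<lambda>x. c *\<^sub>R x + v"]) (auto intro!: derivative_eq_intros that)
  have lin: "frechet_derivative f (at y) (c *\<^sub>R h) = c * frechet_derivative f (at y) h"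
    if "(f has_derivative frechet_derivative f (at y)) (at y)" for f :: "'a \<Rightarrow> real" and y h
    using linear_cmul[OF has_derivative_linear[OF that]] by simp
  have "C_k k (\<lambda>x. f (c *\<^sub>R x + v))" if "C_k k f" for k f
    using that
  proof (induction k arbitrary: f)
    case 0
    then show ?case
      by (auto intro!: continuous_on_compose2[of UNIV f] continuous_intros)
  next
    case (Suc k)
    note d = C_k_Suc_has_derivative[OF Suc.prems]
    show ?case
    proof (rule C_k_SucI[OF der[OF d]])
      show "C_k k (\<lambda>x. frechet_derivative f (at (c *\<^sub>R x + v)) (c *\<^sub>R i))" if "i \<in> Basis" for i
        unfolding lin[OF d] using Suc that by (intro C_k_mult C_k_const) auto
    qed
  qed
  then show "smooth (\<lambda>x. f (c *\<^sub>R x + v))"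
    using assms by (auto simp: smooth_def)
  show "pd i (\<lambda>x. f (c *\<^sub>R x + v)) x = c * pd i f (c *\<^sub>R x + v)"
    using frechet_derivative_at[OF der[OF smooth_has_derivative[OF assms]]]
      lin[OF smooth_has_derivative[OF assms]] by metis
qed

lemma smooth_powr:
  assumes "smooth g" "\<And>x. g x > 0"
  shows "smooth (\<lambda>x. g x powr r)"
proof -
  \<comment> \<open>The exponent stays free in the induction, since each derivative lowers it by
    one.\<close>
  have "C_k k (\<lambda>x. g x powr r)" for k r
  proof (induction k arbitrary: r)
    case 0
    show ?case using smooth_continuous[OF assms(1)] assms(2)
      by (auto intro!: continuous_on_powr continuous_on_const simp: less_imp_neq[THEN not_sym])
  next
    case (Suc k)
    show ?case
    proof (rule C_k_SucI)
      fix x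
      have "((\<lambda>y. y powr r) has_real_derivative r * g x powr (r - 1)) (at (g x))"
        using assms(2)[of x] by (auto intro!: derivative_eq_intros)
      then have "((\<lambda>y. y powr r) has_derivative (\<lambda>h. r * g x powr (r - 1) * h)) (at (g x))"
        by (simp add: has_field_derivative_def)
      from has_derivative_compose[OF smooth_has_derivative[OF assms(1)] this]
      show "((\<lambda>x. g x powr r) has_derivative
         (\<lambda>h. r * g x powr (r - 1) * frechet_derivative g (at x) h)) (at x)" .
    next
      show "C_k k (\<lambda>x. r * g x powr (r - 1) * pd i g x)" if "i \<in> Basis" for i
        using smooth_pd[OF assms(1) that] by (intro C_k_mult C_k_const Suc.IH) (auto simp: smooth_def)
    qed
  qed
  then show ?thesis by (simp add: smooth_def)
qed

text \<open>The poles \<open>s ^ n\<close> close the family under differentiation: the derivative of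
  a member is a combination of the next two. Smoothness is thus one induction over the whole family
  instead of a formula for higher derivatives.\<close>

definition bump :: "nat \<Rightarrow> real \<Rightarrow> real" where
  "bump n s = (if s > 0 then exp (- (1 / s)) / s ^ n else 0)"

lemma bump_pos_iff: "bump n s > 0 \<longleftrightarrow> s > 0"
  and bump_nonneg: "bump n s \<ge> 0"
  by (auto simp: bump_def)

text \<open>With y = 1/h this is the decay of y^n / exp y at infinity.\<close>

lemma bump_pole_limit: "((\<lambda>h::real. exp (- (1 / h)) / h ^ n) \<longlongrightarrow> 0) (at_right 0)"
proof -
  have "((\<lambda>y::real. y ^ n / exp y) \<longlongrightarrow> 0) at_top"
    by (rule tendsto_power_div_exp_0)
  then have "((\<lambda>h::real. inverse h ^ n / exp (inverse h)) \<longlongrightarrow> 0) (at_right 0)"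
    by (rule filterlim_compose[OF _ filterlim_inverse_at_top_right])
  then show ?thesis
    by (simp add: field_simps exp_minus)
qed

lemma bump_has_derivative:
  "(bump n has_real_derivative bump (n + 2) s - real n * bump (n + 1) s) (at s)"
proof -
  consider "s > 0" | "s < 0" | "s = 0" by linarith
  then show ?thesis
  proof cases
    case 1
    have pw: "((\<lambda>s. inverse s ^ n) has_real_derivative - (real n * inverse s ^ (n + 1))) (at s)"
    proof (cases n)
      case (Suc m)
      show ?thesis
        using DERIV_power_Suc[OF DERIV_inverse[of s UNIV], of m] 1 by (simp add: Suc algebra_simps)
    qed simp
    have e: "((\<lambda>s. exp (- (1 / s))) has_real_derivative exp (- (1 / s)) * inverse s ^ 2) (at s)"
      using 1 by (auto intro!: derivative_eq_intros simp: field_simps power2_eq_square)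
    have "((\<lambda>s. exp (- (1 / s)) / s ^ n) has_real_derivative
        exp (- (1 / s)) / s ^ (n + 2) - real n * (exp (- (1 / s)) / s ^ (n + 1))) (at s)"
      using DERIV_mult[OF e pw] 1
      by (simp add: field_simps power2_eq_square)
    moreover have "eventually (\<lambda>t. bump n t = exp (- (1 / t)) / t ^ n) (nhds s)"
      using 1 by (auto simp: bump_def intro!: eventually_nhds_in_open[of "{0<..}", THEN eventually_mono])
    ultimately show ?thesis
      using 1 by (subst DERIV_cong_ev[OF refl _ refl, of _ "\<lambda>s. exp (- (1 / s)) / s ^ n"])
         (auto simp: bump_def)
  next
    case 2
    have "eventually (\<lambda>t. bump n t = 0) (nhds s)"
      using 2 by (auto simp: bump_def intro!: eventually_nhds_in_open[of "{..<0}", THEN eventually_mono])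
    then show ?thesis
      using 2 by (subst DERIV_cong_ev[OF refl _ refl, of _ "\<lambda>s. 0"]) (auto simp: bump_def)
  next
    case 3
    have "((\<lambda>h. bump n h / h) \<longlongrightarrow> 0) (at_left 0)"
      by (rule tendsto_eventually) (auto simp: bump_def eventually_at_filter)
    \<comment> \<open>Dividing by \<open>h\<close> only raises the order of the pole by one, so the
      limit is the one for \<open>Suc n\<close>.\<close>
    moreover have "((\<lambda>h. bump n h / h) \<longlongrightarrow> 0) (at_right 0)"
      by (rule Lim_transform_eventually[OF bump_pole_limit[of "Suc n"]])
        (auto simp: bump_def eventually_at_filter)
    ultimately have "((\<lambda>h. bump n h / h) \<longlongrightarrow> 0) (at 0)"
      by (simp add: filterlim_at_split)
    then show ?thesis using 3 by (simp add: DERIV_def bump_def)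
  qed
qed

lemma smooth_bump:
  assumes "smooth g"
  shows "smooth (\<lambda>x. bump n (g x))"
proof -
  have "C_k k (\<lambda>x. bump n (g x))" for k n
  proof (induction k arbitrary: n)
    case 0
    have "continuous_on UNIV (bump n)"
      using bump_has_derivative DERIV_isCont continuous_at_imp_continuous_on by blast
    then show ?case using smooth_continuous[OF assms]
      by (auto intro: continuous_on_compose2)
  next
    case (Suc k)
    show ?case
    proof (rule C_k_SucI)
      fix x
      have "(bump n has_derivative (\<lambda>h. (bump (n + 2) (g x) - real n * bump (n + 1) (g x)) * h)) (at (g x))"
        using bump_has_derivative by (simp add: has_field_derivative_def)
      from has_derivative_compose[OF smooth_has_derivative[OF assms] this]
      show "((\<lambda>x. bump n (g x)) has_derivative
         (\<lambda>h. (bump (n + 2) (g x) + (- real n) * bump (n + 1) (g x)) * frechet_derivative g (at x) h)) (at x)"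
        by simp
    next
      show "C_k k (\<lambda>x. (bump (n + 2) (g x) + (- real n) * bump (n + 1) (g x)) * pd i g x)" if "i \<in> Basis" for i
        using smooth_pd[OF assms that] by (intro C_k_mult C_k_add C_k_const Suc.IH) (auto simp: smooth_def)
    qed
  qed
  then show ?thesis by (simp add: smooth_def)
qed

section \<open>Test functions and integration by parts\<close>

lemma test_functionsI:
  assumes "smooth f" "compact S" "S \<subseteq> \<Omega>" "\<And>x. x \<notin> S \<Longrightarrow> f x = 0"
  shows "f \<in> test_functions \<Omega>"
proof -
  have "closure {x. f x \<noteq> 0} \<subseteq> S"
    using assms by (intro closure_minimal compact_imp_closed) auto
  moreover have "compact (closure {x. f x \<noteq> 0})"
    using calculation assms(2) by (metis closed_Int_compact closed_closure inf.absorb1)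
  ultimately show ?thesis
    using assms unfolding test_functions_def smooth_def by blast
qed

lemma test_functionsE:
  assumes "f \<in> test_functions \<Omega>"
  obtains S where "smooth f" "compact S" "S \<subseteq> \<Omega>" "\<And>x. x \<notin> S \<Longrightarrow> f x = 0"
proof
  show "smooth f" "compact (closure {x. f x \<noteq> 0})" "closure {x. f x \<noteq> 0} \<subseteq> \<Omega>"
    using assms by (auto simp: test_functions_def smooth_def)
  show "f x = 0" if "x \<notin> closure {x. f x \<noteq> 0}" for x
    using that closure_subset[of "{x. f x \<noteq> 0}"] by auto
qed

lemma test_functions_smooth: "f \<in> test_functions \<Omega> \<Longrightarrow> smooth f"
  by (auto elim: test_functionsE)

lemma test_functions_mono: "\<Omega> \<subseteq> \<Omega>' \<Longrightarrow> f \<in> test_functions \<Omega> \<Longrightarrow> f \<in> test_functions \<Omega>'"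
  by (auto simp: test_functions_def)

lemma test_functions_outside: "f \<in> test_functions \<Omega> \<Longrightarrow> x \<notin> \<Omega> \<Longrightarrow> f x = 0"
  by (metis test_functionsE subsetD)

lemma test_functions_zero: "(\<lambda>x. 0) \<in> test_functions \<Omega>"
  by (rule test_functionsI[of _ "{}"]) auto

lemma test_functions_add:
  assumes "f \<in> test_functions \<Omega>" "g \<in> test_functions \<Omega>"
  shows "(\<lambda>x. f x + g x) \<in> test_functions \<Omega>"
proof -
  obtain S where S: "smooth f" "compact S" "S \<subseteq> \<Omega>" "\<And>x. x \<notin> S \<Longrightarrow> f x = 0"
    using test_functionsE[OF assms(1)] by metis
  obtain T where T: "smooth g" "compact T" "T \<subseteq> \<Omega>" "\<And>x. x \<notin> T \<Longrightarrow> g x = 0"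
    using test_functionsE[OF assms(2)] by metis
  show ?thesis
    using S T by (intro test_functionsI[of _ "S \<union> T"]) auto
qed

lemma test_functions_mult:
  assumes "f \<in> test_functions \<Omega>" "smooth g"
  shows "(\<lambda>x. g x * f x) \<in> test_functions \<Omega>"
proof -
  obtain S where S: "smooth f" "compact S" "S \<subseteq> \<Omega>" "\<And>x. x \<notin> S \<Longrightarrow> f x = 0"
    using test_functionsE[OF assms(1)] by metis
  then show ?thesis
    using assms(2) by (intro test_functionsI[of _ S]) auto
qed

lemma test_functions_cmult: "f \<in> test_functions \<Omega> \<Longrightarrow> (\<lambda>x. c * f x) \<in> test_functions \<Omega>"
  by (rule test_functions_mult) auto

lemma test_functions_diff:
  assumes "f \<in> test_functions \<Omega>" "g \<in> test_functions \<Omega>"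
  shows "(\<lambda>x. f x - g x) \<in> test_functions \<Omega>"
  using test_functions_add[OF assms(1) test_functions_cmult[OF assms(2), of "-1"]] by simp

lemma frechet_derivative_zero_outside:
  assumes "closed S" "\<And>x. x \<notin> S \<Longrightarrow> f x = (0::real)" "x \<notin> S"
  shows "frechet_derivative f (at x) = (\<lambda>h. 0)"
proof -
  have "(f has_derivative (\<lambda>h. 0)) (at x)"
    using has_derivative_transform_within_open[of "\<lambda>_. 0" "\<lambda>_. 0" x UNIV "- S" f] assms
    by (simp add: open_Compl)
  then show ?thesis using frechet_derivative_at by metis
qed

lemma test_functions_pd:
  assumes "f \<in> test_functions \<Omega>" "i \<in> Basis"
  shows "pd i f \<in> test_functions \<Omega>"
proof -
  obtain S where S: "smooth f" "compact S" "S \<subseteq> \<Omega>" "\<And>x. x \<notin> S \<Longrightarrow> f x = 0"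
    using test_functionsE[OF assms(1)] by metis
  show ?thesis
    using S assms(2) frechet_derivative_zero_outside[of S f]
    by (intro test_functionsI[of _ S]) (auto simp: compact_imp_closed)
qed

lemma test_functions_bounded:
  assumes "f \<in> test_functions \<Omega>"
  obtains B where "B \<ge> 0" "\<And>x. \<bar>f x\<bar> \<le> B"
proof -
  obtain S where S: "smooth f" "compact S" "S \<subseteq> \<Omega>" "\<And>x. x \<notin> S \<Longrightarrow> f x = 0"
    using test_functionsE[OF assms(1)] by metis
  have "bounded (f ` S)"
    using S smooth_continuous by (blast intro: compact_imp_bounded compact_continuous_image)
  then obtain B where "B > 0" "\<And>x. x \<in> S \<Longrightarrow> \<bar>f x\<bar> \<le> B"
    by (auto simp: bounded_pos)
  then show thesis using S(4) by (intro that[of B]) (smt (verit))+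
qed

lemma smooth_borel_measurable: "smooth f \<Longrightarrow> f \<in> borel_measurable borel"
  by (intro borel_measurable_continuous_onI smooth_continuous)

text \<open>The bridge from the measure used in the definitions to \<open>lborel\<close>, where
  translation, scaling and Fubini are carried out.\<close>

lemma integral_lebesgue_on_eq_lborel:
  fixes f :: "'a::euclidean_space \<Rightarrow> real"
  assumes "\<Omega> \<in> sets lebesgue" "f \<in> borel_measurable borel" "\<And>x. x \<notin> \<Omega> \<Longrightarrow> f x = 0"
  shows "integral\<^sup>L (lebesgue_on \<Omega>) f = integral\<^sup>L lborel f"
proof -
  have "integral\<^sup>L (lebesgue_on \<Omega>) f = integral\<^sup>L lebesgue (\<lambda>x. indicator \<Omega> x *\<^sub>R f x)"
    using assms(1) by (intro integral_restrict_space) auto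
  also have "(\<lambda>x. indicator \<Omega> x *\<^sub>R f x) = f"
    using assms(3) by (auto simp: fun_eq_iff indicator_def)
  also have "integral\<^sup>L lebesgue f = integral\<^sup>L lborel f"
    using assms(2) by (intro integral_completion) auto
  finally show ?thesis .
qed

lemma test_functions_integrable:
  assumes "f \<in> test_functions \<Omega>"
  shows "integrable lborel f"
proof -
  obtain S where S: "smooth f" "compact S" "S \<subseteq> \<Omega>" "\<And>x. x \<notin> S \<Longrightarrow> f x = 0"
    using test_functionsE[OF assms(1)] by metis
  have "integrable lborel (\<lambda>x. indicator S x *\<^sub>R f x)"
    using S by (intro borel_integrable_compact smooth_continuous)
  also have "(\<lambda>x. indicator S x *\<^sub>R f x) = f"
    using S(4) by (auto simp: fun_eq_iff indicator_def)
  finally show ?thesis .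
qed

lemma smooth_directional_deriv:
  fixes f :: "'a::euclidean_space \<Rightarrow> real"
  assumes "smooth f"
  shows "((\<lambda>t. f (x + t *\<^sub>R i)) has_real_derivative pd i f (x + t *\<^sub>R i)) (at t)"
proof -
  have 1: "((\<lambda>t. x + t *\<^sub>R i) has_derivative (\<lambda>h. h *\<^sub>R i)) (at t)"
    by (auto intro!: derivative_eq_intros)
  have "((\<lambda>t. f (x + t *\<^sub>R i)) has_derivative (\<lambda>h. frechet_derivative f (at (x + t *\<^sub>R i)) (h *\<^sub>R i))) (at t)"
    by (rule has_derivative_compose[OF 1 smooth_has_derivative[OF assms]])
  moreover have "frechet_derivative f (at (x + t *\<^sub>R i)) (h *\<^sub>R i) = pd i f (x + t *\<^sub>R i) * h" for h
    using linear_cmul[OF has_derivative_linear[OF smooth_has_derivative[OF assms]]] by simp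
  ultimately show ?thesis
    by (simp add: has_field_derivative_def)
qed

text \<open>By translation invariance every difference quotient of \<open>f\<close> has integral
  zero, and the quotients converge boundedly on a fixed ball. All integrations by parts below rest
  on this.\<close>

lemma integral_pd_test_function:
  fixes f :: "'a::euclidean_space \<Rightarrow> real"
  assumes f: "f \<in> test_functions \<Omega>" and i: "i \<in> Basis"
  shows "integral\<^sup>L lborel (pd i f) = 0"
proof -
  obtain S where S: "smooth f" "compact S" "S \<subseteq> \<Omega>" "\<And>x. x \<notin> S \<Longrightarrow> f x = 0"
    using test_functionsE[OF assms(1)] by metis
  obtain B where B: "B \<ge> 0" "\<And>x. \<bar>pd i f x\<bar> \<le> B"
    using test_functions_bounded[OF test_functions_pd[OF f i]] by metis
  obtain r where r: "\<And>x. x \<in> S \<Longrightarrow> norm x \<le> r"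
    using compact_imp_bounded[OF S(2)] by (auto simp: bounded_iff)
  define h where "h n = 1 / real (Suc n)" for n
  have h: "h n > 0" "h n \<le> 1" for n by (auto simp: h_def)
  have h0: "h \<longlonglongrightarrow> 0" unfolding h_def using LIMSEQ_inverse_real_of_nat
    by (simp add: inverse_eq_divide)
  define q where "q n x = (f (x + h n *\<^sub>R i) - f x) / h n" for n x
  have [measurable]: "f \<in> borel_measurable borel" "pd i f \<in> borel_measurable borel"
    using S(1) i by (auto intro: smooth_borel_measurable)
  have q0: "integral\<^sup>L lborel (q n) = 0" for n
  proof -
    have "integral\<^sup>L lborel f = integral\<^sup>L (distr lborel borel ((+) (h n *\<^sub>R i))) f"
      by (simp only: lborel_distr_plus)
    also have "\<dots> = integral\<^sup>L lborel (\<lambda>x. f (h n *\<^sub>R i + x))"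
      by (rule integral_distr) measurable
    finally have "integral\<^sup>L lborel (\<lambda>x. f (h n *\<^sub>R i + x)) = integral\<^sup>L lborel f" ..
    moreover have "integrable (distr lborel borel ((+) (h n *\<^sub>R i))) f"
      using test_functions_integrable[OF f] by (simp only: lborel_distr_plus)
    then have "integrable lborel (\<lambda>x. f (h n *\<^sub>R i + x))"
      by (subst (asm) integrable_distr_eq) measurable
    ultimately show ?thesis
      using test_functions_integrable[OF f] by (simp add: q_def[abs_def] add.commute)
  qed
  have "(\<lambda>n. integral\<^sup>L lborel (q n)) \<longlonglongrightarrow> integral\<^sup>L lborel (pd i f)"
  \<comment> \<open>The increments \<open>h n\<close> are at most 1, so enlarging the radius
    \<open>r\<close> of the support by 1 covers all translates; the mean value theorem bounds the
    quotients by \<open>B\<close>.\<close>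
  proof (rule integral_dominated_convergence[where w = "\<lambda>x. indicator (cball 0 (r + 1)) x * B"])
    show "integrable lborel (\<lambda>x::'a. indicator (cball 0 (r + 1)) x * B)"
      by (intro integrable_mult_left integrable_real_indicator)
        (auto simp: emeasure_lborel_cball_finite[unfolded infinity_ennreal_def])
    show "AE x in lborel. (\<lambda>n. q n x) \<longlonglongrightarrow> pd i f x"
    proof (rule AE_I2)
      fix x
      have "((\<lambda>t. (f (x + t *\<^sub>R i) - f x) / t) \<longlongrightarrow> pd i f x) (at 0)"
        using smooth_directional_deriv[OF S(1), of x i 0] by (simp add: DERIV_def)
      moreover have "filterlim h (at 0) sequentially"
        using h0 h(1) by (auto simp: filterlim_at less_imp_neq[THEN not_sym])
      ultimately show "(\<lambda>n. q n x) \<longlonglongrightarrow> pd i f x"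
        unfolding q_def by (rule filterlim_compose)
    qed
    show "AE x in lborel. norm (q n x) \<le> indicator (cball 0 (r + 1)) x * B" for n
    proof (rule AE_I2)
      fix x
      show "norm (q n x) \<le> indicator (cball 0 (r + 1)) x * B"
      proof (cases "norm x \<le> r + 1")
        case True
        obtain z where "f (x + h n *\<^sub>R i) - f (x + 0 *\<^sub>R i) = (h n - 0) * pd i f (x + z *\<^sub>R i)"
          using MVT2[OF h(1)[of n], of "\<lambda>t. f (x + t *\<^sub>R i)" "\<lambda>t. pd i f (x + t *\<^sub>R i)"]
            smooth_directional_deriv[OF S(1)] by blast
        then have "q n x = pd i f (x + z *\<^sub>R i)" using h(1)[of n] by (simp add: q_def)
        then show ?thesis using B(2) True by simp
      next
        case False
        have "norm (x + h n *\<^sub>R i) > r"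
          using norm_triangle_ineq4[of "x + h n *\<^sub>R i" "h n *\<^sub>R i"] False h[of n] i by simp
        then have "f (x + h n *\<^sub>R i) = 0" "f x = 0"
          using False r S(4) by force+
        then show ?thesis using B(1) by (simp add: q_def)
      qed
    qed
    show "q n \<in> borel_measurable lborel" for n
      unfolding q_def by measurable
  qed auto
  then show ?thesis using q0 by (simp add: LIMSEQ_const_iff)
qed

lemma pd_mult:
  assumes "smooth f" "smooth g"
  shows "pd i (\<lambda>x. f x * g x) x = f x * pd i g x + pd i f x * g x"
  using frechet_derivative_at[OF has_derivative_mult[OF smooth_has_derivative[OF assms(1)]
    smooth_has_derivative[OF assms(2)]], of x] by metis

lemma pd_add:
  assumes "smooth f" "smooth g"
  shows "pd i (\<lambda>x. f x + g x) x = pd i f x + pd i g x"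
  using frechet_derivative_at[OF has_derivative_add[OF smooth_has_derivative[OF assms(1)]
    smooth_has_derivative[OF assms(2)]], of x] by metis

lemma pd_cmult:
  assumes "smooth f"
  shows "pd i (\<lambda>x. c * f x) x = c * pd i f x"
  using pd_mult[OF smooth_const[of c] assms, where i = i and x = x] by (simp add: frechet_derivative_const)

lemma pd_diff:
  assumes "smooth f" "smooth g"
  shows "pd i (\<lambda>x. f x - g x) x = pd i f x - pd i g x"
  using pd_add[OF assms(1) smooth_cmult[OF assms(2), of "-1"], where i = i and x = x] pd_cmult[OF assms(2), where c = "-1"] by simp

section \<open>The fundamental lemma of the calculus of variations\<close>

lemma smooth_bump_ball: "smooth (\<lambda>z. bump n (r\<^sup>2 - (norm (z - c))\<^sup>2))"
proof -
  have "smooth (\<lambda>z. (1 *\<^sub>R z + (- c)) \<bullet> (1 *\<^sub>R z + (- c)))"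
    by (rule smooth_affine(1)[OF smooth_inner_self])
  then have "smooth (\<lambda>z. (norm (z - c))\<^sup>2)"
    by (simp add: power2_norm_eq_inner)
  then show ?thesis by (intro smooth_bump smooth_diff smooth_const)
qed

text \<open>\<open>U\<close> is a countable union of balls, each carrying a bump. The partial sums s
  of the bumps need no normalisation: n s / (1 + n s) lies in [0, 1], and it tends to 1 as soon as
  some bump is positive at the point.\<close>

lemma open_indicator_limit_test_functions:
  fixes U :: "'a::euclidean_space set"
  assumes "open U"
  obtains \<phi> where "\<And>n::nat. \<phi> n \<in> test_functions U" "\<And>n x. 0 \<le> \<phi> n x" "\<And>n x. \<phi> n x \<le> 1"
    "\<And>x. (\<lambda>n. \<phi> n x) \<longlonglongrightarrow> indicat_real U x"
proof (cases "U = {}")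
  case True
  then show thesis using test_functions_zero by (intro that[of "\<lambda>n x. 0"]) auto
next
  case False
  \<comment> \<open>The closed balls have to lie in \<open>U\<close>, so that finite unions of them
    are compact supports inside \<open>U\<close>.\<close>
  define F where "F = {(c, r). r > 0 \<and> cball c r \<subseteq> U}"
  have U: "U = \<Union>((\<lambda>(c, r). ball c r) ` F)"
    using open_contains_cball[of U] assms ball_subset_cball by (fastforce simp: F_def)
  obtain \<F> where \<F>: "\<F> \<subseteq> (\<lambda>(c, r). ball c r) ` F" "countable \<F>" "\<Union>\<F> = U"
    using Lindelof[of "(\<lambda>(c, r). ball c r) ` F"] U by force
  obtain F' where F': "countable F'" "F' \<subseteq> F" "\<F> = (\<lambda>(c, r). ball c r) ` F'"
    using countable_image_eq \<F>(1,2) countable_subset_image by metis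
  have ne: "F' \<noteq> {}" using False \<F>(3) F'(3) by auto
  define p where "p = from_nat_into F'"
  have p: "range p = F'" unfolding p_def using F'(1) ne by (simp add: range_from_nat_into)
  define b where "b i z = bump 0 ((snd (p i))\<^sup>2 - (norm (z - fst (p i)))\<^sup>2)" for i z
  have pF: "snd (p i) > 0" "cball (fst (p i)) (snd (p i)) \<subseteq> U" for i
  proof -
    have "p i \<in> F" using p F'(2) by auto
    then show "snd (p i) > 0" "cball (fst (p i)) (snd (p i)) \<subseteq> U"
      unfolding F_def by (auto simp: case_prod_beta)
  qed
  have b_pos: "b i z > 0 \<longleftrightarrow> z \<in> ball (fst (p i)) (snd (p i))" for i z
  proof -
    have "(norm (z - fst (p i)))\<^sup>2 < (snd (p i))\<^sup>2 \<longleftrightarrow> norm (z - fst (p i)) < snd (p i)"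
      using pF(1)[of i] power2_less_imp_less[of "norm (z - fst (p i))" "snd (p i)"]
        power_strict_mono[of "norm (z - fst (p i))" "snd (p i)" 2] by auto
    then show ?thesis by (auto simp: b_def bump_pos_iff dist_norm norm_minus_commute)
  qed
  have b0: "b i z \<ge> 0" for i z by (simp add: b_def bump_nonneg)
  define s where "s n z = (\<Sum>i<n. b i z)" for n z
  have s0: "s n z \<ge> 0" for n z unfolding s_def by (intro sum_nonneg b0)
  \<comment> \<open>The power -1 in place of a quotient makes \<open>smooth_powr\<close>
    applicable.\<close>
  define \<phi> where "\<phi> n z = (real n * s n z) * (1 + real n * s n z) powr (-1)" for n z
  have pos: "1 + real n * s n z > 0" for n z
    using s0[of n z] by (simp add: add_pos_nonneg)
  have \<phi>_eq: "\<phi> n z = 1 - 1 / (1 + real n * s n z)" for n z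
    using pos[of n z] by (simp add: \<phi>_def powr_minus_divide field_simps)
  have sm: "smooth (s n)" for n
    unfolding s_def b_def by (intro smooth_sum smooth_bump_ball)
  show thesis
  proof
    show "\<phi> n \<in> test_functions U" for n
    proof (rule test_functionsI[of _ "\<Union>i<n. cball (fst (p i)) (snd (p i))"])
      show "smooth (\<phi> n)" unfolding \<phi>_def using pos
        by (intro smooth_mult smooth_powr smooth_add smooth_cmult sm smooth_const) auto
      show "(\<Union>i<n. cball (fst (p i)) (snd (p i))) \<subseteq> U" using pF by auto
      fix x assume "x \<notin> (\<Union>i<n. cball (fst (p i)) (snd (p i)))"
      then have "b i x = 0" if "i < n" for i
        using that b_pos[of i x] b0[of i x] ball_subset_cball by fastforce
      then show "\<phi> n x = 0" by (simp add: \<phi>_def s_def)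
    qed auto
    show "0 \<le> \<phi> n x" "\<phi> n x \<le> 1" for n x
      using pos[of n x] s0[of n x] by (auto simp: \<phi>_eq)
    show "(\<lambda>n. \<phi> n x) \<longlonglongrightarrow> indicat_real U x" for x
    proof (cases "x \<in> U")
      case True
      then obtain i where i: "b i x > 0"
        using b_pos \<F>(3) F'(3) p by (auto simp: image_iff) (metis fst_conv snd_conv rangeE)
      have "(\<lambda>n. 1 / (1 + real n * s n x)) \<longlonglongrightarrow> 0"
      proof (rule tendsto_sandwich[OF _ _ tendsto_const])
        show "(\<lambda>n. 1 / (1 + real n * b i x)) \<longlonglongrightarrow> 0"
          using i by real_asymp
        show "\<forall>\<^sub>F n in sequentially. 1 / (1 + real n * s n x) \<le> 1 / (1 + real n * b i x)"
          using eventually_gt_at_top[of i]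
        proof eventually_elim
          case (elim n)
          have "b i x \<le> s n x" unfolding s_def using elim b0 by (intro member_le_sum) auto
          then show ?case using i by (intro frac_le) (auto intro!: add_pos_nonneg mult_left_mono)
        qed
        show "\<forall>\<^sub>F n in sequentially. 0 \<le> 1 / (1 + real n * s n x)"
          using pos less_imp_le by (intro always_eventually) auto
      qed
      then have "(\<lambda>n. 1 - 1 / (1 + real n * s n x)) \<longlonglongrightarrow> 1 - 0" by (intro tendsto_intros)
      then show ?thesis using True by (simp add: \<phi>_eq)
    next
      case False
      then have "b i x = 0" for i
        using b_pos[of i x] b0[of i x] pF(2)[of i] ball_subset_cball by fastforce
      then show ?thesis using False by (simp add: \<phi>_def s_def)
    qed
  qed
qed

text \<open>The hypothesis passes from test functions to indicators of open sets and then, by outer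
  regularity, to a countable intersection of open sets that differs from the set where
  \<open>g\<close> is positive by a null set. Hence the positive part of \<open>g\<close> has
  integral zero.\<close>

lemma fundamental_lemma_le:
  fixes g :: "'a::euclidean_space \<Rightarrow> real"
  assumes "open \<Omega>" and g: "integrable (lebesgue_on \<Omega>) g"
    and 0: "\<And>\<phi>. \<phi> \<in> test_functions \<Omega> \<Longrightarrow> integral\<^sup>L (lebesgue_on \<Omega>) (\<lambda>x. g x * \<phi> x) = 0"
  shows "AE x in lebesgue_on \<Omega>. g x \<le> 0"
proof -
  have \<Omega>: "\<Omega> \<in> sets lebesgue" using assms(1) by (simp add: lborelD)
  note [measurable] = borel_measurable_integrable[OF g]
  have meas: "f \<in> borel_measurable (lebesgue_on \<Omega>)" if "f \<in> borel_measurable borel" for f :: "'a \<Rightarrow> real"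
    using that by (simp add: measurable_completion measurable_restrict_space1)
  have open0: "integral\<^sup>L (lebesgue_on \<Omega>) (\<lambda>x. g x * indicator U x) = 0" if U: "open U" "U \<subseteq> \<Omega>" for U
  proof -
    obtain \<phi> where \<phi>: "\<And>n::nat. \<phi> n \<in> test_functions U" "\<And>n x. 0 \<le> \<phi> n x" "\<And>n x. \<phi> n x \<le> 1"
      "\<And>x. (\<lambda>n. \<phi> n x) \<longlonglongrightarrow> indicat_real U x"
      using open_indicator_limit_test_functions[OF U(1)] by metis
    have [measurable]: "\<phi> n \<in> borel_measurable (lebesgue_on \<Omega>)" for n
      using \<phi>(1) test_functions_smooth by (intro meas smooth_borel_measurable) blast
    have [measurable]: "indicat_real U \<in> borel_measurable (lebesgue_on \<Omega>)"
      using U by (intro meas) auto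
    have "(\<lambda>n. integral\<^sup>L (lebesgue_on \<Omega>) (\<lambda>x. g x * \<phi> n x))
        \<longlonglongrightarrow> integral\<^sup>L (lebesgue_on \<Omega>) (\<lambda>x. g x * indicator U x)"
    proof (rule integral_dominated_convergence[where w = "\<lambda>x. \<bar>g x\<bar>"])
      show "integrable (lebesgue_on \<Omega>) (\<lambda>x. \<bar>g x\<bar>)" using g by simp
      show "AE x in lebesgue_on \<Omega>. (\<lambda>n. g x * \<phi> n x) \<longlonglongrightarrow> g x * indicator U x"
        by (intro AE_I2 tendsto_mult_left \<phi>)
      show "AE x in lebesgue_on \<Omega>. norm (g x * \<phi> n x) \<le> \<bar>g x\<bar>" for n
        using \<phi>(2,3)[of n] by (intro AE_I2) (simp add: abs_mult mult_left_le)
    qed measurable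
    then show ?thesis using 0 test_functions_mono[OF U(2) \<phi>(1)] by (simp add: LIMSEQ_const_iff)
  qed
  define A where "A = {x \<in> \<Omega>. g x > 0}"
  have "A \<in> sets (lebesgue_on \<Omega>)"
    unfolding A_def using measurable_sets[OF borel_measurable_integrable[OF g], of "{0<..}"]
    by (simp add: vimage_def Int_def conj_commute)
  then have A: "A \<in> sets lebesgue" using \<Omega> by (auto simp: sets_restrict_space)
  have "\<exists>U. open U \<and> A \<subseteq> U \<and> U - A \<in> lmeasurable \<and> emeasure lebesgue (U - A) < ennreal (1 / real (Suc n))" for n
    using sets_lebesgue_outer_open[OF A, of "1 / real (Suc n)"] by (metis divide_pos_pos of_nat_0_less_iff zero_less_Suc zero_less_one)
  then obtain U where U: "\<And>n. open (U n)" "\<And>n. A \<subseteq> U n" "\<And>n. U n - A \<in> lmeasurable"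
    "\<And>n. emeasure lebesgue (U n - A) < ennreal (1 / real (Suc n))" by metis
  \<comment> \<open>Finite intersections are still open, so \<open>open0\<close> applies to them,
    and they decrease to \<open>G\<close>.\<close>
  define V where "V n = \<Omega> \<inter> (\<Inter>k\<le>n. U k)" for n
  define G where "G = \<Omega> \<inter> (\<Inter>k. U k)"
  have V: "open (V n)" "V n \<subseteq> \<Omega>" for n
    unfolding V_def using assms(1) U(1) by auto
  have negl: "negligible (G - A)"
  proof (rule negligible_subset[of "\<Inter>k. U k - A"])
    show "negligible (\<Inter>k. U k - A)"
      unfolding negligible_outer_le
    proof (intro allI impI)
      fix e :: real assume "e > 0"
      then obtain n where n: "1 / real (Suc n) < e" using nat_approx_posE by blast
      have "measure lebesgue (U n - A) \<le> e"
        using U(4)[of n] n \<open>e > 0\<close> U(3)[of n]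
        by (simp add: emeasure_eq_measure2 ennreal_less_iff fmeasurableD2)
      then show "\<exists>T. (\<Inter>k. U k - A) \<subseteq> T \<and> T \<in> lmeasurable \<and> measure lebesgue T \<le> e"
        using U(3)[of n] by (intro exI[of _ "U n - A"]) auto
    qed
  qed (auto simp: G_def)
  have mG: "indicat_real G \<in> borel_measurable (lebesgue_on \<Omega>)"
    unfolding G_def using assms(1) U(1) by (intro meas borel_measurable_indicator) auto
  have "(\<lambda>n. integral\<^sup>L (lebesgue_on \<Omega>) (\<lambda>x. g x * indicator (V n) x))
        \<longlonglongrightarrow> integral\<^sup>L (lebesgue_on \<Omega>) (\<lambda>x. g x * indicator G x)"
  proof (rule integral_dominated_convergence[where w = "\<lambda>x. \<bar>g x\<bar>"])
    show "integrable (lebesgue_on \<Omega>) (\<lambda>x. \<bar>g x\<bar>)" using g by simp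
    have lim: "(\<lambda>n. indicat_real (V n) x) \<longlonglongrightarrow> indicator G x" for x
    proof (cases "x \<in> G")
      case True
      then show ?thesis by (auto simp: G_def V_def)
    next
      case False
      show ?thesis
      proof (cases "x \<in> \<Omega>")
        case True
        then obtain k where k: "x \<notin> U k" using False by (auto simp: G_def)
        have "\<forall>\<^sub>F n in sequentially. indicat_real (V n) x = indicator G x"
          using eventually_ge_at_top[of k]
        proof eventually_elim
          case (elim n)
          then show ?case using k False by (auto simp: V_def indicator_def)
        qed
        then show ?thesis by (rule tendsto_eventually)
      qed (auto simp: G_def V_def)
    qed
    show "AE x in lebesgue_on \<Omega>. (\<lambda>n. g x * indicator (V n) x) \<longlonglongrightarrow> g x * indicator G x"
      by (intro AE_I2 tendsto_mult_left lim)
    show "AE x in lebesgue_on \<Omega>. norm (g x * indicator (V n) x) \<le> \<bar>g x\<bar>" for n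
      by (intro AE_I2) (auto simp: indicator_def)
    show "(\<lambda>x. g x * indicator G x) \<in> borel_measurable (lebesgue_on \<Omega>)" using mG by measurable
    have "indicat_real (V n) \<in> borel_measurable (lebesgue_on \<Omega>)" for n
      using V by (intro meas) auto
    then show "(\<lambda>x. g x * indicator (V n) x) \<in> borel_measurable (lebesgue_on \<Omega>)" for n
      by measurable
  qed
  then have G0: "integral\<^sup>L (lebesgue_on \<Omega>) (\<lambda>x. g x * indicator G x) = 0"
    using open0[OF V] by (simp add: LIMSEQ_const_iff)
  have "AE x in lebesgue. x \<notin> G - A"
    using negl negligible_iff_null_sets AE_not_in by blast
  then have "AE x in lebesgue_on \<Omega>. x \<notin> G - A"
    using \<Omega> by (subst AE_restrict_space_iff) auto
  then have AEG: "AE x in lebesgue_on \<Omega>. g x * indicator G x = max (g x) 0"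
    using AE_space
  proof eventually_elim
    case (elim x)
    have "x \<in> G" if "x \<in> A" using that U(2) by (auto simp: G_def A_def)
    moreover have "x \<in> A \<longleftrightarrow> g x > 0" using elim(2) by (auto simp: A_def)
    ultimately show ?case using elim(1) by (auto simp: indicator_def max_def)
  qed
  have "integral\<^sup>L (lebesgue_on \<Omega>) (\<lambda>x. max (g x) 0) = 0"
    using G0 integral_cong_AE[OF _ _ AEG] mG by simp
  then have "AE x in lebesgue_on \<Omega>. max (g x) 0 = 0"
    using g by (subst (asm) integral_nonneg_eq_0_iff_AE) auto
  then show ?thesis by eventually_elim auto
qed

lemma fundamental_lemma:
  fixes g :: "'a::euclidean_space \<Rightarrow> real"
  assumes "open \<Omega>" "integrable (lebesgue_on \<Omega>) g"
    and "\<And>\<phi>. \<phi> \<in> test_functions \<Omega> \<Longrightarrow> integral\<^sup>L (lebesgue_on \<Omega>) (\<lambda>x. g x * \<phi> x) = 0"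
  shows "AE x in lebesgue_on \<Omega>. g x = 0"
  using fundamental_lemma_le[OF assms] fundamental_lemma_le[OF assms(1), of "\<lambda>x. - g x"] assms(2,3)
  by (auto simp: antisym)

section \<open>The space of square integrable functions\<close>

abbreviation ip :: "'a::euclidean_space set \<Rightarrow> ('a \<Rightarrow> 'b::euclidean_space) \<Rightarrow> ('a \<Rightarrow> 'b) \<Rightarrow> real" where
  "ip \<Omega> f g \<equiv> integral\<^sup>L (lebesgue_on \<Omega>) (\<lambda>x. f x \<bullet> g x)"

lemma L2_measurable: "f \<in> L2 \<Omega> \<Longrightarrow> f \<in> borel_measurable (lebesgue_on \<Omega>)"
  by (simp add: L2_def)

lemma L2_integrable_sq: "f \<in> L2 \<Omega> \<Longrightarrow> integrable (lebesgue_on \<Omega>) (\<lambda>x. (norm (f x))\<^sup>2)"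
  by (simp add: L2_def)

lemma L2_integrable_inner:
  assumes f: "f \<in> L2 \<Omega>" and g: "g \<in> L2 \<Omega>"
  shows "integrable (lebesgue_on \<Omega>) (\<lambda>x. f x \<bullet> g x)"
proof (rule Bochner_Integration.integrable_bound)
  show "integrable (lebesgue_on \<Omega>) (\<lambda>x. (norm (f x))\<^sup>2 + (norm (g x))\<^sup>2)"
    using f g by (intro Bochner_Integration.integrable_add L2_integrable_sq)
  show "(\<lambda>x. f x \<bullet> g x) \<in> borel_measurable (lebesgue_on \<Omega>)"
    using f g by (intro borel_measurable_inner L2_measurable)
  show "AE x in lebesgue_on \<Omega>. norm (f x \<bullet> g x) \<le> norm ((norm (f x))\<^sup>2 + (norm (g x))\<^sup>2)"
  proof (rule AE_I2)
    fix x
    have "\<bar>f x \<bullet> g x\<bar> \<le> norm (f x) * norm (g x)" by (rule Cauchy_Schwarz_ineq2)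
    also have "\<dots> \<le> (norm (f x))\<^sup>2 + (norm (g x))\<^sup>2"
      using sum_squares_bound[of "norm (f x)" "norm (g x)"]
        mult_nonneg_nonneg[OF norm_ge_zero norm_ge_zero, of "f x" "g x"] by linarith
    finally show "norm (f x \<bullet> g x) \<le> norm ((norm (f x))\<^sup>2 + (norm (g x))\<^sup>2)" by simp
  qed
qed

lemma L2_add:
  assumes f: "f \<in> L2 \<Omega>" and g: "g \<in> L2 \<Omega>"
  shows "(\<lambda>x. f x + g x) \<in> L2 \<Omega>"
proof -
  have "integrable (lebesgue_on \<Omega>) (\<lambda>x. (norm (f x))\<^sup>2 + 2 * (f x \<bullet> g x) + (norm (g x))\<^sup>2)"
    using f g by (intro Bochner_Integration.integrable_add L2_integrable_sq integrable_mult_right L2_integrable_inner)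
  moreover have "(\<lambda>x. (norm (f x))\<^sup>2 + 2 * (f x \<bullet> g x) + (norm (g x))\<^sup>2) = (\<lambda>x. (norm (f x + g x))\<^sup>2)"
    by (simp add: fun_eq_iff power2_norm_eq_inner inner_add inner_commute)
  ultimately show ?thesis
    using f g by (auto simp: L2_def)
qed

lemma L2_scaleR: "f \<in> L2 \<Omega> \<Longrightarrow> (\<lambda>x. c *\<^sub>R f x) \<in> L2 \<Omega>"
  by (auto simp: L2_def power_mult_distrib)

lemma L2_cmult: "f \<in> L2 \<Omega> \<Longrightarrow> (\<lambda>x. c * f x :: real) \<in> L2 \<Omega>"
  using L2_scaleR[of f \<Omega> c] by simp

lemma L2_diff:
  assumes f: "f \<in> L2 \<Omega>" and g: "g \<in> L2 \<Omega>"
  shows "(\<lambda>x. f x - g x) \<in> L2 \<Omega>"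
  using L2_add[OF f L2_scaleR[OF g, of "-1"]] by simp

lemma L2_zero: "(\<lambda>x. 0) \<in> L2 \<Omega>"
  by (simp add: L2_def)

lemma L2_norm_nonneg: "0 \<le> L2_norm \<Omega> f"
  by (simp add: L2_norm_def integral_nonneg_AE)

lemma L2_norm_sq: "(L2_norm \<Omega> f)\<^sup>2 = ip \<Omega> f f"
  by (simp add: L2_norm_def integral_nonneg_AE power2_norm_eq_inner)

lemma L2_norm_le_iff: "0 \<le> c \<Longrightarrow> L2_norm \<Omega> f \<le> c \<longleftrightarrow> ip \<Omega> f f \<le> c\<^sup>2"
  using L2_norm_sq[of \<Omega> f] L2_norm_nonneg[of \<Omega> f] by (metis abs_le_square_iff abs_of_nonneg)

lemma ip_commute: "ip \<Omega> f g = ip \<Omega> g f"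
  by (simp add: inner_commute)

lemma ip_add_left:
  "f \<in> L2 \<Omega> \<Longrightarrow> g \<in> L2 \<Omega> \<Longrightarrow> h \<in> L2 \<Omega> \<Longrightarrow> ip \<Omega> (\<lambda>x. f x + g x) h = ip \<Omega> f h + ip \<Omega> g h"
  by (simp add: inner_add_left L2_integrable_inner)

lemma ip_diff_left:
  "f \<in> L2 \<Omega> \<Longrightarrow> g \<in> L2 \<Omega> \<Longrightarrow> h \<in> L2 \<Omega> \<Longrightarrow> ip \<Omega> (\<lambda>x. f x - g x) h = ip \<Omega> f h - ip \<Omega> g h"
  by (simp add: inner_diff_left L2_integrable_inner)

lemma ip_scaleR_left: "ip \<Omega> (\<lambda>x. c *\<^sub>R f x) h = c * ip \<Omega> f h"
  by simp

lemma ip_add_expand: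
  assumes f: "f \<in> L2 \<Omega>" and g: "g \<in> L2 \<Omega>"
  shows "ip \<Omega> (\<lambda>x. f x + c *\<^sub>R g x) (\<lambda>x. f x + c *\<^sub>R g x) = ip \<Omega> f f + 2 * c * ip \<Omega> f g + c\<^sup>2 * ip \<Omega> g g"
proof -
  note cg = L2_scaleR[OF g, of c]
  have "ip \<Omega> (\<lambda>x. f x + c *\<^sub>R g x) (\<lambda>x. f x + c *\<^sub>R g x)
      = ip \<Omega> f (\<lambda>x. f x + c *\<^sub>R g x) + c * ip \<Omega> g (\<lambda>x. f x + c *\<^sub>R g x)"
    by (subst ip_add_left[OF f cg L2_add[OF f cg]]) (simp only: ip_scaleR_left)
  also have "ip \<Omega> f (\<lambda>x. f x + c *\<^sub>R g x) = ip \<Omega> f f + c * ip \<Omega> g f"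
    by (subst ip_commute, subst ip_add_left[OF f cg f]) (simp only: ip_scaleR_left)
  also have "ip \<Omega> g (\<lambda>x. f x + c *\<^sub>R g x) = ip \<Omega> f g + c * ip \<Omega> g g"
    by (subst ip_commute, subst ip_add_left[OF f cg g]) (simp only: ip_scaleR_left)
  finally show ?thesis by (simp add: ip_commute[of \<Omega> g f] algebra_simps power2_eq_square)
qed

lemma ip_self_nonneg: "0 \<le> ip \<Omega> f f"
  by (simp add: integral_nonneg_AE)

text \<open>The discriminant criterion. Besides Cauchy-Schwarz it serves for first-order conditions:
  with \<open>a = 0\<close> it forces \<open>b = 0\<close>.\<close>

lemma quadratic_nonneg_imp:
  fixes a b c :: real
  assumes "\<And>t. 0 \<le> a + 2 * t * b + t\<^sup>2 * c" "0 \<le> c"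
  shows "b\<^sup>2 \<le> a * c"
proof (cases "c = 0")
  case True
  have "b = 0"
  proof (rule ccontr)
    assume "b \<noteq> 0"
    \<comment> \<open>For \<open>c = 0\<close> the expression is affine in \<open>t\<close>, and
      this \<open>t\<close> gives it the value -1.\<close>
    then show False using assms(1)[of "- (a + 1) / (2 * b)"] True by (simp add: field_simps)
  qed
  then show ?thesis using True by simp
next
  case False
  then show ?thesis using assms(1)[of "- b / c"] assms(2)
    by (simp add: field_simps power2_eq_square)
qed

lemma L2_Cauchy_Schwarz:
  assumes f: "f \<in> L2 \<Omega>" and g: "g \<in> L2 \<Omega>"
  shows "\<bar>ip \<Omega> f g\<bar> \<le> L2_norm \<Omega> f * L2_norm \<Omega> g"
proof -
  have "(ip \<Omega> f g)\<^sup>2 \<le> ip \<Omega> f f * ip \<Omega> g g"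
  proof (rule quadratic_nonneg_imp)
    show "0 \<le> ip \<Omega> f f + 2 * t * ip \<Omega> f g + t\<^sup>2 * ip \<Omega> g g" for t
      unfolding ip_add_expand[OF f g, symmetric] by (rule ip_self_nonneg)
  qed (rule ip_self_nonneg)
  also have "\<dots> = (L2_norm \<Omega> f * L2_norm \<Omega> g)\<^sup>2" by (simp only: power_mult_distrib L2_norm_sq)
  finally have "\<bar>ip \<Omega> f g\<bar>\<^sup>2 \<le> (L2_norm \<Omega> f * L2_norm \<Omega> g)\<^sup>2" by simp
  then show ?thesis by (rule power2_le_imp_le) (intro mult_nonneg_nonneg L2_norm_nonneg)
qed

lemma L2_triangle:
  assumes f: "f \<in> L2 \<Omega>" and g: "g \<in> L2 \<Omega>"
  shows "L2_norm \<Omega> (\<lambda>x. f x + g x) \<le> L2_norm \<Omega> f + L2_norm \<Omega> g"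
proof -
  have "ip \<Omega> (\<lambda>x. f x + g x) (\<lambda>x. f x + g x) = ip \<Omega> f f + 2 * ip \<Omega> f g + ip \<Omega> g g"
    using ip_add_expand[OF f g, of 1] by simp
  also have "\<dots> \<le> (L2_norm \<Omega> f + L2_norm \<Omega> g)\<^sup>2"
    using L2_Cauchy_Schwarz[OF f g] unfolding power2_sum L2_norm_sq by linarith
  finally show ?thesis using L2_norm_nonneg by (subst L2_norm_le_iff) (auto intro: add_nonneg_nonneg)
qed

lemma L2_norm_scaleR: "L2_norm \<Omega> (\<lambda>x. c *\<^sub>R f x) = \<bar>c\<bar> * L2_norm \<Omega> f"
  by (simp add: L2_norm_def power_mult_distrib real_sqrt_mult)

lemma L2_norm_minus_commute: "L2_norm \<Omega> (\<lambda>x. f x - g x) = L2_norm \<Omega> (\<lambda>x. g x - f x)"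
  by (simp add: L2_norm_def norm_minus_commute)

lemma L2_triangle_diff:
  assumes "f \<in> L2 \<Omega>" "g \<in> L2 \<Omega>" "h \<in> L2 \<Omega>"
  shows "L2_norm \<Omega> (\<lambda>x. f x - h x) \<le> L2_norm \<Omega> (\<lambda>x. f x - g x) + L2_norm \<Omega> (\<lambda>x. g x - h x)"
  using L2_triangle[OF L2_diff[OF assms(1,2)] L2_diff[OF assms(2,3)]] by simp

lemma L2_norm_diff_le:
  assumes f: "f \<in> L2 \<Omega>" and g: "g \<in> L2 \<Omega>"
  shows "\<bar>L2_norm \<Omega> f - L2_norm \<Omega> g\<bar> \<le> L2_norm \<Omega> (\<lambda>x. f x - g x)"
  using L2_triangle_diff[OF f g L2_zero] L2_triangle_diff[OF g f L2_zero] L2_norm_minus_commute[of \<Omega> f g] by simp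

lemma L2_norm_tendsto:
  assumes "\<And>n. f n \<in> L2 \<Omega>" "g \<in> L2 \<Omega>" "(\<lambda>n. L2_norm \<Omega> (\<lambda>x. f n x - g x)) \<longlonglongrightarrow> 0"
  shows "(\<lambda>n. L2_norm \<Omega> (f n)) \<longlonglongrightarrow> L2_norm \<Omega> g"
proof -
  have "(\<lambda>n. L2_norm \<Omega> (f n) - L2_norm \<Omega> g) \<longlonglongrightarrow> 0"
    by (rule tendsto_rabs_zero_cancel, rule tendsto_sandwich[OF _ _ tendsto_const assms(3)])
      (use L2_norm_diff_le[OF assms(1,2)] in auto)
  then show ?thesis by (simp add: LIM_zero_iff)
qed

lemma ip_tendsto:
  assumes "\<And>n. f n \<in> L2 \<Omega>" "g \<in> L2 \<Omega>" "h \<in> L2 \<Omega>" "(\<lambda>n. L2_norm \<Omega> (\<lambda>x. f n x - g x)) \<longlonglongrightarrow> 0"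
  shows "(\<lambda>n. ip \<Omega> (f n) h) \<longlonglongrightarrow> ip \<Omega> g h"
proof -
  have "(\<lambda>n. ip \<Omega> (f n) h - ip \<Omega> g h) \<longlonglongrightarrow> 0"
  proof (rule tendsto_rabs_zero_cancel, rule tendsto_sandwich[OF _ _ tendsto_const])
    show "(\<lambda>n. L2_norm \<Omega> (\<lambda>x. f n x - g x) * L2_norm \<Omega> h) \<longlonglongrightarrow> 0"
      using tendsto_mult_left_zero[OF assms(4)] by blast
    show "\<forall>\<^sub>F n in sequentially. \<bar>ip \<Omega> (f n) h - ip \<Omega> g h\<bar> \<le> L2_norm \<Omega> (\<lambda>x. f n x - g x) * L2_norm \<Omega> h"
      unfolding ip_diff_left[OF assms(1-3), symmetric]
      by (intro always_eventually allI L2_Cauchy_Schwarz L2_diff assms)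
  qed auto
  then show ?thesis by (simp add: LIM_zero_iff)
qed

lemma L2_norm_cong_AE:
  assumes "f \<in> borel_measurable (lebesgue_on \<Omega>)" "g \<in> borel_measurable (lebesgue_on \<Omega>)" "AE x in lebesgue_on \<Omega>. f x = g x"
  shows "L2_norm \<Omega> f = L2_norm \<Omega> g"
proof -
  have "AE x in lebesgue_on \<Omega>. (norm (f x))\<^sup>2 = (norm (g x))\<^sup>2" using assms(3) by eventually_elim simp
  then show ?thesis
    unfolding L2_norm_def using assms(1,2) by (intro arg_cong[of _ _ sqrt] integral_cong_AE) auto
qed

lemma L2_norm_cong: "(\<And>x. x \<in> \<Omega> \<Longrightarrow> f x = g x) \<Longrightarrow> L2_norm \<Omega> f = L2_norm \<Omega> g"
  unfolding L2_norm_def by (intro arg_cong[of _ _ sqrt] Bochner_Integration.integral_cong) (auto simp: space_restrict_space)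

lemma L2_cong_AE:
  assumes "f \<in> L2 \<Omega>" "g \<in> borel_measurable (lebesgue_on \<Omega>)" "AE x in lebesgue_on \<Omega>. f x = g x"
  shows "g \<in> L2 \<Omega>"
proof -
  have "AE x in lebesgue_on \<Omega>. (norm (f x))\<^sup>2 = (norm (g x))\<^sup>2" using assms(3) by eventually_elim simp
  then show ?thesis
    using assms(1,2) integrable_cong_AE[of "\<lambda>x. (norm (f x))\<^sup>2" "lebesgue_on \<Omega>" "\<lambda>x. (norm (g x))\<^sup>2"]
    by (auto simp: L2_def)
qed

lemma finite_measure_lebesgue_on_bounded:
  assumes "open \<Omega>" "bounded (\<Omega> :: 'a::euclidean_space set)"
  shows "finite_measure (lebesgue_on \<Omega>)"
  using assms by (intro finite_measure_lebesgue_on bounded_set_imp_lmeasurable) (auto simp: lborelD)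

lemma L2_bounded:
  fixes f :: "'a::euclidean_space \<Rightarrow> 'b::euclidean_space"
  assumes "open \<Omega>" "bounded \<Omega>" "f \<in> borel_measurable (lebesgue_on \<Omega>)" "\<And>x. x \<in> \<Omega> \<Longrightarrow> norm (f x) \<le> B"
  shows "f \<in> L2 \<Omega>"
proof -
  interpret finite_measure "lebesgue_on \<Omega>" by (rule finite_measure_lebesgue_on_bounded[OF assms(1,2)])
  have "integrable (lebesgue_on \<Omega>) (\<lambda>x. (norm (f x))\<^sup>2)"
    using assms(3,4) by (intro integrable_const_bound[where B = "B\<^sup>2"] AE_I2) (auto simp: space_restrict_space intro!: power_mono)
  then show ?thesis using assms(3) by (simp add: L2_def)
qed

lemma L2_integrable:
  fixes f :: "'a::euclidean_space \<Rightarrow> 'b::euclidean_space"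
  assumes "open \<Omega>" "bounded \<Omega>" "f \<in> L2 \<Omega>"
  shows "integrable (lebesgue_on \<Omega>) f"
proof (rule Bochner_Integration.integrable_bound)
  interpret finite_measure "lebesgue_on \<Omega>" by (rule finite_measure_lebesgue_on_bounded[OF assms(1,2)])
  show "integrable (lebesgue_on \<Omega>) (\<lambda>x. 1 + (norm (f x))\<^sup>2)"
    using L2_integrable_sq[OF assms(3)] by simp
  show "AE x in lebesgue_on \<Omega>. norm (f x) \<le> norm (1 + (norm (f x))\<^sup>2)"
  proof (rule AE_I2)
    fix x
    show "norm (f x) \<le> norm (1 + (norm (f x))\<^sup>2)"
    proof -
      have "2 * norm (f x) \<le> (norm (f x))\<^sup>2 + 1" using sum_squares_bound[of "norm (f x)" 1] by simp
      then have "norm (f x) \<le> 1 + (norm (f x))\<^sup>2" using norm_ge_zero[of "f x"] by linarith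
      also have "\<dots> \<le> norm (1 + (norm (f x))\<^sup>2)" by (simp only: real_norm_def abs_ge_self)
      finally show ?thesis .
    qed
  qed
qed (rule L2_measurable[OF assms(3)])

lemma L2_norm_integral_le:
  fixes f :: "'a::euclidean_space \<Rightarrow> 'b::euclidean_space"
  assumes "open \<Omega>" "bounded \<Omega>" "f \<in> L2 \<Omega>"
  shows "integral\<^sup>L (lebesgue_on \<Omega>) (\<lambda>x. norm (f x)) \<le> L2_norm \<Omega> f * L2_norm \<Omega> (\<lambda>x. 1 :: real)"
proof -
  have 1: "(\<lambda>x. 1 :: real) \<in> L2 \<Omega>" by (rule L2_bounded[OF assms(1,2), where B = 1]) auto
  have n: "(\<lambda>x. norm (f x)) \<in> L2 \<Omega>" using assms(3) by (auto simp: L2_def)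
  have "L2_norm \<Omega> (\<lambda>x. norm (f x)) = L2_norm \<Omega> f" by (simp add: L2_norm_def)
  then show ?thesis using L2_Cauchy_Schwarz[OF n 1] by simp
qed

text \<open>Riesz-Fischer. Along a fast subsequence the increments are summable in the mean, because
  \<Omega> has finite measure, so the subsequence converges almost everywhere. Fatou then turns the
  Cauchy estimates into estimates against the limit.\<close>

lemma L2_complete:
  fixes f :: "nat \<Rightarrow> 'a::euclidean_space \<Rightarrow> 'b::euclidean_space"
  assumes \<Omega>: "open \<Omega>" "bounded \<Omega>" and f: "\<And>n. f n \<in> L2 \<Omega>"
    and Cauchy: "\<And>e. e > 0 \<Longrightarrow> \<exists>N. \<forall>m\<ge>N. \<forall>n\<ge>N. L2_norm \<Omega> (\<lambda>x. f m x - f n x) \<le> e"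
  obtains F where "F \<in> L2 \<Omega>" "(\<lambda>n. L2_norm \<Omega> (\<lambda>x. f n x - F x)) \<longlonglongrightarrow> 0"
proof -
  let ?M = "lebesgue_on \<Omega>"
  have [measurable]: "f n \<in> borel_measurable ?M" for n by (rule L2_measurable[OF f])
  obtain N where N: "\<And>k m n. m \<ge> N k \<Longrightarrow> n \<ge> N k \<Longrightarrow> L2_norm \<Omega> (\<lambda>x. f m x - f n x) \<le> (1 / 2) ^ k"
    using Cauchy[of "(1 / 2) ^ k" for k] by (metis zero_less_power half_gt_zero zero_less_one)
  \<comment> \<open>Summing the \<open>N j\<close> makes \<open>r\<close> monotone with
    \<open>r k\<close> at least \<open>N k\<close>; the summand \<open>k\<close> drives it to
    infinity.\<close>
  define r where "r k = (\<Sum>j\<le>k. N j) + k" for k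
  have rN: "r k \<ge> N k" for k
    unfolding r_def using member_le_sum[of k "{..k}" N] by simp
  have r_mono: "r k \<le> r (Suc k)" and rk: "r k \<ge> k" for k by (auto simp: r_def)
  define d where "d k x = norm (f (r (Suc k)) x - f (r k) x)" for k x
  have [measurable]: "d k \<in> borel_measurable ?M" for k unfolding d_def by measurable
  define c where "c = L2_norm \<Omega> (\<lambda>x. 1 :: real)"
  have c0: "c \<ge> 0" by (simp add: c_def L2_norm_nonneg)
  have d_int: "integrable ?M (d k)" for k
    unfolding d_def using L2_integrable[OF \<Omega> L2_diff[OF f f]] by simp
  have d_le: "integral\<^sup>L ?M (d k) \<le> (1 / 2) ^ k * c" for k
  proof -
    have "integral\<^sup>L ?M (d k) \<le> L2_norm \<Omega> (\<lambda>x. f (r (Suc k)) x - f (r k) x) * c"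
      unfolding d_def c_def by (rule L2_norm_integral_le[OF \<Omega> L2_diff[OF f f]])
    also have "\<dots> \<le> (1 / 2) ^ k * c"
      using N[of k "r (Suc k)" "r k"] rN r_mono le_trans c0 by (intro mult_right_mono) blast+
    finally show ?thesis .
  qed
  have "(\<integral>\<^sup>+x. (\<Sum>k. ennreal (d k x)) \<partial>?M) = (\<Sum>k. \<integral>\<^sup>+x. ennreal (d k x) \<partial>?M)"
    by (rule nn_integral_suminf) measurable
  also have "\<dots> \<le> (\<Sum>k. ennreal ((1 / 2) ^ k * c))"
  proof (intro suminf_le summableI)
    fix k
    have d0: "AE x in ?M. 0 \<le> d k x" by (simp add: d_def)
    show "(\<integral>\<^sup>+x. ennreal (d k x) \<partial>?M) \<le> ennreal ((1 / 2) ^ k * c)"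
      by (subst nn_integral_eq_integral[OF d_int d0]) (rule ennreal_leI[OF d_le])
  qed
  also have "\<dots> = ennreal (\<Sum>k. (1 / 2) ^ k * c)"
    using c0 by (intro suminf_ennreal2 summable_mult2 summable_geometric) auto
  finally have "(\<integral>\<^sup>+x. (\<Sum>k. ennreal (d k x)) \<partial>?M) \<noteq> \<infinity>"
    by (metis ennreal_neq_top infinity_ennreal_def neq_top_trans)
  then have "AE x in ?M. (\<Sum>k. ennreal (d k x)) \<noteq> \<infinity>"
    by (intro nn_integral_PInf_AE) measurable
  then have "AE x in ?M. convergent (\<lambda>k. f (r k) x)"
  proof eventually_elim
    case (elim x)
    then have "summable (\<lambda>k. d k x)"
      by (intro summable_suminf_not_top) (auto simp: d_def)
    then have "summable (\<lambda>k. f (r (Suc k)) x - f (r k) x)"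
      unfolding d_def by (rule summable_norm_cancel)
    then have "convergent (\<lambda>n. \<Sum>k<n. f (r (Suc k)) x - f (r k) x)"
      by (simp add: summable_iff_convergent)
    then have "convergent (\<lambda>n. f (r n) x - f (r 0) x)"
      by (simp add: sum_lessThan_telescope[of "\<lambda>k. f (r k) x"])
    then have "convergent (\<lambda>n. (f (r n) x - f (r 0) x) + f (r 0) x)"
      by (intro convergent_add convergent_const)
    then show ?case by simp
  qed
  then have lim: "AE x in ?M. (\<lambda>k. f (r k) x) \<longlonglongrightarrow> lim (\<lambda>k. f (r k) x)"
    by eventually_elim (simp add: convergent_LIMSEQ_iff)
  define F where "F x = lim (\<lambda>k. f (r k) x)" for x
  have [measurable]: "F \<in> borel_measurable ?M"
    unfolding F_def by (rule borel_measurable_lim_metric) measurable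
  \<comment> \<open>Fatou along the subsequence with \<open>m\<close> fixed: the bound
    \<open>e\<close> on the distance from \<open>f (r k)\<close> to \<open>f m\<close> survives the
    limit in \<open>k\<close>.\<close>
  have key: "(\<lambda>x. F x - f m x) \<in> L2 \<Omega> \<and> L2_norm \<Omega> (\<lambda>x. F x - f m x) \<le> e"
    if m: "m \<ge> n0" and n0: "\<And>m n. m \<ge> n0 \<Longrightarrow> n \<ge> n0 \<Longrightarrow> L2_norm \<Omega> (\<lambda>x. f m x - f n x) \<le> e" and e: "e \<ge> 0" for m n0 e
  proof -
    have "(\<integral>\<^sup>+x. ennreal ((norm (F x - f m x))\<^sup>2) \<partial>?M)
        = (\<integral>\<^sup>+x. liminf (\<lambda>k. ennreal ((norm (f (r k) x - f m x))\<^sup>2)) \<partial>?M)"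
    proof (rule nn_integral_cong_AE)
      show "AE x in ?M. ennreal ((norm (F x - f m x))\<^sup>2) = liminf (\<lambda>k. ennreal ((norm (f (r k) x - f m x))\<^sup>2))"
        using lim
      proof eventually_elim
        case (elim x)
        have "(\<lambda>k. ennreal ((norm (f (r k) x - f m x))\<^sup>2)) \<longlonglongrightarrow> ennreal ((norm (F x - f m x))\<^sup>2)"
          unfolding F_def by (intro tendsto_intros elim)
        then show ?case by (intro lim_imp_Liminf[symmetric]) auto
      qed
    qed
    also have "\<dots> \<le> liminf (\<lambda>k. \<integral>\<^sup>+x. ennreal ((norm (f (r k) x - f m x))\<^sup>2) \<partial>?M)"
      by (rule nn_integral_liminf) measurable
    also have "\<dots> \<le> liminf (\<lambda>k. ennreal (e\<^sup>2))"
    proof (intro Liminf_mono)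
      show "\<forall>\<^sub>F k in sequentially. (\<integral>\<^sup>+x. ennreal ((norm (f (r k) x - f m x))\<^sup>2) \<partial>?M) \<le> ennreal (e\<^sup>2)"
        using eventually_ge_at_top[of n0]
      proof eventually_elim
        case (elim k)
        have "L2_norm \<Omega> (\<lambda>x. f (r k) x - f m x) \<le> e"
          using n0[of "r k" m] m elim rk[of k] by simp
        then have "integral\<^sup>L ?M (\<lambda>x. (norm (f (r k) x - f m x))\<^sup>2) \<le> e\<^sup>2"
          using e by (simp add: L2_norm_le_iff power2_norm_eq_inner)
        then show ?case
          using L2_integrable_sq[OF L2_diff[OF f f]] by (subst nn_integral_eq_integral) (auto intro: ennreal_leI)
      qed
    qed
    also have "\<dots> = ennreal (e\<^sup>2)" by (simp add: Liminf_const)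
    finally have le: "(\<integral>\<^sup>+x. ennreal ((norm (F x - f m x))\<^sup>2) \<partial>?M) \<le> ennreal (e\<^sup>2)" .
    have int: "integrable ?M (\<lambda>x. (norm (F x - f m x))\<^sup>2)"
      by (rule integrableI_nonneg) (use le in \<open>auto simp: le_less_trans[OF le]\<close>)
    then have "integral\<^sup>L ?M (\<lambda>x. (norm (F x - f m x))\<^sup>2) \<le> e\<^sup>2"
      using le by (subst (asm) nn_integral_eq_integral) auto
    then show ?thesis using int e
      by (auto simp: L2_def L2_norm_le_iff power2_norm_eq_inner)
  qed
  show thesis
  proof
    obtain n0 where "\<And>m n. m \<ge> n0 \<Longrightarrow> n \<ge> n0 \<Longrightarrow> L2_norm \<Omega> (\<lambda>x. f m x - f n x) \<le> 1"
      using Cauchy[of 1] by auto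
    then have "(\<lambda>x. F x - f n0 x) \<in> L2 \<Omega>" using key[of n0 n0 1] by simp
    from L2_add[OF this f[of n0]] show "F \<in> L2 \<Omega>" by simp
    show "(\<lambda>n. L2_norm \<Omega> (\<lambda>x. f n x - F x)) \<longlonglongrightarrow> 0"
    proof (rule LIMSEQ_I)
      fix e :: real assume e: "0 < e"
      then obtain n0 where n0: "\<And>m n. m \<ge> n0 \<Longrightarrow> n \<ge> n0 \<Longrightarrow> L2_norm \<Omega> (\<lambda>x. f m x - f n x) \<le> e / 2"
        using Cauchy[of "e / 2"] by auto
      have le0: "L2_norm \<Omega> (\<lambda>x. F x - f m x) \<le> e / 2" if "m \<ge> n0" for m
        using key[OF that n0] e by simp
      have le: "L2_norm \<Omega> (\<lambda>x. f m x - F x) \<le> e / 2" if "m \<ge> n0" for m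
        unfolding L2_norm_minus_commute[of \<Omega> "f m" F] by (rule le0[OF that])
      have "norm (L2_norm \<Omega> (\<lambda>x. f m x - F x) - 0) < e" if "m \<ge> n0" for m
        using le[OF that] L2_norm_nonneg[of \<Omega> "\<lambda>x. f m x - F x"] e by simp
      then show "\<exists>n0. \<forall>m\<ge>n0. norm (L2_norm \<Omega> (\<lambda>x. f m x - F x) - 0) < e" by blast
    qed
  qed
qed

section \<open>The weak Dirichlet problem\<close>

definition grad :: "('a::euclidean_space \<Rightarrow> real) \<Rightarrow> 'a \<Rightarrow> 'a" where
  "grad f x = (\<Sum>i\<in>Basis. pd i f x *\<^sub>R i)"

definition laplacian :: "('a::euclidean_space \<Rightarrow> real) \<Rightarrow> 'a \<Rightarrow> real" where
  "laplacian f x = (\<Sum>i\<in>Basis. pd i (pd i f) x)"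

lemma grad_inner_Basis: "i \<in> Basis \<Longrightarrow> grad f x \<bullet> i = pd i f x"
  by (simp add: grad_def inner_sum_left inner_Basis if_distrib cong: if_cong)

lemma grad_add: "smooth f \<Longrightarrow> smooth g \<Longrightarrow> grad (\<lambda>x. f x + g x) x = grad f x + grad g x"
  by (simp add: grad_def pd_add scaleR_add_left sum.distrib)

lemma grad_cmult: "smooth f \<Longrightarrow> grad (\<lambda>x. c * f x) x = c *\<^sub>R grad f x"
  by (simp add: grad_def pd_cmult scaleR_sum_right)

lemma grad_diff: "smooth f \<Longrightarrow> smooth g \<Longrightarrow> grad (\<lambda>x. f x - g x) x = grad f x - grad g x"
  by (simp add: grad_def pd_diff scaleR_diff_left sum_subtractf)

lemma grad_test_combine:
  assumes "f \<in> test_functions \<Omega>" "g \<in> test_functions \<Omega>"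
  shows "grad (\<lambda>x. f x + c * g x) = (\<lambda>x. grad f x + c *\<^sub>R grad g x)"
proof
  note s = test_functions_smooth[OF assms(1)] test_functions_smooth[OF assms(2)]
  show "grad (\<lambda>x. f x + c * g x) x = grad f x + c *\<^sub>R grad g x" for x
    by (simp add: grad_add[OF s(1) smooth_cmult[OF s(2)]] grad_cmult[OF s(2)])
qed

lemma grad_test_diff:
  assumes "f \<in> test_functions \<Omega>" "g \<in> test_functions \<Omega>"
  shows "grad (\<lambda>x. f x - g x) = (\<lambda>x. grad f x - grad g x)"
  using grad_diff[OF test_functions_smooth[OF assms(1)] test_functions_smooth[OF assms(2)]] by blast

lemma L2_inner_const:
  assumes "f \<in> L2 \<Omega>"
  shows "(\<lambda>x. f x \<bullet> v) \<in> L2 \<Omega>"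
proof -
  have "integrable (lebesgue_on \<Omega>) (\<lambda>x. (norm (f x \<bullet> v))\<^sup>2)"
  proof (rule Bochner_Integration.integrable_bound)
    show "integrable (lebesgue_on \<Omega>) (\<lambda>x. (norm v)\<^sup>2 * (norm (f x))\<^sup>2)"
      by (intro integrable_mult_right L2_integrable_sq assms)
    show "AE x in lebesgue_on \<Omega>. norm ((norm (f x \<bullet> v))\<^sup>2) \<le> norm ((norm v)\<^sup>2 * (norm (f x))\<^sup>2)"
    proof (rule AE_I2)
      fix x
      have "(norm (f x \<bullet> v))\<^sup>2 \<le> (norm (f x) * norm v)\<^sup>2"
        by (intro power_mono) (auto simp: Cauchy_Schwarz_ineq2)
      then show "norm ((norm (f x \<bullet> v))\<^sup>2) \<le> norm ((norm v)\<^sup>2 * (norm (f x))\<^sup>2)"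
        by (simp add: power_mult_distrib mult.commute)
    qed
  qed (use L2_measurable[OF assms] in measurable)
  then show ?thesis using L2_measurable[OF assms] by (simp add: L2_def)
qed

section \<open>Weak gradients and the closure of the test functions\<close>

locale bounded_open =
  fixes \<Omega> :: "'a::euclidean_space set"
  assumes open_\<Omega>: "open \<Omega>" and bounded_\<Omega>: "bounded \<Omega>"
begin

lemma sets_\<Omega>: "\<Omega> \<in> sets lebesgue"
  using open_\<Omega> by (simp add: lborelD)

lemma borel_meas: "f \<in> borel_measurable borel \<Longrightarrow> f \<in> borel_measurable (lebesgue_on \<Omega>)"
  for f :: "'a \<Rightarrow> 'b::euclidean_space"
  by (simp add: measurable_completion measurable_restrict_space1)

lemma test_L2: "\<phi> \<in> test_functions \<Omega> \<Longrightarrow> \<phi> \<in> L2 \<Omega>"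
  by (metis L2_bounded[OF open_\<Omega> bounded_\<Omega>] borel_meas real_norm_def smooth_borel_measurable
      test_functions_bounded test_functions_smooth)

lemma grad_test_L2:
  assumes "\<phi> \<in> test_functions \<Omega>"
  shows "grad \<phi> \<in> L2 \<Omega>"
proof -
  have "(\<lambda>x. \<Sum>i\<in>I. pd i \<phi> x *\<^sub>R i) \<in> L2 \<Omega>" if "I \<subseteq> Basis" for I
    using finite_subset[OF that finite_Basis] that
  proof (induction I)
    case empty
    then show ?case by (simp add: L2_zero)
  next
    case (insert i I)
    have "pd i \<phi> \<in> L2 \<Omega>" using insert assms by (intro test_L2 test_functions_pd) auto
    then have "(\<lambda>x. pd i \<phi> x *\<^sub>R i) \<in> L2 \<Omega>" using insert.prems by (auto simp: L2_def)
    then show ?case using insert by (simp add: L2_add)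
  qed
  then show ?thesis unfolding grad_def[abs_def] by simp
qed

lemma integral_test_eq_lborel: "\<phi> \<in> test_functions \<Omega> \<Longrightarrow> integral\<^sup>L (lebesgue_on \<Omega>) \<phi> = integral\<^sup>L lborel \<phi>"
  by (intro integral_lebesgue_on_eq_lborel sets_\<Omega> smooth_borel_measurable test_functions_smooth test_functions_outside)

lemma integral_pd_test: "\<phi> \<in> test_functions \<Omega> \<Longrightarrow> i \<in> Basis \<Longrightarrow> integral\<^sup>L (lebesgue_on \<Omega>) (pd i \<phi>) = 0"
  by (simp add: integral_test_eq_lborel test_functions_pd integral_pd_test_function)

lemma weak_gradient_test:
  assumes "\<phi> \<in> test_functions \<Omega>"
  shows "has_weak_gradient \<Omega> \<phi> (grad \<phi>)"
  unfolding has_weak_gradient_def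
proof (intro ballI)
  fix \<psi> i assume \<psi>: "\<psi> \<in> test_functions \<Omega>" and i: "i \<in> (Basis :: 'a set)"
  note s = test_functions_smooth[OF assms] test_functions_smooth[OF \<psi>]
  have "0 = integral\<^sup>L (lebesgue_on \<Omega>) (pd i (\<lambda>x. \<phi> x * \<psi> x))"
    using integral_pd_test[OF test_functions_mult[OF \<psi> s(1)] i] by simp
  also have "\<dots> = integral\<^sup>L (lebesgue_on \<Omega>) (\<lambda>x. \<phi> x * pd i \<psi> x + pd i \<phi> x * \<psi> x)"
    by (simp add: pd_mult[OF s])
  also have "\<dots> = integral\<^sup>L (lebesgue_on \<Omega>) (\<lambda>x. \<phi> x * pd i \<psi> x) + integral\<^sup>L (lebesgue_on \<Omega>) (\<lambda>x. pd i \<phi> x * \<psi> x)"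
    using L2_integrable_inner[OF test_L2[OF assms] test_L2[OF test_functions_pd[OF \<psi> i]]]
      L2_integrable_inner[OF test_L2[OF test_functions_pd[OF assms i]] test_L2[OF \<psi>]] by simp
  finally show "integral\<^sup>L (lebesgue_on \<Omega>) (\<lambda>x. \<phi> x * pd i \<psi> x)
      = - integral\<^sup>L (lebesgue_on \<Omega>) (\<lambda>x. (grad \<phi> x \<bullet> i) * \<psi> x)"
    by (simp add: grad_inner_Basis[OF i])
qed

text \<open>The fundamental lemma in each coordinate. It makes the choice in
  \<open>weak_grad\<close> harmless.\<close>

lemma weak_gradient_unique:
  assumes g: "g \<in> L2 \<Omega>" "has_weak_gradient \<Omega> u g" and g': "g' \<in> L2 \<Omega>" "has_weak_gradient \<Omega> u g'"
  shows "AE x in lebesgue_on \<Omega>. g x = g' x"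
proof -
  have "AE x in lebesgue_on \<Omega>. (g x - g' x) \<bullet> i = 0" if i: "i \<in> Basis" for i
  proof (rule fundamental_lemma[OF open_\<Omega>])
    note d = L2_inner_const[OF L2_diff[OF g(1) g'(1)], of i]
    show "integrable (lebesgue_on \<Omega>) (\<lambda>x. (g x - g' x) \<bullet> i)"
      by (rule L2_integrable[OF open_\<Omega> bounded_\<Omega> d])
    fix \<phi> assume \<phi>: "\<phi> \<in> test_functions \<Omega>"
    have "integral\<^sup>L (lebesgue_on \<Omega>) (\<lambda>x. (g x - g' x) \<bullet> i * \<phi> x)
      = integral\<^sup>L (lebesgue_on \<Omega>) (\<lambda>x. (g x \<bullet> i) * \<phi> x) - integral\<^sup>L (lebesgue_on \<Omega>) (\<lambda>x. (g' x \<bullet> i) * \<phi> x)"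
      using ip_diff_left[OF L2_inner_const[OF g(1)] L2_inner_const[OF g'(1)] test_L2[OF \<phi>], of i i]
      by (simp add: inner_diff_left)
    also have "\<dots> = 0"
      using g(2) g'(2) \<phi> i unfolding has_weak_gradient_def by fastforce
    finally show "integral\<^sup>L (lebesgue_on \<Omega>) (\<lambda>x. (g x - g' x) \<bullet> i * \<phi> x) = 0" .
  qed
  then have "AE x in lebesgue_on \<Omega>. \<forall>i\<in>Basis. (g x - g' x) \<bullet> i = 0"
    by (intro AE_finite_allI) auto
  then show ?thesis
    unfolding euclidean_all_zero_iff by eventually_elim simp
qed

lemma weak_grad:
  assumes "u \<in> H1 \<Omega>"
  shows "weak_grad \<Omega> u \<in> L2 \<Omega>" "has_weak_gradient \<Omega> u (weak_grad \<Omega> u)"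
proof -
  have "\<exists>g. g \<in> L2 \<Omega> \<and> has_weak_gradient \<Omega> u g" using assms by (auto simp: H1_def)
  from someI_ex[OF this] show "weak_grad \<Omega> u \<in> L2 \<Omega>" "has_weak_gradient \<Omega> u (weak_grad \<Omega> u)"
    by (auto simp: weak_grad_def)
qed

lemma weak_grad_AE:
  assumes "u \<in> L2 \<Omega>" "g \<in> L2 \<Omega>" "has_weak_gradient \<Omega> u g"
  shows "AE x in lebesgue_on \<Omega>. weak_grad \<Omega> u x = g x"
proof -
  have "u \<in> H1 \<Omega>" using assms by (auto simp: H1_def)
  from weak_grad[OF this] show ?thesis by (rule weak_gradient_unique) (rule assms)+
qed

lemma H1_norm_eq:
  assumes "u \<in> L2 \<Omega>" "g \<in> L2 \<Omega>" "has_weak_gradient \<Omega> u g"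
  shows "H1_norm \<Omega> u = sqrt ((L2_norm \<Omega> u)\<^sup>2 + (L2_norm \<Omega> g)\<^sup>2)"
proof -
  have "u \<in> H1 \<Omega>" using assms by (auto simp: H1_def)
  then have "L2_norm \<Omega> (weak_grad \<Omega> u) = L2_norm \<Omega> g"
    by (intro L2_norm_cong_AE L2_measurable weak_grad assms weak_grad_AE)
  then show ?thesis by (simp add: H1_norm_def)
qed

lemma has_weak_gradient_diff:
  assumes u: "u \<in> L2 \<Omega>" "g \<in> L2 \<Omega>" "has_weak_gradient \<Omega> u g"
    and v: "v \<in> L2 \<Omega>" "h \<in> L2 \<Omega>" "has_weak_gradient \<Omega> v h"
  shows "has_weak_gradient \<Omega> (\<lambda>x. u x - v x) (\<lambda>x. g x - h x)"
  unfolding has_weak_gradient_def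
proof (intro ballI)
  fix \<phi> i assume \<phi>: "\<phi> \<in> test_functions \<Omega>" and i: "i \<in> (Basis :: 'a set)"
  have "integral\<^sup>L (lebesgue_on \<Omega>) (\<lambda>x. (u x - v x) * pd i \<phi> x)
     = integral\<^sup>L (lebesgue_on \<Omega>) (\<lambda>x. u x * pd i \<phi> x) - integral\<^sup>L (lebesgue_on \<Omega>) (\<lambda>x. v x * pd i \<phi> x)"
    using ip_diff_left[OF u(1) v(1) test_L2[OF test_functions_pd[OF \<phi> i]]] by simp
  moreover have "integral\<^sup>L (lebesgue_on \<Omega>) (\<lambda>x. (g x - h x) \<bullet> i * \<phi> x)
      = integral\<^sup>L (lebesgue_on \<Omega>) (\<lambda>x. (g x \<bullet> i) * \<phi> x) - integral\<^sup>L (lebesgue_on \<Omega>) (\<lambda>x. (h x \<bullet> i) * \<phi> x)"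
    using ip_diff_left[OF L2_inner_const[OF u(2)] L2_inner_const[OF v(2)] test_L2[OF \<phi>], of i i]
    by (simp add: inner_diff_left)
  ultimately show "integral\<^sup>L (lebesgue_on \<Omega>) (\<lambda>x. (u x - v x) * pd i \<phi> x)
      = - integral\<^sup>L (lebesgue_on \<Omega>) (\<lambda>x. (g x - h x) \<bullet> i * \<phi> x)"
    using u(3) v(3) \<phi> i unfolding has_weak_gradient_def by auto
qed

text \<open>The closure of the pairs \<open>(\<phi>, grad \<phi>)\<close> in a product of two
  \<open>L2\<close> spaces: membership in \<open>H10\<close> with the gradient carried along, so
  that limits and linear combinations never meet the choice operator behind
  \<open>weak_grad\<close>.\<close>

definition H10_pair :: "('a \<Rightarrow> real) \<Rightarrow> ('a \<Rightarrow> 'a) \<Rightarrow> bool" where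
  "H10_pair u g \<longleftrightarrow> u \<in> L2 \<Omega> \<and> g \<in> L2 \<Omega> \<and> (\<exists>\<phi>. (\<forall>n::nat. \<phi> n \<in> test_functions \<Omega>) \<and>
     (\<lambda>n. L2_norm \<Omega> (\<lambda>x. \<phi> n x - u x)) \<longlonglongrightarrow> 0 \<and> (\<lambda>n. L2_norm \<Omega> (\<lambda>x. grad (\<phi> n) x - g x)) \<longlonglongrightarrow> 0)"

lemma H10_pairE:
  assumes "H10_pair u g"
  obtains \<phi> where "u \<in> L2 \<Omega>" "g \<in> L2 \<Omega>" "\<And>n::nat. \<phi> n \<in> test_functions \<Omega>"
    "(\<lambda>n. L2_norm \<Omega> (\<lambda>x. \<phi> n x - u x)) \<longlonglongrightarrow> 0" "(\<lambda>n. L2_norm \<Omega> (\<lambda>x. grad (\<phi> n) x - g x)) \<longlonglongrightarrow> 0"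
  using assms unfolding H10_pair_def by blast

lemma H10_pair_L2: "H10_pair u g \<Longrightarrow> u \<in> L2 \<Omega>" "H10_pair u g \<Longrightarrow> g \<in> L2 \<Omega>"
  by (auto simp: H10_pair_def)

text \<open>For a fixed test function, integration by parts involves only inner products in
  \<open>L2\<close>, and these are continuous along the approximating sequence.\<close>

lemma H10_pair_weak_gradient:
  assumes "H10_pair u g"
  shows "has_weak_gradient \<Omega> u g"
  unfolding has_weak_gradient_def
proof (intro ballI)
  fix \<psi> i assume \<psi>: "\<psi> \<in> test_functions \<Omega>" and i: "i \<in> (Basis :: 'a set)"
  obtain \<phi> where \<phi>: "u \<in> L2 \<Omega>" "g \<in> L2 \<Omega>" "\<And>n::nat. \<phi> n \<in> test_functions \<Omega>"
    "(\<lambda>n. L2_norm \<Omega> (\<lambda>x. \<phi> n x - u x)) \<longlonglongrightarrow> 0" "(\<lambda>n. L2_norm \<Omega> (\<lambda>x. grad (\<phi> n) x - g x)) \<longlonglongrightarrow> 0"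
    by (rule H10_pairE[OF assms]) blast
  have \<psi>i: "(\<lambda>x. \<psi> x *\<^sub>R i) \<in> L2 \<Omega>"
    using test_L2[OF \<psi>] i by (auto simp: L2_def)
  have l1: "(\<lambda>n. ip \<Omega> (\<phi> n) (pd i \<psi>)) \<longlonglongrightarrow> ip \<Omega> u (pd i \<psi>)"
    by (intro ip_tendsto test_L2 test_functions_pd \<psi> i \<phi>)
  have l2: "(\<lambda>n. ip \<Omega> (grad (\<phi> n)) (\<lambda>x. \<psi> x *\<^sub>R i)) \<longlonglongrightarrow> ip \<Omega> g (\<lambda>x. \<psi> x *\<^sub>R i)"
    by (intro ip_tendsto grad_test_L2 \<psi>i \<phi>)
  have eq: "ip \<Omega> (\<phi> n) (pd i \<psi>) = - ip \<Omega> (grad (\<phi> n)) (\<lambda>x. \<psi> x *\<^sub>R i)" for n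
    using weak_gradient_test[OF \<phi>(3)[of n]] \<psi> i by (simp add: has_weak_gradient_def mult.commute)
  have "ip \<Omega> u (pd i \<psi>) = - ip \<Omega> g (\<lambda>x. \<psi> x *\<^sub>R i)"
    by (rule LIMSEQ_unique[OF l1]) (simp only: eq tendsto_minus[OF l2])
  then show "integral\<^sup>L (lebesgue_on \<Omega>) (\<lambda>x. u x * pd i \<psi> x) = - integral\<^sup>L (lebesgue_on \<Omega>) (\<lambda>x. (g x \<bullet> i) * \<psi> x)"
    by (simp add: mult.commute)
qed

lemma H10_imp_pair:
  assumes "u \<in> H10 \<Omega>"
  shows "H10_pair u (weak_grad \<Omega> u)"
proof -
  have u: "u \<in> H1 \<Omega>" "u \<in> L2 \<Omega>" using assms by (auto simp: H10_def H1_def)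
  obtain \<phi> where \<phi>: "\<And>n::nat. \<phi> n \<in> test_functions \<Omega>" "(\<lambda>n. H1_norm \<Omega> (\<lambda>x. \<phi> n x - u x)) \<longlonglongrightarrow> 0"
    using assms by (auto simp: H10_def)
  have eq: "H1_norm \<Omega> (\<lambda>x. \<phi> n x - u x)
      = sqrt ((L2_norm \<Omega> (\<lambda>x. \<phi> n x - u x))\<^sup>2 + (L2_norm \<Omega> (\<lambda>x. grad (\<phi> n) x - weak_grad \<Omega> u x))\<^sup>2)" for n
    by (rule H1_norm_eq[OF L2_diff[OF test_L2[OF \<phi>(1)] u(2)] L2_diff[OF grad_test_L2[OF \<phi>(1)] weak_grad(1)[OF u(1)]]
          has_weak_gradient_diff[OF test_L2[OF \<phi>(1)] grad_test_L2[OF \<phi>(1)] weak_gradient_test[OF \<phi>(1)]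
            u(2) weak_grad[OF u(1)]]])
  have "(\<lambda>n. L2_norm \<Omega> (\<lambda>x. \<phi> n x - u x)) \<longlonglongrightarrow> 0"
    by (rule tendsto_sandwich[OF _ _ tendsto_const \<phi>(2)]) (auto simp: eq L2_norm_nonneg intro!: always_eventually real_le_rsqrt)
  moreover have "(\<lambda>n. L2_norm \<Omega> (\<lambda>x. grad (\<phi> n) x - weak_grad \<Omega> u x)) \<longlonglongrightarrow> 0"
    by (rule tendsto_sandwich[OF _ _ tendsto_const \<phi>(2)]) (auto simp: eq L2_norm_nonneg intro!: always_eventually real_le_rsqrt)
  ultimately show ?thesis
    unfolding H10_pair_def using u weak_grad \<phi>(1) by blast
qed

lemma H10_pair_imp_H10:
  assumes "H10_pair u g"
  shows "u \<in> H10 \<Omega>"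
proof -
  obtain \<phi> where \<phi>: "u \<in> L2 \<Omega>" "g \<in> L2 \<Omega>" "\<And>n::nat. \<phi> n \<in> test_functions \<Omega>"
    "(\<lambda>n. L2_norm \<Omega> (\<lambda>x. \<phi> n x - u x)) \<longlonglongrightarrow> 0" "(\<lambda>n. L2_norm \<Omega> (\<lambda>x. grad (\<phi> n) x - g x)) \<longlonglongrightarrow> 0"
    by (rule H10_pairE[OF assms(1)]) blast
  have w: "has_weak_gradient \<Omega> u g" by (rule H10_pair_weak_gradient[OF assms])
  have eq: "H1_norm \<Omega> (\<lambda>x. \<phi> n x - u x)
      = sqrt ((L2_norm \<Omega> (\<lambda>x. \<phi> n x - u x))\<^sup>2 + (L2_norm \<Omega> (\<lambda>x. grad (\<phi> n) x - g x))\<^sup>2)" for n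
    by (rule H1_norm_eq[OF L2_diff[OF test_L2[OF \<phi>(3)] \<phi>(1)] L2_diff[OF grad_test_L2[OF \<phi>(3)] \<phi>(2)]
          has_weak_gradient_diff[OF test_L2[OF \<phi>(3)] grad_test_L2[OF \<phi>(3)] weak_gradient_test[OF \<phi>(3)]
            \<phi>(1,2) w]])
  have "(\<lambda>n. sqrt ((L2_norm \<Omega> (\<lambda>x. \<phi> n x - u x))\<^sup>2 + (L2_norm \<Omega> (\<lambda>x. grad (\<phi> n) x - g x))\<^sup>2)) \<longlonglongrightarrow> sqrt (0\<^sup>2 + 0\<^sup>2)"
    by (intro tendsto_intros \<phi>)
  then have "(\<lambda>n. H1_norm \<Omega> (\<lambda>x. \<phi> n x - u x)) \<longlonglongrightarrow> 0" unfolding eq by simp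
  moreover have "u \<in> H1 \<Omega>" unfolding H1_def using \<phi>(1,2) w by blast
  ultimately show ?thesis unfolding H10_def using \<phi>(3) by blast
qed

lemma H10_pair_test: "\<phi> \<in> test_functions \<Omega> \<Longrightarrow> H10_pair \<phi> (grad \<phi>)"
  unfolding H10_pair_def by (auto intro!: exI[of _ "\<lambda>_. \<phi>"] test_L2 grad_test_L2 simp: L2_norm_def)

lemma H10_pair_combine:
  assumes u: "H10_pair u g" and v: "H10_pair v h"
  shows "H10_pair (\<lambda>x. u x + c * v x) (\<lambda>x. g x + c *\<^sub>R h x)"
proof -
  obtain \<phi> where \<phi>: "u \<in> L2 \<Omega>" "g \<in> L2 \<Omega>" "\<And>n::nat. \<phi> n \<in> test_functions \<Omega>"
    "(\<lambda>n. L2_norm \<Omega> (\<lambda>x. \<phi> n x - u x)) \<longlonglongrightarrow> 0" "(\<lambda>n. L2_norm \<Omega> (\<lambda>x. grad (\<phi> n) x - g x)) \<longlonglongrightarrow> 0"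
    by (rule H10_pairE[OF u]) blast
  obtain \<psi> where \<psi>: "v \<in> L2 \<Omega>" "h \<in> L2 \<Omega>" "\<And>n::nat. \<psi> n \<in> test_functions \<Omega>"
    "(\<lambda>n. L2_norm \<Omega> (\<lambda>x. \<psi> n x - v x)) \<longlonglongrightarrow> 0" "(\<lambda>n. L2_norm \<Omega> (\<lambda>x. grad (\<psi> n) x - h x)) \<longlonglongrightarrow> 0"
    by (rule H10_pairE[OF v]) blast
  have lim: "(\<lambda>n. L2_norm \<Omega> (\<lambda>x. (a n x + c *\<^sub>R b n x) - (a' x + c *\<^sub>R b' x))) \<longlonglongrightarrow> 0"
    if "\<And>n. a n \<in> L2 \<Omega>" "\<And>n. b n \<in> L2 \<Omega>" "a' \<in> L2 \<Omega>" "b' \<in> L2 \<Omega>"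
      "(\<lambda>n. L2_norm \<Omega> (\<lambda>x. a n x - a' x)) \<longlonglongrightarrow> 0" "(\<lambda>n. L2_norm \<Omega> (\<lambda>x. b n x - b' x)) \<longlonglongrightarrow> 0"
    for a b :: "nat \<Rightarrow> 'a \<Rightarrow> 'c::euclidean_space" and a' b'
  proof (rule tendsto_sandwich[OF _ _ tendsto_const])
    show "(\<lambda>n. L2_norm \<Omega> (\<lambda>x. a n x - a' x) + \<bar>c\<bar> * L2_norm \<Omega> (\<lambda>x. b n x - b' x)) \<longlonglongrightarrow> 0"
      using tendsto_add[OF that(5) tendsto_mult_left[OF that(6), of "\<bar>c\<bar>"]] by simp
    have "L2_norm \<Omega> (\<lambda>x. (a n x + c *\<^sub>R b n x) - (a' x + c *\<^sub>R b' x))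
      \<le> L2_norm \<Omega> (\<lambda>x. a n x - a' x) + \<bar>c\<bar> * L2_norm \<Omega> (\<lambda>x. b n x - b' x)" for n
    proof -
      have e: "(\<lambda>x. (a n x + c *\<^sub>R b n x) - (a' x + c *\<^sub>R b' x)) = (\<lambda>x. (a n x - a' x) + c *\<^sub>R (b n x - b' x))"
        by (simp add: algebra_simps)
      show ?thesis
        unfolding e L2_norm_scaleR[symmetric]
        by (rule L2_triangle[OF L2_diff[OF that(1)[of n] that(3)] L2_scaleR[OF L2_diff[OF that(2)[of n] that(4)]]])
    qed
    then show "\<forall>\<^sub>F n in sequentially. L2_norm \<Omega> (\<lambda>x. (a n x + c *\<^sub>R b n x) - (a' x + c *\<^sub>R b' x))
      \<le> L2_norm \<Omega> (\<lambda>x. a n x - a' x) + \<bar>c\<bar> * L2_norm \<Omega> (\<lambda>x. b n x - b' x)" by simp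
  qed (simp add: L2_norm_nonneg)
  have g: "grad (\<lambda>x. \<phi> n x + c * \<psi> n x) = (\<lambda>x. grad (\<phi> n) x + c *\<^sub>R grad (\<psi> n) x)" for n
    by (rule grad_test_combine[OF \<phi>(3) \<psi>(3)])
  show ?thesis
    unfolding H10_pair_def
  proof (intro conjI exI[of _ "\<lambda>n x. \<phi> n x + c * \<psi> n x"] allI)
    show "(\<lambda>x. u x + c * v x) \<in> L2 \<Omega>" by (intro L2_add L2_cmult \<phi> \<psi>)
    show "(\<lambda>x. g x + c *\<^sub>R h x) \<in> L2 \<Omega>" by (intro L2_add L2_scaleR \<phi> \<psi>)
    show "(\<lambda>x. \<phi> n x + c * \<psi> n x) \<in> test_functions \<Omega>" for n
      by (intro test_functions_add test_functions_cmult \<phi> \<psi>)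
    show "(\<lambda>n. L2_norm \<Omega> (\<lambda>x. \<phi> n x + c * \<psi> n x - (u x + c * v x))) \<longlonglongrightarrow> 0"
      using lim[of \<phi> \<psi> u v] \<phi> \<psi> test_L2 by simp
    show "(\<lambda>n. L2_norm \<Omega> (\<lambda>x. grad (\<lambda>x. \<phi> n x + c * \<psi> n x) x - (g x + c *\<^sub>R h x))) \<longlonglongrightarrow> 0"
      unfolding g using lim[of "\<lambda>n. grad (\<phi> n)" "\<lambda>n. grad (\<psi> n)" g h] \<phi> \<psi> grad_test_L2 by simp
  qed
qed

section \<open>The Poincare inequality and weak solutions\<close>

text \<open>Integrate \<open>\<partial>\<^sub>i (x\<^sub>i \<phi>\<^sup>2) = \<phi>\<^sup>2 + 2 x\<^sub>i \<phi> \<partial>\<^sub>i \<phi>\<close> over \<open>\<Omega>\<close>.\<close>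

lemma Poincare_test:
  obtains c where "c > 0" "\<And>\<phi>. \<phi> \<in> test_functions \<Omega> \<Longrightarrow> L2_norm \<Omega> \<phi> \<le> c * L2_norm \<Omega> (grad \<phi>)"
proof -
  obtain r where r: "r > 0" "\<And>x. x \<in> \<Omega> \<Longrightarrow> norm x \<le> r"
    using bounded_\<Omega> by (auto simp: bounded_pos)
  obtain i :: 'a where i: "i \<in> Basis" using nonempty_Basis by blast
  have "L2_norm \<Omega> \<phi> \<le> 2 * r * L2_norm \<Omega> (grad \<phi>)" if \<phi>: "\<phi> \<in> test_functions \<Omega>" for \<phi>
  proof -
    have s: "smooth \<phi>" by (rule test_functions_smooth[OF \<phi>])
    define p where "p x = (x \<bullet> i) * pd i \<phi> x" for x
    have p: "p \<in> test_functions \<Omega>"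
      unfolding p_def by (intro test_functions_mult test_functions_pd \<phi> i smooth_inner)
    have pdx: "pd i (\<lambda>x. x \<bullet> i) x = 1" for x
    proof -
      have "((\<lambda>x. x \<bullet> i) has_derivative (\<lambda>h. h \<bullet> i)) (at x)" by (auto intro!: derivative_eq_intros)
      then show ?thesis using i frechet_derivative_at by (metis inner_same_Basis)
    qed
    have "pd i (\<lambda>x. (x \<bullet> i) * (\<phi> x * \<phi> x)) x = 2 * (\<phi> x * p x) + \<phi> x * \<phi> x" for x
      using pd_mult[OF smooth_inner smooth_mult[OF s s], where i = i and x = x] pd_mult[OF s s, where i = i and x = x]
      by (simp add: pdx p_def algebra_simps)
    moreover have "integral\<^sup>L (lebesgue_on \<Omega>) (pd i (\<lambda>x. (x \<bullet> i) * (\<phi> x * \<phi> x))) = 0"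
      by (intro integral_pd_test i test_functions_mult \<phi> s smooth_inner)
    ultimately have "integral\<^sup>L (lebesgue_on \<Omega>) (\<lambda>x. 2 * (\<phi> x * p x) + \<phi> x * \<phi> x) = 0"
      by (metis (no_types, lifting) ext)
    then have "2 * ip \<Omega> \<phi> p + ip \<Omega> \<phi> \<phi> = 0"
      using L2_integrable_inner[OF test_L2[OF \<phi>] test_L2[OF p]] L2_integrable_inner[OF test_L2[OF \<phi>] test_L2[OF \<phi>]]
      by simp
    then have 1: "(L2_norm \<Omega> \<phi>)\<^sup>2 \<le> 2 * (L2_norm \<Omega> \<phi> * L2_norm \<Omega> p)"
      using L2_Cauchy_Schwarz[OF test_L2[OF \<phi>] test_L2[OF p]] unfolding L2_norm_sq by linarith
    have "L2_norm \<Omega> p \<le> r * L2_norm \<Omega> (grad \<phi>)"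
    proof -
      have "ip \<Omega> p p \<le> integral\<^sup>L (lebesgue_on \<Omega>) (\<lambda>x. r\<^sup>2 * (grad \<phi> x \<bullet> grad \<phi> x))"
      proof (rule integral_mono_AE)
        show "integrable (lebesgue_on \<Omega>) (\<lambda>x. p x \<bullet> p x)" by (intro L2_integrable_inner test_L2 p)
        show "integrable (lebesgue_on \<Omega>) (\<lambda>x. r\<^sup>2 * (grad \<phi> x \<bullet> grad \<phi> x))"
          by (intro integrable_mult_right L2_integrable_inner grad_test_L2 \<phi>)
        show "AE x in lebesgue_on \<Omega>. p x \<bullet> p x \<le> r\<^sup>2 * (grad \<phi> x \<bullet> grad \<phi> x)"
        proof (rule AE_I2)
          fix x assume "x \<in> space (lebesgue_on \<Omega>)"
          then have "\<bar>x \<bullet> i\<bar> \<le> r" using r(2)[of x] Basis_le_norm[OF i, of x] by (auto simp: space_restrict_space)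
          moreover have "\<bar>pd i \<phi> x\<bar> \<le> norm (grad \<phi> x)"
            using Basis_le_norm[OF i, of "grad \<phi> x"] by (simp add: grad_inner_Basis[OF i])
          ultimately have "\<bar>p x\<bar> \<le> r * norm (grad \<phi> x)"
            unfolding p_def abs_mult using r(1) by (intro mult_mono) auto
          then have "\<bar>p x\<bar>\<^sup>2 \<le> (r * norm (grad \<phi> x))\<^sup>2" by (intro power_mono) auto
          then show "p x \<bullet> p x \<le> r\<^sup>2 * (grad \<phi> x \<bullet> grad \<phi> x)"
            by (simp add: power_mult_distrib power2_norm_eq_inner[symmetric] power2_eq_square[of "p x", symmetric])
        qed
      qed
      also have "\<dots> = (r * L2_norm \<Omega> (grad \<phi>))\<^sup>2" by (simp add: power_mult_distrib L2_norm_sq)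
      finally show ?thesis
        using r(1) L2_norm_nonneg[of \<Omega> "grad \<phi>"] by (subst L2_norm_le_iff) auto
    qed
    then have *: "L2_norm \<Omega> \<phi> * L2_norm \<Omega> \<phi> \<le> L2_norm \<Omega> \<phi> * (2 * r * L2_norm \<Omega> (grad \<phi>))"
      using 1 mult_left_mono[of "L2_norm \<Omega> p" "r * L2_norm \<Omega> (grad \<phi>)" "L2_norm \<Omega> \<phi>"] L2_norm_nonneg[of \<Omega> \<phi>]
      by (simp add: power2_eq_square)
    then show ?thesis
    proof (cases "L2_norm \<Omega> \<phi> = 0")
      case True
      then show ?thesis using r(1) L2_norm_nonneg by (metis less_imp_le mult_nonneg_nonneg zero_le_numeral)
    next
      case False
      then have "0 < L2_norm \<Omega> \<phi>" using L2_norm_nonneg[of \<Omega> \<phi>] by linarith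
      then show ?thesis using * by (simp only: mult_le_cancel_left_pos)
    qed
  qed
  then show thesis using r(1) by (intro that[of "2 * r"]) auto
qed

lemma Poincare:
  obtains c where "c > 0" "\<And>u g. H10_pair u g \<Longrightarrow> L2_norm \<Omega> u \<le> c * L2_norm \<Omega> g"
proof -
  obtain c where c: "c > 0" "\<And>\<phi>. \<phi> \<in> test_functions \<Omega> \<Longrightarrow> L2_norm \<Omega> \<phi> \<le> c * L2_norm \<Omega> (grad \<phi>)"
    using Poincare_test by blast
  have "L2_norm \<Omega> u \<le> c * L2_norm \<Omega> g" if ug: "H10_pair u g" for u g
  proof -
    obtain \<phi> where \<phi>: "u \<in> L2 \<Omega>" "g \<in> L2 \<Omega>" "\<And>n::nat. \<phi> n \<in> test_functions \<Omega>"
      "(\<lambda>n. L2_norm \<Omega> (\<lambda>x. \<phi> n x - u x)) \<longlonglongrightarrow> 0" "(\<lambda>n. L2_norm \<Omega> (\<lambda>x. grad (\<phi> n) x - g x)) \<longlonglongrightarrow> 0"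
      by (rule H10_pairE[OF ug]) blast
    have "(\<lambda>n. L2_norm \<Omega> (\<phi> n)) \<longlonglongrightarrow> L2_norm \<Omega> u" "(\<lambda>n. c * L2_norm \<Omega> (grad (\<phi> n))) \<longlonglongrightarrow> c * L2_norm \<Omega> g"
      by (intro L2_norm_tendsto tendsto_mult_left test_L2 grad_test_L2 \<phi>)+
    then show ?thesis using c(2)[OF \<phi>(3)] by (intro LIMSEQ_le) auto
  qed
  then show thesis using c(1) that by blast
qed

text \<open>The equation is tested against test functions only, and the gradient is an explicit
  argument. Density extends it to all of \<open>H10\<close> in \<open>weak_solution_H10\<close>, and
  \<open>weak_poisson_solution_iff\<close> ties it to the original notion.\<close>

definition weak_solution :: "('a \<Rightarrow> real) \<Rightarrow> ('a \<Rightarrow> real) \<Rightarrow> ('a \<Rightarrow> 'a) \<Rightarrow> bool" where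
  "weak_solution f u g \<longleftrightarrow> H10_pair u g \<and> (\<forall>\<phi>\<in>test_functions \<Omega>. ip \<Omega> g (grad \<phi>) = ip \<Omega> f \<phi>)"

lemma weak_solution_H10:
  assumes f: "f \<in> L2 \<Omega>" and ug: "weak_solution f u g" and v: "H10_pair v h"
  shows "ip \<Omega> g h = ip \<Omega> f v"
proof -
  obtain \<phi> where \<phi>: "v \<in> L2 \<Omega>" "h \<in> L2 \<Omega>" "\<And>n::nat. \<phi> n \<in> test_functions \<Omega>"
    "(\<lambda>n. L2_norm \<Omega> (\<lambda>x. \<phi> n x - v x)) \<longlonglongrightarrow> 0" "(\<lambda>n. L2_norm \<Omega> (\<lambda>x. grad (\<phi> n) x - h x)) \<longlonglongrightarrow> 0"
    by (rule H10_pairE[OF v]) blast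
  have g: "g \<in> L2 \<Omega>" using ug H10_pair_L2 by (auto simp: weak_solution_def)
  have 1: "(\<lambda>n. ip \<Omega> (grad (\<phi> n)) g) \<longlonglongrightarrow> ip \<Omega> h g"
    by (intro ip_tendsto grad_test_L2 \<phi> g)
  have 2: "(\<lambda>n. ip \<Omega> (\<phi> n) f) \<longlonglongrightarrow> ip \<Omega> v f"
    by (intro ip_tendsto test_L2 \<phi> f)
  have "ip \<Omega> (grad (\<phi> n)) g = ip \<Omega> (\<phi> n) f" for n
    using ug \<phi>(3)[of n] ip_commute unfolding weak_solution_def by metis
  then have "ip \<Omega> h g = ip \<Omega> v f" using LIMSEQ_unique[OF 1] 2 by simp
  then show ?thesis unfolding ip_commute[of \<Omega> g] ip_commute[of \<Omega> f] .
qed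

lemma weak_poisson_solution_iff:
  assumes f: "f \<in> L2 \<Omega>"
  shows "weak_poisson_solution \<Omega> f u \<longleftrightarrow> (\<exists>g. weak_solution f u g)"
proof
  assume L: "weak_poisson_solution \<Omega> f u"
  then have u: "H10_pair u (weak_grad \<Omega> u)" by (auto simp: weak_poisson_solution_def H10_imp_pair)
  have "ip \<Omega> (weak_grad \<Omega> u) (grad \<phi>) = ip \<Omega> f \<phi>" if \<phi>: "\<phi> \<in> test_functions \<Omega>" for \<phi>
  proof -
    have "\<phi> \<in> H10 \<Omega>" by (rule H10_pair_imp_H10[OF H10_pair_test[OF \<phi>]])
    then have "ip \<Omega> (weak_grad \<Omega> u) (weak_grad \<Omega> \<phi>) = ip \<Omega> f \<phi>"
      using L by (simp add: weak_poisson_solution_def)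
    moreover have "ip \<Omega> (weak_grad \<Omega> u) (weak_grad \<Omega> \<phi>) = ip \<Omega> (weak_grad \<Omega> u) (grad \<phi>)"
    proof (rule integral_cong_AE)
      have AE: "AE x in lebesgue_on \<Omega>. weak_grad \<Omega> \<phi> x = grad \<phi> x"
        by (intro weak_grad_AE test_L2 grad_test_L2 weak_gradient_test \<phi>)
      then show "AE x in lebesgue_on \<Omega>. weak_grad \<Omega> u x \<bullet> weak_grad \<Omega> \<phi> x = weak_grad \<Omega> u x \<bullet> grad \<phi> x"
        by eventually_elim simp
      have "\<phi> \<in> H1 \<Omega>" using \<open>\<phi> \<in> H10 \<Omega>\<close> by (simp add: H10_def)
      then show "(\<lambda>x. weak_grad \<Omega> u x \<bullet> weak_grad \<Omega> \<phi> x) \<in> borel_measurable (lebesgue_on \<Omega>)"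
        by (intro borel_measurable_inner L2_measurable H10_pair_L2(2)[OF u] weak_grad(1))
      show "(\<lambda>x. weak_grad \<Omega> u x \<bullet> grad \<phi> x) \<in> borel_measurable (lebesgue_on \<Omega>)"
        by (intro borel_measurable_inner L2_measurable H10_pair_L2(2)[OF u] grad_test_L2 \<phi>)
    qed
    ultimately show ?thesis by simp
  qed
  then show "\<exists>g. weak_solution f u g" using u by (auto simp: weak_solution_def)
next
  assume "\<exists>g. weak_solution f u g"
  then obtain g where g: "weak_solution f u g" by blast
  then have ug: "H10_pair u g" by (simp add: weak_solution_def)
  have u: "u \<in> H10 \<Omega>" by (rule H10_pair_imp_H10[OF ug])
  have AE: "AE x in lebesgue_on \<Omega>. weak_grad \<Omega> u x = g x"
    by (intro weak_grad_AE H10_pair_weak_gradient ug H10_pair_L2[OF ug])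
  have "ip \<Omega> (weak_grad \<Omega> u) (weak_grad \<Omega> v) = ip \<Omega> f v" if v: "v \<in> H10 \<Omega>" for v
  proof -
    note vp = H10_imp_pair[OF v]
    have "ip \<Omega> (weak_grad \<Omega> u) (weak_grad \<Omega> v) = ip \<Omega> g (weak_grad \<Omega> v)"
    proof (rule integral_cong_AE)
      show "AE x in lebesgue_on \<Omega>. weak_grad \<Omega> u x \<bullet> weak_grad \<Omega> v x = g x \<bullet> weak_grad \<Omega> v x"
        using AE by eventually_elim simp
      have "u \<in> H1 \<Omega>" using u by (simp add: H10_def)
      then show "(\<lambda>x. weak_grad \<Omega> u x \<bullet> weak_grad \<Omega> v x) \<in> borel_measurable (lebesgue_on \<Omega>)"
        by (intro borel_measurable_inner L2_measurable H10_pair_L2(2)[OF vp] weak_grad(1))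
      show "(\<lambda>x. g x \<bullet> weak_grad \<Omega> v x) \<in> borel_measurable (lebesgue_on \<Omega>)"
        by (intro borel_measurable_inner L2_measurable H10_pair_L2(2)[OF vp] H10_pair_L2(2)[OF ug])
    qed
    also have "\<dots> = ip \<Omega> f v" by (rule weak_solution_H10[OF f g vp])
    finally show ?thesis .
  qed
  then show "weak_poisson_solution \<Omega> f u" using u by (simp add: weak_poisson_solution_def)
qed

lemma weak_solution_combine:
  assumes f: "f \<in> L2 \<Omega>" "weak_solution f u g" and f': "f' \<in> L2 \<Omega>" "weak_solution f' u' g'"
  shows "weak_solution (\<lambda>x. f x + c * f' x) (\<lambda>x. u x + c * u' x) (\<lambda>x. g x + c *\<^sub>R g' x)"
proof -
  have p: "H10_pair u g" "H10_pair u' g'" using f f' by (auto simp: weak_solution_def)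
  have "ip \<Omega> (\<lambda>x. g x + c *\<^sub>R g' x) (grad \<phi>) = ip \<Omega> (\<lambda>x. f x + c * f' x) \<phi>" if \<phi>: "\<phi> \<in> test_functions \<Omega>" for \<phi>
  proof -
    have "ip \<Omega> (\<lambda>x. g x + c *\<^sub>R g' x) (grad \<phi>) = ip \<Omega> g (grad \<phi>) + c * ip \<Omega> g' (grad \<phi>)"
      using ip_add_left[OF H10_pair_L2(2)[OF p(1)] L2_scaleR[OF H10_pair_L2(2)[OF p(2)]] grad_test_L2[OF \<phi>], of c]
      by simp
    also have "\<dots> = ip \<Omega> f \<phi> + c * ip \<Omega> f' \<phi>"
      using f(2) f'(2) \<phi> by (simp add: weak_solution_def)
    also have "\<dots> = ip \<Omega> (\<lambda>x. f x + c * f' x) \<phi>"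
      using ip_add_left[OF f(1) L2_cmult[OF f'(1)] test_L2[OF \<phi>], of c] by (simp add: mult.assoc)
    finally show ?thesis .
  qed
  then show ?thesis using H10_pair_combine[OF p, of c] by (simp add: weak_solution_def)
qed

text \<open>Testing the equation with \<open>u\<close> itself equates the energy with the pairing of
  \<open>f\<close> and \<open>u\<close>. The Poincare constant enters twice, once in bounding this
  pairing and once in returning from the gradient to \<open>u\<close>.\<close>

lemma weak_solution_bound:
  obtains c where "c > 0" "\<And>f u g. f \<in> L2 \<Omega> \<Longrightarrow> weak_solution f u g \<Longrightarrow> L2_norm \<Omega> u \<le> c * L2_norm \<Omega> f"
proof -
  obtain c where c: "c > 0" "\<And>u g. H10_pair u g \<Longrightarrow> L2_norm \<Omega> u \<le> c * L2_norm \<Omega> g"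
    using Poincare by blast
  have "L2_norm \<Omega> u \<le> c * c * L2_norm \<Omega> f" if f: "f \<in> L2 \<Omega>" and s: "weak_solution f u g" for f u g
  proof -
    have ug: "H10_pair u g" using s by (simp add: weak_solution_def)
    have "(L2_norm \<Omega> g)\<^sup>2 = ip \<Omega> f u"
      unfolding L2_norm_sq by (rule weak_solution_H10[OF f s ug])
    also have "\<dots> \<le> L2_norm \<Omega> f * L2_norm \<Omega> u"
      using L2_Cauchy_Schwarz[OF f H10_pair_L2(1)[OF ug]] by linarith
    also have "\<dots> \<le> L2_norm \<Omega> f * (c * L2_norm \<Omega> g)"
      by (intro mult_left_mono c(2) ug L2_norm_nonneg)
    finally have "L2_norm \<Omega> g * L2_norm \<Omega> g \<le> (c * L2_norm \<Omega> f) * L2_norm \<Omega> g"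
      by (simp add: power2_eq_square mult_ac)
    then have "L2_norm \<Omega> g \<le> c * L2_norm \<Omega> f"
      using L2_norm_nonneg[of \<Omega> g] L2_norm_nonneg[of \<Omega> f] c(1)
      by (cases "L2_norm \<Omega> g = 0") (auto simp: mult_le_cancel_right)
    then have "c * L2_norm \<Omega> g \<le> c * (c * L2_norm \<Omega> f)" using c(1) by (intro mult_left_mono) auto
    then show ?thesis using c(2)[OF ug] by (simp add: mult.assoc)
  qed
  then show thesis using c(1) by (intro that[of "c * c"]) auto
qed

text \<open>Dirichlet's principle, over test functions only. The energy \<open>J\<close> is
  quadratic with leading part the squared norm of the gradient, so near-minimisers have nearby
  gradients and, by Poincare, nearby values. The limit of the pairs is the solution.\<close>

lemma weak_solution_exists:
  assumes f: "f \<in> L2 \<Omega>"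
  obtains u g where "weak_solution f u g"
proof -
  obtain c where c: "c > 0" "\<And>\<phi>. \<phi> \<in> test_functions \<Omega> \<Longrightarrow> L2_norm \<Omega> \<phi> \<le> c * L2_norm \<Omega> (grad \<phi>)"
    using Poincare_test by blast
  define J where "J \<phi> = ip \<Omega> (grad \<phi>) (grad \<phi>) - 2 * ip \<Omega> \<phi> f" for \<phi>
  \<comment> \<open>Poincare bounds the linear term by a multiple of the gradient norm; completing
    the square bounds \<open>J\<close> from below.\<close>
  have low: "- (c * L2_norm \<Omega> f)\<^sup>2 \<le> J \<phi>" if \<phi>: "\<phi> \<in> test_functions \<Omega>" for \<phi>
  proof -
    have "ip \<Omega> \<phi> f \<le> L2_norm \<Omega> \<phi> * L2_norm \<Omega> f"
      using L2_Cauchy_Schwarz[OF test_L2[OF \<phi>] f] by linarith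
    also have "\<dots> \<le> c * L2_norm \<Omega> (grad \<phi>) * L2_norm \<Omega> f"
      by (intro mult_right_mono c \<phi> L2_norm_nonneg)
    finally have "J \<phi> \<ge> (L2_norm \<Omega> (grad \<phi>))\<^sup>2 - 2 * (L2_norm \<Omega> (grad \<phi>) * (c * L2_norm \<Omega> f))"
      by (simp add: J_def L2_norm_sq mult_ac)
    moreover have "2 * (L2_norm \<Omega> (grad \<phi>) * (c * L2_norm \<Omega> f)) \<le> (L2_norm \<Omega> (grad \<phi>))\<^sup>2 + (c * L2_norm \<Omega> f)\<^sup>2"
      using sum_squares_bound[of "L2_norm \<Omega> (grad \<phi>)" "c * L2_norm \<Omega> f"] by (simp add: mult_ac)
    ultimately show ?thesis by linarith
  qed
  define m where "m = Inf (J ` test_functions \<Omega>)"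
  have bdd: "bdd_below (J ` test_functions \<Omega>)" using low by (rule bdd_belowI2)
  have mle: "m \<le> J \<phi>" if "\<phi> \<in> test_functions \<Omega>" for \<phi>
    unfolding m_def using bdd that by (intro cInf_lower) auto
  have "\<exists>\<phi>. \<phi> \<in> test_functions \<Omega> \<and> J \<phi> < m + 1 / real (Suc n)" for n
    using cInf_lessD[of "J ` test_functions \<Omega>" "m + 1 / real (Suc n)"] test_functions_zero[of \<Omega>]
    unfolding m_def by auto
  then obtain \<phi> where \<phi>: "\<And>n. \<phi> n \<in> test_functions \<Omega>" and Jn: "\<And>n. J (\<phi> n) < m + 1 / real (Suc n)"
    by metis
  have J_line: "J (\<lambda>x. \<phi> x + t * \<psi> x) = J \<phi> + 2 * t * (ip \<Omega> (grad \<phi>) (grad \<psi>) - ip \<Omega> \<psi> f) + t\<^sup>2 * ip \<Omega> (grad \<psi>) (grad \<psi>)"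
    if \<phi>: "\<phi> \<in> test_functions \<Omega>" and \<psi>: "\<psi> \<in> test_functions \<Omega>" for \<phi> \<psi> t
  proof -
    have g: "grad (\<lambda>x. \<phi> x + t * \<psi> x) = (\<lambda>x. grad \<phi> x + t *\<^sub>R grad \<psi> x)"
      by (rule grad_test_combine[OF \<phi> \<psi>])
    have l: "ip \<Omega> (\<lambda>x. \<phi> x + t * \<psi> x) f = ip \<Omega> \<phi> f + t * ip \<Omega> \<psi> f"
      using ip_add_left[OF test_L2[OF \<phi>] L2_cmult[OF test_L2[OF \<psi>]] f, of t] by (simp add: mult.assoc)
    show ?thesis
      unfolding J_def g l ip_add_expand[OF grad_test_L2[OF \<phi>] grad_test_L2[OF \<psi>]] by (simp add: algebra_simps)
  qed
  \<comment> \<open>Comparing \<open>J\<close> at \<open>\<phi> k\<close>, at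
    \<open>\<phi> n\<close> and at their midpoint, where it is at least \<open>m\<close>, isolates
    the second-order term.\<close>
  have dist: "(L2_norm \<Omega> (\<lambda>x. grad (\<phi> k) x - grad (\<phi> n) x))\<^sup>2 \<le> 2 * (1 / real (Suc k) + 1 / real (Suc n))" for k n
  proof -
    define \<psi> where "\<psi> x = \<phi> n x - \<phi> k x" for x
    have \<psi>: "\<psi> \<in> test_functions \<Omega>" unfolding \<psi>_def by (intro test_functions_diff \<phi>)
    have g: "grad \<psi> = (\<lambda>x. grad (\<phi> n) x - grad (\<phi> k) x)"
      unfolding \<psi>_def[abs_def] by (rule grad_test_diff[OF \<phi> \<phi>])
    let ?b = "ip \<Omega> (grad (\<phi> k)) (grad \<psi>) - ip \<Omega> \<psi> f"
    let ?a = "ip \<Omega> (grad \<psi>) (grad \<psi>)"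
    have "J (\<phi> n) = J (\<phi> k) + 2 * ?b + ?a"
      using J_line[OF \<phi>[of k] \<psi>, of 1] by (simp add: \<psi>_def)
    moreover have "m \<le> J (\<phi> k) + ?b + ?a / 4"
      using J_line[OF \<phi>[of k] \<psi>, of "1 / 2"] mle[OF test_functions_add[OF \<phi>[of k] test_functions_cmult[OF \<psi>, of "1 / 2"]]]
      by (simp add: power2_eq_square)
    moreover have "a \<le> 2 * ((x - m) + (y - m))" if "y = x + 2 * b + a" "m \<le> x + b + a / 4" for a b x y :: real
      using that by argo
    ultimately have "?a \<le> 2 * ((J (\<phi> k) - m) + (J (\<phi> n) - m))" by blast
    moreover have "a \<le> 2 * (c + d)" if "a \<le> 2 * ((x - m) + (y - m))" "x < m + c" "y < m + d" for a c d x y :: real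
      using that by argo
    ultimately have "?a \<le> 2 * (1 / real (Suc k) + 1 / real (Suc n))" using Jn[of k] Jn[of n] by blast
    then show ?thesis unfolding L2_norm_minus_commute[of \<Omega> "grad (\<phi> k)"] L2_norm_sq g[symmetric] .
  qed
  have Cauchy_g: "\<exists>N. \<forall>k\<ge>N. \<forall>n\<ge>N. L2_norm \<Omega> (\<lambda>x. grad (\<phi> k) x - grad (\<phi> n) x) \<le> e" if e: "e > 0" for e
  proof -
    obtain N where N: "1 / real (Suc N) < e\<^sup>2 / 4" using nat_approx_posE[of "e\<^sup>2 / 4"] e by auto
    have "L2_norm \<Omega> (\<lambda>x. grad (\<phi> k) x - grad (\<phi> n) x) \<le> e" if "k \<ge> N" "n \<ge> N" for k n
    proof -
      have le: "1 / real (Suc k) \<le> 1 / real (Suc N)" "1 / real (Suc n) \<le> 1 / real (Suc N)"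
        using that by (auto intro!: divide_left_mono)
      have "(L2_norm \<Omega> (\<lambda>x. grad (\<phi> k) x - grad (\<phi> n) x))\<^sup>2 \<le> e\<^sup>2"
      proof -
        have N4: "4 * (1 / real (Suc N)) < e\<^sup>2" using N by simp
        have gen: "X \<le> E" if "X \<le> 2 * (A + B)" "A \<le> C" "B \<le> C" "4 * C < E" for X A B C E :: real
          using that by argo
        show ?thesis by (rule gen[OF dist le N4])
      qed
      then show ?thesis by (rule power2_le_imp_le) (use e in simp)
    qed
    then show ?thesis by blast
  qed
  obtain g where g: "g \<in> L2 \<Omega>" "(\<lambda>n. L2_norm \<Omega> (\<lambda>x. grad (\<phi> n) x - g x)) \<longlonglongrightarrow> 0"
    by (rule L2_complete[OF open_\<Omega> bounded_\<Omega>, of "\<lambda>n. grad (\<phi> n)", OF grad_test_L2[OF \<phi>] Cauchy_g])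
  have Cauchy_u: "\<exists>N. \<forall>k\<ge>N. \<forall>n\<ge>N. L2_norm \<Omega> (\<lambda>x. \<phi> k x - \<phi> n x) \<le> e" if e: "e > 0" for e
  proof -
    obtain N where N: "\<And>k n. k \<ge> N \<Longrightarrow> n \<ge> N \<Longrightarrow> L2_norm \<Omega> (\<lambda>x. grad (\<phi> k) x - grad (\<phi> n) x) \<le> e / c"
      using Cauchy_g[of "e / c"] e c(1) by (meson divide_pos_pos)
    have "L2_norm \<Omega> (\<lambda>x. \<phi> k x - \<phi> n x) \<le> e" if "k \<ge> N" "n \<ge> N" for k n
    proof -
      have "L2_norm \<Omega> (\<lambda>x. \<phi> k x - \<phi> n x) \<le> c * L2_norm \<Omega> (grad (\<lambda>x. \<phi> k x - \<phi> n x))"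
        by (intro c test_functions_diff \<phi>)
      also have "grad (\<lambda>x. \<phi> k x - \<phi> n x) = (\<lambda>x. grad (\<phi> k) x - grad (\<phi> n) x)"
        by (rule grad_test_diff[OF \<phi> \<phi>])
      also have "c * L2_norm \<Omega> (\<lambda>x. grad (\<phi> k) x - grad (\<phi> n) x) \<le> c * (e / c)"
        using N[OF that] c(1) by (intro mult_left_mono) auto
      finally show ?thesis using c(1) by simp
    qed
    then show ?thesis by blast
  qed
  obtain u where u: "u \<in> L2 \<Omega>" "(\<lambda>n. L2_norm \<Omega> (\<lambda>x. \<phi> n x - u x)) \<longlonglongrightarrow> 0"
    by (rule L2_complete[OF open_\<Omega> bounded_\<Omega>, of \<phi>, OF test_L2[OF \<phi>] Cauchy_u])
  have pair: "H10_pair u g" unfolding H10_pair_def using u g \<phi> by blast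
  have "ip \<Omega> g (grad \<psi>) = ip \<Omega> f \<psi>" if \<psi>: "\<psi> \<in> test_functions \<Omega>" for \<psi>
  proof -
    define b where "b = ip \<Omega> g (grad \<psi>) - ip \<Omega> \<psi> f"
    have bn: "(\<lambda>n. ip \<Omega> (grad (\<phi> n)) (grad \<psi>) - ip \<Omega> \<psi> f) \<longlonglongrightarrow> b"
      unfolding b_def by (intro tendsto_diff tendsto_const ip_tendsto grad_test_L2 \<phi> \<psi> g)
    \<comment> \<open>\<open>J (\<phi> n)\<close> exceeds the infimum by less than 1 / (n + 1), so
      the quadratic in \<open>t\<close> is nonnegative up to that slack. In the limit its constant
      term is 0, which forces \<open>b = 0\<close>: the Euler-Lagrange equation.\<close>
    have "0 \<le> 0 + 2 * t * b + t\<^sup>2 * ip \<Omega> (grad \<psi>) (grad \<psi>)" for t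
    proof (rule LIMSEQ_le_const)
      show "(\<lambda>n. 1 / real (Suc n) + 2 * t * (ip \<Omega> (grad (\<phi> n)) (grad \<psi>) - ip \<Omega> \<psi> f) + t\<^sup>2 * ip \<Omega> (grad \<psi>) (grad \<psi>))
        \<longlonglongrightarrow> 0 + 2 * t * b + t\<^sup>2 * ip \<Omega> (grad \<psi>) (grad \<psi>)"
        by (intro tendsto_intros bn) (use LIMSEQ_inverse_real_of_nat in \<open>simp add: inverse_eq_divide\<close>)
      have "0 \<le> 1 / real (Suc n) + 2 * t * (ip \<Omega> (grad (\<phi> n)) (grad \<psi>) - ip \<Omega> \<psi> f) + t\<^sup>2 * ip \<Omega> (grad \<psi>) (grad \<psi>)" for n
        using mle[OF test_functions_add[OF \<phi>[of n] test_functions_cmult[OF \<psi>, of t]]] J_line[OF \<phi>[of n] \<psi>, of t] Jn[of n]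
        by linarith
      then show "\<exists>N. \<forall>n\<ge>N. 0 \<le> 1 / real (Suc n) + 2 * t * (ip \<Omega> (grad (\<phi> n)) (grad \<psi>) - ip \<Omega> \<psi> f) + t\<^sup>2 * ip \<Omega> (grad \<psi>) (grad \<psi>)"
        by blast
    qed
    then have "b\<^sup>2 \<le> 0 * ip \<Omega> (grad \<psi>) (grad \<psi>)"
      by (rule quadratic_nonneg_imp) (rule ip_self_nonneg)
    then have "b = 0" by simp
    then have "ip \<Omega> g (grad \<psi>) = ip \<Omega> \<psi> f" unfolding b_def by simp
    then show ?thesis unfolding ip_commute[of \<Omega> f \<psi>] .
  qed
  then have "weak_solution f u g" using pair by (simp add: weak_solution_def)
  then show thesis by (rule that)
qed

text \<open>Both derivatives are moved onto the test function. This trades averages of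
  \<open>u\<close> against a Laplacian for integrals of the source.\<close>

lemma weak_solution_laplacian:
  assumes s: "weak_solution f u g" and \<phi>: "\<phi> \<in> test_functions \<Omega>"
  shows "ip \<Omega> u (laplacian \<phi>) = - ip \<Omega> f \<phi>"
proof -
  have p: "H10_pair u g" using s by (simp add: weak_solution_def)
  note L = H10_pair_L2[OF p]
  have t: "pd i (pd i \<phi>) \<in> test_functions \<Omega>" "pd i \<phi> \<in> test_functions \<Omega>" if "i \<in> Basis" for i
    using that by (intro test_functions_pd \<phi>; assumption)+
  have "ip \<Omega> u (laplacian \<phi>) = integral\<^sup>L (lebesgue_on \<Omega>) (\<lambda>x. \<Sum>i\<in>Basis. u x * pd i (pd i \<phi>) x)"
    by (simp add: laplacian_def sum_distrib_left)
  also have "\<dots> = (\<Sum>i\<in>Basis. integral\<^sup>L (lebesgue_on \<Omega>) (\<lambda>x. u x * pd i (pd i \<phi>) x))"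
    using L2_integrable_inner[OF L(1) test_L2[OF t(1)]] by (intro Bochner_Integration.integral_sum) auto
  also have "\<dots> = (\<Sum>i\<in>Basis. - integral\<^sup>L (lebesgue_on \<Omega>) (\<lambda>x. (g x \<bullet> i) * pd i \<phi> x))"
    using H10_pair_weak_gradient[OF p] t by (intro sum.cong) (auto simp: has_weak_gradient_def)
  also have "\<dots> = - integral\<^sup>L (lebesgue_on \<Omega>) (\<lambda>x. \<Sum>i\<in>Basis. (g x \<bullet> i) * pd i \<phi> x)"
    using L2_integrable_inner[OF L2_inner_const[OF L(2)] test_L2[OF t(2)]]
    by (subst Bochner_Integration.integral_sum) (auto simp: sum_negf)
  also have "(\<lambda>x. \<Sum>i\<in>Basis. (g x \<bullet> i) * pd i \<phi> x) = (\<lambda>x. g x \<bullet> grad \<phi> x)"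
    by (simp add: grad_def inner_sum_right mult.commute)
  finally show ?thesis using s \<phi> by (simp add: weak_solution_def)
qed

end

section \<open>Interior regularity in dimension at most three\<close>

lemma pd_eqI: "(f has_derivative f') (at x) \<Longrightarrow> pd i f x = f' i"
  using frechet_derivative_at by metis

text \<open>\<open>kap (norm z ^ 2)\<close> is a positive smooth function of \<open>z\<close> that equals \<open>norm z ^ 2\<close> for \<open>norm z \<ge> 1\<close>, so
  that \<open>z kap (norm z ^ 2) powr (- d / 2)\<close> is a regularisation of the divergence-free field \<open>z / norm z ^ d\<close>.\<close>

definition kap :: "real \<Rightarrow> real" where
  "kap s = s + bump 0 (1 - s)"

text \<open>Positivity slightly below 0 is wanted because functions of the variable s = |z|^2 are
  going to be differentiated at \<open>s = 0\<close>. For \<open>s \<le> 0\<close> the bump is at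
  least exp (-1), which gives the bound.\<close>

lemma kap_pos: "s > - exp (-1) \<Longrightarrow> kap s > 0"
proof (cases "s \<le> 0")
  case True
  assume s: "s > - exp (-1)"
  have "exp (-1) \<le> exp (- (1 / (1 - s)))" using True by (simp add: field_simps)
  then have "0 < s + exp (- (1 / (1 - s)))" using s by linarith
  then show ?thesis using True by (simp add: kap_def bump_def)
next
  case False
  then show ?thesis using bump_nonneg[of 0 "1 - s"] by (simp add: kap_def)
qed

lemma kap_nonneg_pos: "s \<ge> 0 \<Longrightarrow> kap s > 0"
  by (rule kap_pos) (use exp_gt_zero[of "-1::real"] in linarith)

lemma kap_outside: "s \<ge> 1 \<Longrightarrow> kap s = s"
  by (simp add: kap_def bump_def)

lemma kap_DERIV: "(kap has_real_derivative 1 - bump 2 (1 - s)) (at s)"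
proof -
  have "((\<lambda>s. bump 0 (1 - s)) has_real_derivative (bump 2 (1 - s)) * (-1)) (at s)"
    by (rule DERIV_chain2[where f = "bump 0" and g = "\<lambda>s. 1 - s"])
      (use bump_has_derivative[of 0 "1 - s"] in \<open>auto intro!: derivative_eq_intros simp: numeral_2_eq_2\<close>)
  then show ?thesis unfolding kap_def[abs_def] by (auto intro!: derivative_eq_intros)
qed

definition rho :: "'a::euclidean_space \<Rightarrow> real" where
  "rho z = kap (z \<bullet> z) powr (- (real DIM('a) / 2))"

text \<open>The divergence of the regularised field, see \<open>divergence_rho\<close>, written so
  that its sign and its vanishing outside the unit ball can be read off.\<close>

definition eta :: "'a::euclidean_space \<Rightarrow> real" where
  "eta z = real DIM('a) * (kap (z \<bullet> z) powr (- (real DIM('a) / 2) - 1)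
     * (bump 0 (1 - z \<bullet> z) + (z \<bullet> z) * bump 2 (1 - z \<bullet> z)))"

lemma smooth_kap: "smooth (\<lambda>z. kap (z \<bullet> z))"
  unfolding kap_def by (intro smooth_add smooth_bump smooth_diff smooth_const smooth_inner_self)

lemma smooth_rho: "smooth rho"
  unfolding rho_def[abs_def] by (intro smooth_powr smooth_kap kap_nonneg_pos inner_ge_zero)

lemma smooth_eta: "smooth eta"
  unfolding eta_def[abs_def]
  by (intro smooth_cmult smooth_mult smooth_add smooth_powr smooth_bump smooth_diff smooth_const
      smooth_kap smooth_inner_self kap_nonneg_pos inner_ge_zero)

lemma eta_nonneg: "0 \<le> eta z"
  unfolding eta_def by (intro mult_nonneg_nonneg add_nonneg_nonneg bump_nonneg powr_ge_zero) auto

lemma eta_zero_pos: "eta 0 > 0"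
  using kap_nonneg_pos[of 0] by (simp add: eta_def bump_def)

lemma one_le_inner_self: "1 \<le> norm z \<Longrightarrow> 1 \<le> z \<bullet> z"
  using power_mono[of 1 "norm z" 2] by (simp add: power2_norm_eq_inner)

lemma eta_outside: "1 \<le> norm z \<Longrightarrow> eta z = 0"
  using one_le_inner_self[of z] by (simp add: eta_def bump_def)

lemma kap_has_derivative: "((\<lambda>z. kap (z \<bullet> z)) has_derivative (\<lambda>h. (1 - bump 2 (1 - z \<bullet> z)) * (2 * (z \<bullet> h)))) (at z)"
proof -
  have 1: "((\<lambda>z. z \<bullet> z) has_derivative (\<lambda>h. 2 * (z \<bullet> h))) (at z)"
    by (auto intro!: derivative_eq_intros simp: inner_commute)
  have 2: "(kap has_derivative (\<lambda>h. (1 - bump 2 (1 - z \<bullet> z)) * h)) (at (z \<bullet> z))"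
    using kap_DERIV[of "z \<bullet> z"] by (simp add: has_field_derivative_def)
  show ?thesis by (rule has_derivative_compose[OF 1 2])
qed

lemma pd_rho: "pd i rho z = - real DIM('a) * kap (z \<bullet> z) powr (- (real DIM('a) / 2) - 1)
    * ((1 - bump 2 (1 - z \<bullet> z)) * (z \<bullet> i))" for z :: "'a::euclidean_space"
proof -
  let ?r = "- (real DIM('a) / 2)"
  have k: "kap (z \<bullet> z) > 0" by (intro kap_nonneg_pos inner_ge_zero)
  have "((\<lambda>y. y powr ?r) has_real_derivative ?r * kap (z \<bullet> z) powr (?r - 1)) (at (kap (z \<bullet> z)))"
    using k by (auto intro!: derivative_eq_intros)
  then have 2: "((\<lambda>y. y powr ?r) has_derivative (*) (?r * kap (z \<bullet> z) powr (?r - 1))) (at (kap (z \<bullet> z)))"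
    unfolding has_field_derivative_def .
  have "(rho has_derivative (\<lambda>h. ?r * kap (z \<bullet> z) powr (?r - 1) * ((1 - bump 2 (1 - z \<bullet> z)) * (2 * (z \<bullet> h))))) (at z)"
    unfolding rho_def[abs_def] by (rule has_derivative_compose[OF kap_has_derivative 2])
  from pd_eqI[OF this, of i] show ?thesis by simp
qed

lemma pd_inner: "pd i (\<lambda>z. z \<bullet> v) z = i \<bullet> v"
  by (rule pd_eqI) (auto intro!: derivative_eq_intros)

text \<open>With s = |z|^2, taking out the common power of \<open>kap\<close> leaves kap s - s kap'
  s, which is zero wherever \<open>kap\<close> is the identity.\<close>

lemma divergence_rho: "(\<Sum>i\<in>Basis. pd i (\<lambda>z. (z \<bullet> i) * rho z) z) = eta z" for z :: "'a::euclidean_space"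
proof -
  let ?r = "- (real DIM('a) / 2)" and ?k = "kap (z \<bullet> z)" and ?b = "bump 2 (1 - z \<bullet> z)"
  let ?q = "?k powr (?r - 1)"
  have k: "?k > 0" by (intro kap_nonneg_pos inner_ge_zero)
  have q: "?k powr ?r = ?k * ?q" using k by (simp add: powr_diff)
  have "(\<Sum>i\<in>Basis. pd i (\<lambda>z. (z \<bullet> i) * rho z) z) = (\<Sum>i\<in>Basis. rho z - real DIM('a) * ?q * (1 - ?b) * ((z \<bullet> i) * (z \<bullet> i)))"
    unfolding pd_mult[OF smooth_inner smooth_rho] pd_inner pd_rho
    by (intro sum.cong refl) (simp add: algebra_simps)
  also have "\<dots> = real DIM('a) * rho z - real DIM('a) * ?q * (1 - ?b) * (z \<bullet> z)"
    by (simp add: sum_subtractf sum_distrib_left[symmetric] euclidean_inner[of z z, symmetric])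
  also have "\<dots> = real DIM('a) * (?q * (?k - (1 - ?b) * (z \<bullet> z)))"
    unfolding rho_def q by (simp add: algebra_simps)
  also have "?k - (1 - ?b) * (z \<bullet> z) = bump 0 (1 - z \<bullet> z) + (z \<bullet> z) * ?b"
    by (simp add: kap_def algebra_simps)
  finally show ?thesis by (simp add: eta_def)
qed

text \<open>Radial ansatz W z = w (|z|^2), with w chosen so that the gradient of \<open>W\<close> is
  z (rho z - 2^d rho (2 z)); by \<open>divergence_rho\<close> its divergence is the required
  difference. Outside the unit ball \<open>rho\<close> is homogeneous of degree -d, so there the
  gradient vanishes, and \<open>W\<close> vanishes too once the constant in w is fixed.\<close>

lemma dyadic_potential:
  obtains W :: "'a::euclidean_space \<Rightarrow> real" where "smooth W" "\<And>z. 1 \<le> norm z \<Longrightarrow> W z = 0"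
    "\<And>z. laplacian W z = eta z - 2 ^ DIM('a) * eta (2 *\<^sub>R z)"
proof -
  let ?r = "- (real DIM('a) / 2)"
  \<comment> \<open>A quarter of the bound in \<open>kap_pos\<close>, because \<open>p\<close> also
    evaluates \<open>kap\<close> at \<open>4 * s\<close>.\<close>
  define \<delta> where "\<delta> = exp (-1 :: real) / 4"
  have \<delta>: "\<delta> > 0" by (simp add: \<delta>_def)
  \<comment> \<open>The derivative of w. The division by 2 absorbs the factor 2 in the derivative of
    \<open>z \<bullet> z\<close>.\<close>
  define p where "p s = (kap s powr ?r - 2 ^ DIM('a) * kap (4 * s) powr ?r) / 2" for s
  have kpos: "kap s > 0" "kap (4 * s) > 0" if "s > - \<delta>" for s
    by (rule kap_pos; use that exp_gt_zero[of "-1::real"] in \<open>unfold \<delta>_def, linarith\<close>)+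
  have kc: "isCont kap s" for s using kap_DERIV DERIV_isCont by blast
  have pc: "isCont p s" if "ereal (- \<delta>) < ereal s" for s
  proof -
    have "isCont (\<lambda>s. kap (4 * s)) s" by (rule continuous_at_compose[of s "\<lambda>s. 4 * s" kap, unfolded comp_def]) (auto simp: kc)
    then show ?thesis
      unfolding p_def using kpos[of s] that kc[of s]
      by (intro continuous_intros) auto
  qed
  obtain w0 where w0: "\<And>s. ereal (- \<delta>) < ereal s \<Longrightarrow> ereal s < \<infinity> \<Longrightarrow> (w0 has_vector_derivative p s) (at s)"
    using einterval_antiderivative[of "ereal (- \<delta>)" \<infinity> p] pc by auto
  \<comment> \<open>Normalised to vanish at 1; beyond 1 the derivative \<open>p\<close> is
    zero.\<close>
  define w where "w s = w0 s - w0 1" for s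
  have w: "(w has_real_derivative p s) (at s)" if "s > - \<delta>" for s
    using w0[of s] that unfolding w_def
    by (auto intro!: derivative_eq_intros simp: has_real_derivative_iff_has_vector_derivative)
  \<comment> \<open>Both terms are pure powers here, and the factor 4 inside the second one cancels
    \<open>2 ^ DIM('a)\<close> exactly.\<close>
  have p0: "p s = 0" if "s \<ge> 1" for s
  proof -
    have "(4 * s) powr ?r = 4 powr ?r * s powr ?r" using that by (simp add: powr_mult)
    moreover have "(4::real) powr ?r = 1 / 2 ^ DIM('a)"
    proof -
      have "(4::real) powr ?r = (2 powr 2) powr ?r" by simp
      also have "\<dots> = 2 powr (- real DIM('a))" by (simp only: powr_powr) simp
      also have "\<dots> = 1 / 2 ^ DIM('a)" by (simp add: powr_minus_divide powr_realpow)
      finally show ?thesis .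
    qed
    ultimately show ?thesis using that by (simp add: p_def kap_outside)
  qed
  have wout: "w s = 0" if "s \<ge> 1" for s
  proof (cases "s = 1")
    case False
    then have "1 < s" using that by simp
    then obtain z where "1 < z" "w s - w 1 = (s - 1) * p z"
      using MVT2[of 1 s w p] w \<delta> by force
    then show ?thesis using p0[of z] by (simp add: w_def)
  qed (simp add: w_def)
  define W :: "'a \<Rightarrow> real" where "W z = w (z \<bullet> z)" for z
  define G :: "'a \<Rightarrow> 'a \<Rightarrow> real" where "G i z = (z \<bullet> i) * rho z" for i z
  have pz: "p (z \<bullet> z) = (rho z - 2 ^ DIM('a) * rho (2 *\<^sub>R z)) / 2" for z :: 'a
    by (simp add: p_def rho_def)
  have W_der: "(W has_derivative (\<lambda>h. (z \<bullet> h) * (rho z - 2 ^ DIM('a) * rho (2 *\<^sub>R z)))) (at z)" for z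
  proof -
    have 1: "((\<lambda>z. z \<bullet> z) has_derivative (\<lambda>h. 2 * (z \<bullet> h))) (at z)"
      by (auto intro!: derivative_eq_intros simp: inner_commute)
    have "z \<bullet> z > - \<delta>" using \<delta> inner_ge_zero[of z] by linarith
    then have 2: "(w has_derivative (\<lambda>h. p (z \<bullet> z) * h)) (at (z \<bullet> z))"
      using w by (simp add: has_field_derivative_def)
    have "(W has_derivative (\<lambda>h. p (z \<bullet> z) * (2 * (z \<bullet> h)))) (at z)"
      unfolding W_def[abs_def] by (rule has_derivative_compose[OF 1 2])
    moreover have "(\<lambda>h. p (z \<bullet> z) * (2 * (z \<bullet> h))) = (\<lambda>h. (z \<bullet> h) * (rho z - 2 ^ DIM('a) * rho (2 *\<^sub>R z)))"
      by (simp add: pz fun_eq_iff)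
    ultimately show ?thesis by simp
  qed
  have smG: "smooth (G i)" for i unfolding G_def[abs_def] by (intro smooth_mult smooth_inner smooth_rho)
  have smG2: "smooth (\<lambda>z. G i (2 *\<^sub>R z))" for i using smooth_affine(1)[OF smG, where c = 2 and v = 0] by simp
  have pdG2: "pd i (\<lambda>z. G i (2 *\<^sub>R z)) z = 2 * pd i (G i) (2 *\<^sub>R z)" if "i \<in> Basis" for i z
    using smooth_affine(2)[OF smG that, where c = 2 and v = 0] by simp
  \<comment> \<open>\<open>G i (2 *\<^sub>R z)\<close> contains a factor 2 of its own, hence the
    division by 2; the chain rule restores it in the next derivative.\<close>
  have pdW: "pd i W = (\<lambda>z. G i z - (2 ^ DIM('a) / 2) * G i (2 *\<^sub>R z))" for i
    by (rule ext) (simp add: pd_eqI[OF W_der] G_def algebra_simps)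
  show thesis
  proof
    show "smooth W"
    proof (rule smoothI[OF W_der])
      show "smooth (\<lambda>z. (z \<bullet> i) * (rho z - 2 ^ DIM('a) * rho (2 *\<^sub>R z)))" for i :: 'a
        using smooth_affine(1)[OF smooth_rho, where c = 2 and v = 0]
        by (intro smooth_mult smooth_inner smooth_diff smooth_rho smooth_const) simp
    qed
    show "W z = 0" if "1 \<le> norm z" for z
      using wout one_le_inner_self[OF that] by (simp add: W_def)
    show "laplacian W z = eta z - 2 ^ DIM('a) * eta (2 *\<^sub>R z)" for z
    proof -
      have "laplacian W z = (\<Sum>i\<in>Basis. pd i (G i) z - 2 ^ DIM('a) * pd i (G i) (2 *\<^sub>R z))"
        unfolding laplacian_def pdW
      proof (rule sum.cong[OF refl])
        fix i :: 'a assume i: "i \<in> Basis"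
        have "pd i (\<lambda>z. G i z - 2 ^ DIM('a) / 2 * G i (2 *\<^sub>R z)) z
            = pd i (G i) z - pd i (\<lambda>z. 2 ^ DIM('a) / 2 * G i (2 *\<^sub>R z)) z"
          by (rule pd_diff[OF smG smooth_cmult[OF smG2]])
        also have "pd i (\<lambda>z. 2 ^ DIM('a) / 2 * G i (2 *\<^sub>R z)) z = 2 ^ DIM('a) / 2 * pd i (\<lambda>z. G i (2 *\<^sub>R z)) z"
          by (rule pd_cmult[OF smG2])
        finally show "pd i (\<lambda>z. G i z - 2 ^ DIM('a) / 2 * G i (2 *\<^sub>R z)) z
            = pd i (G i) z - 2 ^ DIM('a) * pd i (G i) (2 *\<^sub>R z)"
          by (simp add: pdG2[OF i])
      qed
      also have "\<dots> = eta z - 2 ^ DIM('a) * eta (2 *\<^sub>R z)"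
        using divergence_rho[of z] divergence_rho[of "2 *\<^sub>R z"]
        by (simp add: sum_subtractf sum_distrib_left[symmetric] G_def[abs_def])
      finally show ?thesis .
    qed
  qed
qed

text \<open>This is F ((y - x) / t), spelled in the affine form that \<open>smooth_affine\<close>
  handles.\<close>

definition rescale :: "real \<Rightarrow> 'a::euclidean_space \<Rightarrow> ('a \<Rightarrow> real) \<Rightarrow> 'a \<Rightarrow> real" where
  "rescale t x F y = F ((1 / t) *\<^sub>R y + (- (1 / t) *\<^sub>R x))"

lemma rescale_outside:
  assumes "t > 0" "\<And>z. 1 \<le> norm z \<Longrightarrow> F z = 0" "y \<notin> cball x t"
  shows "rescale t x F y = 0"
proof -
  have "(1 / t) *\<^sub>R y + (- (1 / t) *\<^sub>R x) = (1 / t) *\<^sub>R (y - x)" by (simp add: scaleR_diff_right)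
  moreover have "1 \<le> norm ((1 / t) *\<^sub>R (y - x))"
    using assms(1,3) by (simp add: dist_norm norm_minus_commute)
  ultimately show ?thesis unfolding rescale_def using assms(2) by metis
qed

lemma smooth_rescale: "smooth F \<Longrightarrow> smooth (rescale t x F)"
  unfolding rescale_def[abs_def] by (rule smooth_affine(1))

lemma rescale_test:
  assumes "t > 0" "cball x t \<subseteq> \<Omega>" "smooth F" "\<And>z. 1 \<le> norm z \<Longrightarrow> F z = 0"
  shows "rescale t x F \<in> test_functions \<Omega>"
  by (rule test_functionsI[of _ "cball x t"]) (use assms rescale_outside[OF assms(1,4)] smooth_rescale in auto)

lemma laplacian_rescale:
  assumes "smooth F" "t > 0"
  shows "laplacian (rescale t x F) y = laplacian F ((1 / t) *\<^sub>R y + (- (1 / t) *\<^sub>R x)) / t\<^sup>2"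
proof -
  have 1: "pd i (rescale t x F) = (\<lambda>y. (1 / t) * rescale t x (pd i F) y)" if "i \<in> Basis" for i
    unfolding rescale_def[abs_def] by (rule ext) (rule smooth_affine(2)[OF assms(1) that])
  have 2: "pd i (pd i (rescale t x F)) y = (1 / t) * ((1 / t) * pd i (pd i F) ((1 / t) *\<^sub>R y + (- (1 / t) *\<^sub>R x)))"
    if i: "i \<in> Basis" for i
    unfolding 1[OF i] pd_cmult[OF smooth_rescale[OF smooth_pd[OF assms(1) i]]]
    unfolding rescale_def[abs_def] smooth_affine(2)[OF smooth_pd[OF assms(1) i] i] ..
  show ?thesis unfolding laplacian_def
    by (simp add: 2 sum_divide_distrib power2_eq_square)
qed

section \<open>Averages over dyadic scales\<close>

lemma geometric_increments:
  fixes a :: "nat \<Rightarrow> real"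
  assumes inc: "\<And>n. n \<ge> N \<Longrightarrow> \<bar>a (Suc n) - a n\<bar> \<le> c * q ^ n" and q: "0 \<le> q" "q < 1"
  shows "a \<longlonglongrightarrow> lim a" and "\<And>n. n \<ge> N \<Longrightarrow> \<bar>lim a - a n\<bar> \<le> c * q ^ n / (1 - q)"
proof -
  have key: "(\<lambda>k. a (k + n)) \<longlonglongrightarrow> a n + (\<Sum>k. a (Suc (k + n)) - a (k + n))"
    "\<bar>\<Sum>k. a (Suc (k + n)) - a (k + n)\<bar> \<le> c * q ^ n / (1 - q)" if n: "n \<ge> N" for n
  proof -
    have g: "(\<lambda>k. c * q ^ n * q ^ k) sums (c * q ^ n * (1 / (1 - q)))"
      using q by (intro sums_mult geometric_sums) auto
    have le: "norm (a (Suc (k + n)) - a (k + n)) \<le> c * q ^ n * q ^ k" for k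
      using inc[of "k + n"] n by (simp add: power_add mult_ac)
    have sn: "summable (\<lambda>k. norm (a (Suc (k + n)) - a (k + n)))"
      by (rule summable_comparison_test'[OF sums_summable[OF g], of 0]) (use le in simp)
    then have s: "summable (\<lambda>k. a (Suc (k + n)) - a (k + n))" by (rule summable_norm_cancel)
    have "(\<lambda>m. \<Sum>k<m. a (Suc (k + n)) - a (k + n)) \<longlonglongrightarrow> (\<Sum>k. a (Suc (k + n)) - a (k + n))"
      using summable_sums[OF s] by (simp add: sums_def)
    moreover have "(\<Sum>k<m. a (Suc (k + n)) - a (k + n)) = a (m + n) - a n" for m
      using sum_lessThan_telescope[of "\<lambda>k. a (k + n)" m] by simp
    ultimately have "(\<lambda>m. a (m + n) - a n) \<longlonglongrightarrow> (\<Sum>k. a (Suc (k + n)) - a (k + n))" by simp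
    from tendsto_add[OF tendsto_const[of "a n"] this]
    show "(\<lambda>k. a (k + n)) \<longlonglongrightarrow> a n + (\<Sum>k. a (Suc (k + n)) - a (k + n))" by simp
    have "norm (\<Sum>k. a (Suc (k + n)) - a (k + n)) \<le> (\<Sum>k. c * q ^ n * q ^ k)"
      by (rule order_trans[OF summable_norm[OF sn] suminf_le[OF le sn sums_summable[OF g]]])
    then show "\<bar>\<Sum>k. a (Suc (k + n)) - a (k + n)\<bar> \<le> c * q ^ n / (1 - q)"
      using sums_unique[OF g] by simp
  qed
  have lim: "a \<longlonglongrightarrow> a n + (\<Sum>k. a (Suc (k + n)) - a (k + n))" if "n \<ge> N" for n
    using key(1)[OF that] by (rule LIMSEQ_offset)
  have eq: "lim a = a n + (\<Sum>k. a (Suc (k + n)) - a (k + n))" if "n \<ge> N" for n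
    by (rule limI[OF lim[OF that]])
  show "a \<longlonglongrightarrow> lim a" using lim[of N] eq[of N] by simp
  show "\<bar>lim a - a n\<bar> \<le> c * q ^ n / (1 - q)" if "n \<ge> N" for n
    using key(2)[OF that] eq[OF that] by simp
qed

lemma eta_test: "eta \<in> test_functions UNIV"
  by (rule test_functionsI[of _ "cball 0 1"]) (auto simp: smooth_eta eta_outside)

lemma integral_eta_pos: "0 < integral\<^sup>L lborel (eta :: 'a::euclidean_space \<Rightarrow> real)"
proof -
  have int: "integrable lborel (eta :: 'a \<Rightarrow> real)" by (rule test_functions_integrable[OF eta_test])
  have "integral\<^sup>L lborel (eta :: 'a \<Rightarrow> real) \<noteq> 0"
  proof
    assume "integral\<^sup>L lborel (eta :: 'a \<Rightarrow> real) = 0"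
    then have "AE z in lborel. eta (z :: 'a) = 0"
      using int eta_nonneg by (subst (asm) integral_nonneg_eq_0_iff_AE) auto
    then have "AE z in lebesgue. eta (z :: 'a) = 0" by (rule AE_completion)
    then have "negligible {z :: 'a. eta z \<noteq> 0}"
      by (simp add: eventually_ae_filter_negligible) (metis (mono_tags, lifting) negligible_subset)
    moreover have "open {z :: 'a. eta z \<noteq> 0}"
      using smooth_continuous[OF smooth_eta, of UNIV] by (intro open_Collect_neq continuous_intros) auto
    moreover have "(0 :: 'a) \<in> {z. eta z \<noteq> 0}" using eta_zero_pos[where 'a='a] by simp
    ultimately show False using open_not_negligible by blast
  qed
  moreover have "0 \<le> integral\<^sup>L lborel (eta :: 'a \<Rightarrow> real)"
    by (intro integral_nonneg_AE AE_I2 eta_nonneg)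
  ultimately show ?thesis by linarith
qed

text \<open>The scaling preserves the integral of \<open>eta\<close>, which is some positive mass
  and not normalised to 1; \<open>continuous_solution\<close> divides by it.\<close>

definition mol :: "real \<Rightarrow> 'a::euclidean_space \<Rightarrow> 'a \<Rightarrow> real" where
  "mol t x y = (1 / t ^ DIM('a)) * rescale t x eta y"

text \<open>The integral runs over the centre of the mollifier; the substitution x = y - t z turns
  the argument of \<open>eta\<close> into \<open>z\<close>.\<close>

lemma integral_mol_left:
  fixes \<phi> :: "'a::euclidean_space \<Rightarrow> real"
  assumes t: "t > 0" and \<phi>: "\<phi> \<in> borel_measurable borel"
  shows "integral\<^sup>L lborel (\<lambda>x. \<phi> x * mol t x y) = integral\<^sup>L lborel (\<lambda>z. \<phi> (y + (- t) *\<^sub>R z) * eta z)"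
proof -
  have [measurable]: "eta \<in> borel_measurable (borel :: 'a measure)" by (rule smooth_borel_measurable[OF smooth_eta])
  note \<phi>[measurable]
  have [measurable]: "(\<lambda>x. \<phi> x * mol t x y) \<in> borel_measurable borel"
    unfolding mol_def rescale_def by measurable
  have "integral\<^sup>L lborel (\<lambda>x. \<phi> x * mol t x y)
      = integral\<^sup>L (density (distr lborel borel (\<lambda>z. y + (- t) *\<^sub>R z)) (\<lambda>_. \<bar>- t\<bar> ^ DIM('a))) (\<lambda>x. \<phi> x * mol t x y)"
    using lborel_affine[of "- t" y] t by simp
  also have "\<dots> = integral\<^sup>L (distr lborel borel (\<lambda>z. y + (- t) *\<^sub>R z)) (\<lambda>x. t ^ DIM('a) * (\<phi> x * mol t x y))"
    using t by (subst integral_real_density) auto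
  also have "\<dots> = integral\<^sup>L lborel (\<lambda>z. t ^ DIM('a) * (\<phi> (y + (- t) *\<^sub>R z) * mol t (y + (- t) *\<^sub>R z) y))"
    by (rule integral_distr) measurable
  also have "\<dots> = integral\<^sup>L lborel (\<lambda>z. \<phi> (y + (- t) *\<^sub>R z) * eta z)"
    using t by (intro Bochner_Integration.integral_cong refl) (simp add: mol_def rescale_def scaleR_diff_right algebra_simps)
  finally show ?thesis .
qed

lemma pair_integrable_product:
  fixes \<phi> U :: "'a::euclidean_space \<Rightarrow> real"
  assumes \<phi>: "integrable lborel \<phi>" and U: "integrable lborel U"
    and H[measurable]: "H \<in> borel_measurable (lborel \<Otimes>\<^sub>M lborel)" and B: "\<And>p. \<bar>H p\<bar> \<le> B"
  shows "integrable (lborel \<Otimes>\<^sub>M lborel) (\<lambda>(x, y). \<phi> x * (U y * H (x, y)))"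
proof -
  note [measurable] = borel_measurable_integrable[OF \<phi>] borel_measurable_integrable[OF U]
  have B0: "B \<ge> 0" using B[of undefined] by linarith
  have "integrable (lborel \<Otimes>\<^sub>M lborel) (\<lambda>(x, y). \<phi> x * U y)"
    by (rule lborel_pair.Fubini_integrable) (use \<phi> U in \<open>auto simp: abs_mult\<close>)
  then have "integrable (lborel \<Otimes>\<^sub>M lborel) (\<lambda>p. B * (case p of (x, y) \<Rightarrow> \<phi> x * U y))" by (rule integrable_mult_right)
  then show ?thesis
  proof (rule Bochner_Integration.integrable_bound)
    show "AE p in lborel \<Otimes>\<^sub>M lborel. norm (case p of (x, y) \<Rightarrow> \<phi> x * (U y * H (x, y)))
        \<le> norm (B * (case p of (x, y) \<Rightarrow> \<phi> x * U y))"
    proof (rule AE_I2, clarsimp simp: abs_mult)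
      fix x y
      have "\<bar>\<phi> x\<bar> * \<bar>U y\<bar> * \<bar>H (x, y)\<bar> \<le> \<bar>\<phi> x\<bar> * \<bar>U y\<bar> * B" by (intro mult_left_mono B) auto
      then show "\<bar>\<phi> x\<bar> * (\<bar>U y\<bar> * \<bar>H (x, y)\<bar>) \<le> \<bar>B\<bar> * (\<bar>\<phi> x\<bar> * \<bar>U y\<bar>)" using B0 by (simp add: mult_ac)
    qed
  qed measurable
qed

lemma continuous_AE_eq:
  fixes f g :: "'a::euclidean_space \<Rightarrow> real"
  assumes "open \<Omega>" and f: "continuous_on \<Omega> f" "continuous_on \<Omega> g" and AE: "AE x in lebesgue_on \<Omega>. f x = g x"
    and x: "x \<in> \<Omega>"
  shows "f x = g x"
proof (rule ccontr)
  assume ne: "f x \<noteq> g x"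
  have op: "open (\<Omega> \<inter> (\<lambda>x. f x - g x) -` (- {0}))"
    using f assms(1) by (intro continuous_open_preimage continuous_on_diff) auto
  have "\<Omega> \<in> sets lebesgue" using assms(1) by (simp add: lborelD)
  then have "AE x in lebesgue. x \<in> \<Omega> \<longrightarrow> f x = g x"
    using AE by (subst (asm) AE_restrict_space_iff) auto
  then obtain N where N: "negligible N" "{x. \<not> (x \<in> \<Omega> \<longrightarrow> f x = g x)} \<subseteq> N"
    by (auto simp: eventually_ae_filter_negligible)
  have "negligible (\<Omega> \<inter> (\<lambda>x. f x - g x) -` (- {0}))"
    by (rule negligible_subset[OF N(1)]) (use N(2) in auto)
  moreover have "x \<in> \<Omega> \<inter> (\<lambda>x. f x - g x) -` (- {0})" using ne x by simp
  ultimately show False using open_not_negligible[OF op] by blast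
qed

text \<open>This lets the continuous representative replace the solution that comes from the
  variational problem.\<close>

lemma (in bounded_open) H10_pair_cong:
  assumes "H10_pair u g" "u' \<in> L2 \<Omega>" "AE x in lebesgue_on \<Omega>. u' x = u x"
  shows "H10_pair u' g"
proof -
  obtain \<phi> where \<phi>: "u \<in> L2 \<Omega>" "g \<in> L2 \<Omega>" "\<And>n::nat. \<phi> n \<in> test_functions \<Omega>"
    "(\<lambda>n. L2_norm \<Omega> (\<lambda>x. \<phi> n x - u x)) \<longlonglongrightarrow> 0" "(\<lambda>n. L2_norm \<Omega> (\<lambda>x. grad (\<phi> n) x - g x)) \<longlonglongrightarrow> 0"
    by (rule H10_pairE[OF assms(1)]) blast
  have "L2_norm \<Omega> (\<lambda>x. \<phi> n x - u' x) = L2_norm \<Omega> (\<lambda>x. \<phi> n x - u x)" for n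
    using assms(3) by (intro L2_norm_cong_AE L2_measurable L2_diff test_L2 \<phi> assms) auto
  then show ?thesis unfolding H10_pair_def using \<phi> assms(2) by (auto intro!: exI[of _ \<phi>])
qed

text \<open>\<open>W\<close> is supplied by \<open>dyadic_potential\<close>. Fixing it here makes
  every constant derived from it the same for all points, scales and sources.\<close>

locale poisson_domain = bounded_open \<Omega> for \<Omega> :: "'a::euclidean_space set" +
  fixes W :: "'a \<Rightarrow> real"
  assumes smooth_W: "smooth W" and W_outside: "\<And>z. 1 \<le> norm z \<Longrightarrow> W z = 0"
    and laplacian_W: "\<And>z. laplacian W z = eta z - 2 ^ DIM('a) * eta (2 *\<^sub>R z)"
    and dim: "DIM('a) \<le> 3"
begin

definition C\<^sub>W :: real where
  "C\<^sub>W = (SOME B. B \<ge> 0 \<and> (\<forall>z. \<bar>W z\<bar> \<le> B)) * sqrt (unit_ball_vol (real DIM('a)))"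

lemma mol_test: "t > 0 \<Longrightarrow> cball x t \<subseteq> \<Omega> \<Longrightarrow> mol t x \<in> test_functions \<Omega>"
  unfolding mol_def[abs_def] by (intro test_functions_cmult rescale_test smooth_eta eta_outside)

text \<open>If B bounds |W|, the height is at most B t^(2-d) on a ball of volume v t^d, so the
  squared norm is at most B^2 v t^(4-d). For d \<le> 3 and t \<le> 1 the last power is at most
  t.\<close>

lemma rescaled_W_norm:
  assumes t: "0 < t" "t \<le> 1" "cball x t \<subseteq> \<Omega>"
  defines "P \<equiv> \<lambda>y. (t\<^sup>2 / t ^ DIM('a)) * rescale t x W y"
  shows "P \<in> test_functions \<Omega>" "L2_norm \<Omega> P \<le> C\<^sub>W * sqrt t"
proof -
  let ?d = "DIM('a)" and ?v = "unit_ball_vol (real DIM('a))"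
  define a where "a = t\<^sup>2 / t ^ ?d"
  define B where "B = (SOME B. B \<ge> 0 \<and> (\<forall>z. \<bar>W z\<bar> \<le> B))"
  have "W \<in> test_functions UNIV"
    by (rule test_functionsI[of _ "cball 0 1"]) (auto simp: smooth_W W_outside)
  then have "\<exists>B. B \<ge> 0 \<and> (\<forall>z. \<bar>W z\<bar> \<le> B)" by (metis test_functions_bounded)
  from someI_ex[OF this] have B: "B \<ge> 0" "\<And>z. \<bar>W z\<bar> \<le> B" by (auto simp: B_def)
  show P: "P \<in> test_functions \<Omega>"
    unfolding P_def by (intro test_functions_cmult rescale_test smooth_W W_outside t)
  have PP: "(\<lambda>y. P y * P y) \<in> test_functions \<Omega>"
    by (intro test_functions_mult P test_functions_smooth[OF P])
  have cball_int: "integrable lborel (\<lambda>y. (a * B)\<^sup>2 * indicat_real (cball x t) y)"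
    by (intro integrable_mult_right integrable_real_indicator)
      (auto simp: emeasure_lborel_cball_finite[unfolded infinity_ennreal_def])
  have "ip \<Omega> P P = integral\<^sup>L lborel (\<lambda>y. P y * P y)"
    using integral_test_eq_lborel[OF PP] by simp
  also have "\<dots> \<le> integral\<^sup>L lborel (\<lambda>y. (a * B)\<^sup>2 * indicat_real (cball x t) y)"
  proof (rule integral_mono[OF test_functions_integrable[OF PP] cball_int])
    fix y
    show "P y * P y \<le> (a * B)\<^sup>2 * indicat_real (cball x t) y"
    proof (cases "y \<in> cball x t")
      case True
      have "\<bar>P y\<bar> \<le> a * B"
        using t B(2) by (auto simp: P_def a_def abs_mult rescale_def intro!: divide_right_mono mult_left_mono)
      then have "\<bar>P y\<bar>\<^sup>2 \<le> (a * B)\<^sup>2" by (intro power_mono) auto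
      then show ?thesis using True by (simp add: power2_eq_square)
    next
      case False
      then show ?thesis using rescale_outside[OF t(1) W_outside False] by (simp add: P_def)
    qed
  qed
  also have "\<dots> = (a * B)\<^sup>2 * (?v * t ^ ?d)"
    using t(1) content_cball[of t x] by simp
  also have "\<dots> = B\<^sup>2 * ?v * t ^ (4 - ?d)"
  proof -
    \<comment> \<open>The difference \<open>4 - ?d\<close> is one of natural numbers;
      \<open>dim\<close> keeps it from being truncated.\<close>
    have "t ^ 4 = t ^ (4 - ?d) * t ^ ?d" using dim by (simp flip: power_add)
    moreover have "a\<^sup>2 * t ^ ?d = t ^ 4 / t ^ ?d"
      using t(1) by (simp add: a_def power_divide power2_eq_square power4_eq_xxxx power_add)
    ultimately have "a\<^sup>2 * t ^ ?d = t ^ (4 - ?d)" using t(1) by simp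
    then show ?thesis by (simp add: power_mult_distrib mult_ac)
  qed
  also have "\<dots> \<le> B\<^sup>2 * ?v * t"
  proof (rule mult_left_mono)
    show "t ^ (4 - ?d) \<le> t" using power_decreasing[of 1 "4 - ?d" t] t dim by simp
  qed simp
  also have "\<dots> = (C\<^sub>W * sqrt t)\<^sup>2"
    using t(1) by (simp add: C\<^sub>W_def B_def[symmetric] power_mult_distrib)
  finally show "L2_norm \<Omega> P \<le> C\<^sub>W * sqrt t"
    using t(1) B(1) by (subst L2_norm_le_iff) (auto simp: C\<^sub>W_def B_def[symmetric])
qed

text \<open>The rescaled \<open>W\<close> is a test function whose Laplacian is the difference of
  the two mollifiers, so the weak equation turns the increment into an integral of \<open>f\<close>,
  to which Cauchy-Schwarz applies.\<close>

lemma average_increment: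
  assumes f: "f \<in> L2 \<Omega>" and s: "weak_solution f u g" and t: "0 < t" "t \<le> 1" "cball x t \<subseteq> \<Omega>"
  shows "\<bar>ip \<Omega> u (mol (t / 2) x) - ip \<Omega> u (mol t x)\<bar> \<le> L2_norm \<Omega> f * (C\<^sub>W * sqrt t)"
proof -
  let ?d = "DIM('a)"
  define P where "P = (\<lambda>y. (t\<^sup>2 / t ^ ?d) * rescale t x W y)"
  note P = rescaled_W_norm[OF t, folded P_def]
  have u: "u \<in> L2 \<Omega>" using s H10_pair_L2 by (auto simp: weak_solution_def)
  have t2: "t / 2 > 0" "cball x (t / 2) \<subseteq> \<Omega>" using t by (auto intro: subset_trans[OF subset_cball])
  have "laplacian P y = mol t x y - mol (t / 2) x y" for y
  proof -
    let ?z = "(1 / t) *\<^sub>R y + (- (1 / t) *\<^sub>R x)"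
    have "pd i P = (\<lambda>y. (t\<^sup>2 / t ^ ?d) * pd i (rescale t x W) y)" for i
      unfolding P_def by (rule ext) (rule pd_cmult[OF smooth_rescale[OF smooth_W]])
    then have "laplacian P y = (t\<^sup>2 / t ^ ?d) * laplacian (rescale t x W) y"
      unfolding laplacian_def sum_distrib_left
      by (intro sum.cong refl) (simp only: pd_cmult[OF smooth_pd[OF smooth_rescale[OF smooth_W]]])
    also have "\<dots> = (1 / t ^ ?d) * (eta ?z - 2 ^ ?d * eta (2 *\<^sub>R ?z))"
      using t(1) by (simp add: laplacian_rescale[OF smooth_W t(1)] laplacian_W)
    also have "2 *\<^sub>R ?z = (1 / (t / 2)) *\<^sub>R y + (- (1 / (t / 2)) *\<^sub>R x)"
      by (simp add: scaleR_add_right scaleR_diff_right)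
    also have "(1 / t ^ ?d) * (eta ?z - 2 ^ ?d * eta \<dots>) = mol t x y - mol (t / 2) x y"
      by (simp add: mol_def rescale_def power_divide right_diff_distrib)
    finally show ?thesis .
  qed
  then have L: "laplacian P = (\<lambda>y. mol t x y - mol (t / 2) x y)" by (rule ext)
  have "ip \<Omega> u (laplacian P) = ip \<Omega> u (mol t x) - ip \<Omega> u (mol (t / 2) x)"
    unfolding L using ip_diff_left[OF test_L2[OF mol_test[OF t(1,3)]] test_L2[OF mol_test[OF t2]] u]
    by (simp add: mult.commute)
  then have "\<bar>ip \<Omega> u (mol (t / 2) x) - ip \<Omega> u (mol t x)\<bar> = \<bar>ip \<Omega> f P\<bar>"
    using weak_solution_laplacian[OF s P(1)] by linarith
  also have "\<dots> \<le> L2_norm \<Omega> f * L2_norm \<Omega> P" by (rule L2_Cauchy_Schwarz[OF f test_L2[OF P(1)]])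
  also have "\<dots> \<le> L2_norm \<Omega> f * (C\<^sub>W * sqrt t)" by (rule mult_left_mono[OF P(2) L2_norm_nonneg])
  finally show ?thesis .
qed

definition avg :: "('a \<Rightarrow> real) \<Rightarrow> nat \<Rightarrow> 'a \<Rightarrow> real" where
  "avg u n x = ip \<Omega> u (mol ((1 / 2) ^ n) x)"

definition limit_avg :: "('a \<Rightarrow> real) \<Rightarrow> 'a \<Rightarrow> real" where
  "limit_avg u x = lim (\<lambda>n. avg u n x)"

text \<open>The increment at scale 2^-n is of order sqrt (2^-n), the n-th power of this
  ratio.\<close>

definition q :: real where "q = sqrt (1 / 2)"

lemma q: "0 \<le> q" "q < 1"
  by (simp_all add: q_def real_sqrt_lt_1_iff)

text \<open>The rate depends on \<open>x\<close> only through the scale \<open>N\<close> from which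
  on the balls fit into \<Omega>. This is what makes the convergence locally uniform.\<close>

lemma avg_limit:
  assumes f: "f \<in> L2 \<Omega>" and s: "weak_solution f u g" and N: "cball x ((1 / 2) ^ N) \<subseteq> \<Omega>"
  shows "(\<lambda>n. avg u n x) \<longlonglongrightarrow> limit_avg u x"
    and "n \<ge> N \<Longrightarrow> \<bar>limit_avg u x - avg u n x\<bar> \<le> L2_norm \<Omega> f * C\<^sub>W * q ^ n / (1 - q)"
proof -
  have inc: "\<bar>avg u (Suc n) x - avg u n x\<bar> \<le> L2_norm \<Omega> f * C\<^sub>W * q ^ n" if "n \<ge> N" for n
  proof -
    have "(1 / 2 :: real) ^ n \<le> (1 / 2) ^ N" using that by (intro power_decreasing) auto
    then have "cball x ((1 / 2) ^ n) \<subseteq> \<Omega>" using N subset_cball subset_trans by blast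
    then have "\<bar>ip \<Omega> u (mol ((1 / 2) ^ n / 2) x) - ip \<Omega> u (mol ((1 / 2) ^ n) x)\<bar>
        \<le> L2_norm \<Omega> f * (C\<^sub>W * sqrt ((1 / 2) ^ n))"
      by (intro average_increment[OF f s]) (auto simp: power_le_one)
    then show ?thesis by (simp add: avg_def q_def real_sqrt_power mult_ac)
  qed
  show "(\<lambda>n. avg u n x) \<longlonglongrightarrow> limit_avg u x"
    unfolding limit_avg_def by (rule geometric_increments(1)[OF inc q])
  show "\<bar>limit_avg u x - avg u n x\<bar> \<le> L2_norm \<Omega> f * C\<^sub>W * q ^ n / (1 - q)" if "n \<ge> N"
    unfolding limit_avg_def by (rule geometric_increments(2)[OF inc q that])
qed

lemma mol_bounded:
  assumes "t > 0"
  obtains B where "B \<ge> 0" "\<And>x y :: 'a. \<bar>mol t x y\<bar> \<le> B"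
proof -
  obtain B where B: "B \<ge> 0" "\<And>z :: 'a. \<bar>eta z\<bar> \<le> B" using test_functions_bounded[OF eta_test] by metis
  show thesis
    by (rule that[of "B / t ^ DIM('a)"])
      (use B assms in \<open>auto simp: mol_def rescale_def abs_mult divide_right_mono\<close>)
qed

lemma smooth_mol: "smooth (mol t x)"
  unfolding mol_def[abs_def] by (intro smooth_cmult smooth_rescale smooth_eta)

lemma mol_L2: "t > 0 \<Longrightarrow> mol t x \<in> L2 \<Omega>"
proof -
  assume "t > 0"
  then obtain B where "B \<ge> 0" "\<And>x y :: 'a. \<bar>mol t x y\<bar> \<le> B" using mol_bounded by blast
  then show ?thesis
    by (intro L2_bounded[OF open_\<Omega> bounded_\<Omega>, where B = B] borel_meas smooth_borel_measurable smooth_mol) auto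
qed

lemma continuous_avg:
  assumes u: "u \<in> L2 \<Omega>"
  shows "continuous_on UNIV (avg u n)"
proof (rule continuous_on_sequentiallyI)
  fix X :: "nat \<Rightarrow> 'a" and a assume X: "X \<longlonglongrightarrow> a"
  obtain B where B: "B \<ge> 0" "\<And>x y :: 'a. \<bar>mol ((1 / 2) ^ n) x y\<bar> \<le> B" using mol_bounded[of "(1 / 2) ^ n"] by auto
  have [measurable]: "mol ((1 / 2) ^ n) x \<in> borel_measurable (lebesgue_on \<Omega>)" for x
    by (intro borel_meas smooth_borel_measurable smooth_mol)
  note [measurable] = L2_measurable[OF u]
  show "(\<lambda>k. avg u n (X k)) \<longlonglongrightarrow> avg u n a"
    unfolding avg_def
  proof (rule integral_dominated_convergence[where w = "\<lambda>y. \<bar>u y\<bar> * B"])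
    show "integrable (lebesgue_on \<Omega>) (\<lambda>y. \<bar>u y\<bar> * B)"
      using L2_integrable[OF open_\<Omega> bounded_\<Omega> u] by simp
    show "AE y in lebesgue_on \<Omega>. (\<lambda>k. u y \<bullet> mol ((1 / 2) ^ n) (X k) y) \<longlonglongrightarrow> u y \<bullet> mol ((1 / 2) ^ n) a y"
    proof (rule AE_I2)
      fix y
      have "(\<lambda>k. (1 / (1 / 2) ^ n) *\<^sub>R y + (- (1 / (1 / 2) ^ n)) *\<^sub>R X k)
          \<longlonglongrightarrow> (1 / (1 / 2) ^ n) *\<^sub>R y + (- (1 / (1 / 2) ^ n)) *\<^sub>R a"
        by (intro tendsto_add tendsto_scaleR tendsto_const X)
      then have "(\<lambda>k. rescale ((1 / 2) ^ n) (X k) eta y) \<longlonglongrightarrow> rescale ((1 / 2) ^ n) a eta y"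
        unfolding rescale_def
        by (rule continuous_on_tendsto_compose[OF smooth_continuous[OF smooth_eta, of UNIV]]) auto
      then show "(\<lambda>k. u y \<bullet> mol ((1 / 2) ^ n) (X k) y) \<longlonglongrightarrow> u y \<bullet> mol ((1 / 2) ^ n) a y"
        unfolding mol_def inner_real_def by (intro tendsto_mult_left)
    qed
    show "AE y in lebesgue_on \<Omega>. norm (u y \<bullet> mol ((1 / 2) ^ n) (X k) y) \<le> \<bar>u y\<bar> * B" for k
      using B(2) by (intro AE_I2) (simp add: abs_mult mult_left_mono)
  qed measurable
qed

lemma continuous_limit_avg:
  assumes f: "f \<in> L2 \<Omega>" and s: "weak_solution f u g"
  shows "continuous_on \<Omega> (limit_avg u)"
proof -
  have u: "u \<in> L2 \<Omega>" using s H10_pair_L2 by (auto simp: weak_solution_def)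
  have "isCont (limit_avg u) x0" if x0: "x0 \<in> \<Omega>" for x0
  proof -
    obtain e where e: "e > 0" "cball x0 e \<subseteq> \<Omega>" using open_contains_cball open_\<Omega> x0 by blast
    \<comment> \<open>Half of \<open>e\<close> is for the radius of the balls, the other half for
      moving their centre.\<close>
    obtain N where N: "(1 / 2 :: real) ^ N < e / 2" using real_arch_pow_inv[of "e / 2" "1 / 2"] e(1) by auto
    have sub: "cball x ((1 / 2) ^ N) \<subseteq> \<Omega>" if "x \<in> ball x0 (e / 2)" for x
    proof -
      have "cball x ((1 / 2) ^ N) \<subseteq> cball x0 e"
        using that N by (intro cball_subset_cball_iff[THEN iffD2]) (auto simp: dist_commute)
      then show ?thesis using e(2) by blast
    qed
    have "uniform_limit (ball x0 (e / 2)) (avg u) (limit_avg u) sequentially"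
    proof (rule uniform_limitI)
      fix \<epsilon> :: real assume \<epsilon>: "\<epsilon> > 0"
      have "(\<lambda>n. L2_norm \<Omega> f * C\<^sub>W * q ^ n / (1 - q)) \<longlonglongrightarrow> L2_norm \<Omega> f * C\<^sub>W * 0 / (1 - q)"
        using q by (intro tendsto_intros LIMSEQ_power_zero) auto
      then have "\<forall>\<^sub>F n in sequentially. L2_norm \<Omega> f * C\<^sub>W * q ^ n / (1 - q) < \<epsilon>"
        using \<epsilon> by (intro order_tendstoD(2)) auto
      then show "\<forall>\<^sub>F n in sequentially. \<forall>x\<in>ball x0 (e / 2). dist (avg u n x) (limit_avg u x) < \<epsilon>"
        using eventually_ge_at_top[of N]
      proof eventually_elim
        case (elim n)
        show ?case
        proof
          fix x assume "x \<in> ball x0 (e / 2)"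
          from avg_limit(2)[OF f s sub[OF this] elim(2)] elim(1)
          show "dist (avg u n x) (limit_avg u x) < \<epsilon>" by (simp add: dist_real_def abs_minus_commute)
        qed
      qed
    qed
    then have "continuous_on (ball x0 (e / 2)) (limit_avg u)"
      by (rule uniform_limit_theorem[rotated])
        (auto intro!: always_eventually continuous_on_subset[OF continuous_avg[OF u]])
    then show ?thesis using e(1) by (simp add: continuous_on_eq_continuous_at)
  qed
  then show ?thesis by (simp add: continuous_at_imp_continuous_on)
qed

text \<open>\<open>u\<close> is only Lebesgue measurable and only its values in \<Omega> matter,
  whereas Fubini on the product of two copies of \<open>lborel\<close> wants a Borel function on the
  whole space.\<close>

lemma borel_version:
  assumes "u \<in> L2 \<Omega>"
  obtains U where "integrable lborel U"
    "\<And>\<psi> :: 'a \<Rightarrow> real. \<psi> \<in> borel_measurable borel \<Longrightarrow> integral\<^sup>L (lebesgue_on \<Omega>) (\<lambda>y. u y * \<psi> y) = integral\<^sup>L lborel (\<lambda>y. U y * \<psi> y)"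
proof -
  have int: "integrable lebesgue (\<lambda>x. indicator \<Omega> x *\<^sub>R u x)"
    using L2_integrable[OF open_\<Omega> bounded_\<Omega> assms] sets_\<Omega> by (subst (asm) integrable_restrict_space) auto
  then obtain U where U[measurable]: "U \<in> borel_measurable lborel" and AE: "AE x in lborel. indicator \<Omega> x *\<^sub>R u x = U x"
    using completion_ex_borel_measurable_real[OF borel_measurable_integrable[OF int]] by blast
  have AE': "AE x in lebesgue. indicator \<Omega> x *\<^sub>R u x = U x" by (rule AE_completion[OF AE])
  have Um: "U \<in> borel_measurable lebesgue" by (rule measurable_completion[OF U])
  have "integrable lebesgue U"
    using integrable_cong_AE_imp[OF int Um] AE' by (simp add: eq_commute)
  then have "integrable lborel U" by (simp add: integrable_completion)
  moreover have "integral\<^sup>L (lebesgue_on \<Omega>) (\<lambda>y. u y * \<psi> y) = integral\<^sup>L lborel (\<lambda>y. U y * \<psi> y)"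
    if \<psi>[measurable]: "\<psi> \<in> borel_measurable borel" for \<psi> :: "'a \<Rightarrow> real"
  proof -
    have \<psi>': "\<psi> \<in> borel_measurable lebesgue" using \<psi> by (intro measurable_completion) simp
    have "integral\<^sup>L (lebesgue_on \<Omega>) (\<lambda>y. u y * \<psi> y) = integral\<^sup>L lebesgue (\<lambda>y. indicator \<Omega> y *\<^sub>R (u y * \<psi> y))"
      using sets_\<Omega> by (intro integral_restrict_space) auto
    also have "\<dots> = integral\<^sup>L lebesgue (\<lambda>y. U y * \<psi> y)"
    proof (rule integral_cong_AE)
      have "(\<lambda>y. (indicator \<Omega> y *\<^sub>R u y) * \<psi> y) \<in> borel_measurable lebesgue"
        by (intro borel_measurable_times borel_measurable_integrable[OF int] \<psi>')
      then show "(\<lambda>y. indicator \<Omega> y *\<^sub>R (u y * \<psi> y)) \<in> borel_measurable lebesgue" by (simp add: mult.assoc)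
      show "(\<lambda>y. U y * \<psi> y) \<in> borel_measurable lebesgue" by (intro borel_measurable_times Um \<psi>')
      show "AE y in lebesgue. indicator \<Omega> y *\<^sub>R (u y * \<psi> y) = U y * \<psi> y"
        using AE' by eventually_elim (simp add: mult.assoc[symmetric])
    qed
    also have "\<dots> = integral\<^sup>L lborel (\<lambda>y. U y * \<psi> y)" by (rule integral_completion) measurable
    finally show ?thesis .
  qed
  ultimately show thesis by (rule that)
qed

text \<open>By Fubini, averaging \<open>u\<close> against a test function \<open>\<phi>\<close> is the same as averaging \<open>\<phi>\<close>, and the averages
  of \<open>\<phi>\<close> converge boundedly.\<close>

lemma limit_avg_weak:
  assumes f: "f \<in> L2 \<Omega>" and s: "weak_solution f u g" and \<phi>: "\<phi> \<in> test_functions \<Omega>"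
  shows "integral\<^sup>L (lebesgue_on \<Omega>) (\<lambda>x. limit_avg u x * \<phi> x)
    = integral\<^sup>L lborel (eta :: 'a \<Rightarrow> real) * integral\<^sup>L (lebesgue_on \<Omega>) (\<lambda>x. u x * \<phi> x)"
proof -
  let ?mass = "integral\<^sup>L lborel (eta :: 'a \<Rightarrow> real)"
  have u: "u \<in> L2 \<Omega>" using s H10_pair_L2 by (auto simp: weak_solution_def)
  obtain U where U: "integrable lborel U"
    and Uu: "\<And>\<psi> :: 'a \<Rightarrow> real. \<psi> \<in> borel_measurable borel \<Longrightarrow> integral\<^sup>L (lebesgue_on \<Omega>) (\<lambda>y. u y * \<psi> y) = integral\<^sup>L lborel (\<lambda>y. U y * \<psi> y)"
    using borel_version[OF u] by blast
  have int\<phi>: "integrable lborel \<phi>" by (rule test_functions_integrable[OF \<phi>])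
  have int\<eta>: "integrable lborel (eta :: 'a \<Rightarrow> real)" by (rule test_functions_integrable[OF eta_test])
  have \<phi>b[measurable]: "\<phi> \<in> borel_measurable borel" by (rule smooth_borel_measurable[OF test_functions_smooth[OF \<phi>]])
  have \<eta>b[measurable]: "(eta :: 'a \<Rightarrow> real) \<in> borel_measurable borel" by (rule smooth_borel_measurable[OF smooth_eta])
  note Ub[measurable] = borel_measurable_integrable[OF U]
  obtain S where S: "compact S" "S \<subseteq> \<Omega>" "\<And>x. x \<notin> S \<Longrightarrow> \<phi> x = 0" using test_functionsE[OF \<phi>] by metis
  obtain B where B: "B \<ge> 0" "\<And>x. \<bar>\<phi> x\<bar> \<le> B" using test_functions_bounded[OF \<phi>] by metis
  define t where "t n = (1 / 2 :: real) ^ n" for n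
  have t: "t n > 0" for n by (simp add: t_def)
  have t0: "t \<longlonglongrightarrow> 0" unfolding t_def by (rule LIMSEQ_power_zero) simp
  \<comment> \<open>The dual averages: \<phi> is integrated over the centre of the mollifier, see
    \<open>m_mol\<close>.\<close>
  define m where "m n y = integral\<^sup>L lborel (\<lambda>z. \<phi> (y + (- t n) *\<^sub>R z) * eta z)" for n y
  have m_mol: "m n y = integral\<^sup>L lborel (\<lambda>x. \<phi> x * mol (t n) x y)" for n y
    unfolding m_def by (rule integral_mol_left[OF t \<phi>b, symmetric])
  have \<phi>\<eta>_le: "\<bar>\<phi> w * eta z\<bar> \<le> B * eta z" for w and z :: 'a
    using B(2)[of w] eta_nonneg[of z] by (simp add: abs_mult mult_right_mono)
  have m_le: "\<bar>m n y\<bar> \<le> B * ?mass" for n y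
  proof -
    have "\<bar>m n y\<bar> \<le> integral\<^sup>L lborel (\<lambda>z. \<bar>\<phi> (y + (- t n) *\<^sub>R z) * eta z\<bar>)"
      unfolding m_def by (rule integral_abs_bound)
    also have "\<dots> \<le> integral\<^sup>L lborel (\<lambda>z :: 'a. B * eta z)"
    proof (rule integral_mono)
      show "integrable lborel (\<lambda>z :: 'a. B * eta z)" using int\<eta> by simp
      then have "integrable lborel (\<lambda>z. \<phi> (y + (- t n) *\<^sub>R z) * eta z)"
        by (rule Bochner_Integration.integrable_bound) (use \<phi>\<eta>_le in \<open>auto intro!: AE_I2 order_trans[OF _ abs_ge_self]\<close>)
      then show "integrable lborel (\<lambda>z. \<bar>\<phi> (y + (- t n) *\<^sub>R z) * eta z\<bar>)" by simp
    qed (rule \<phi>\<eta>_le)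
    finally show ?thesis by simp
  qed
  have m_lim: "(\<lambda>n. m n y) \<longlonglongrightarrow> ?mass * \<phi> y" for y
  proof -
    have "(\<lambda>n. m n y) \<longlonglongrightarrow> integral\<^sup>L lborel (\<lambda>z :: 'a. \<phi> y * eta z)"
      unfolding m_def
    proof (rule integral_dominated_convergence[where w = "\<lambda>z :: 'a. B * eta z"])
      show "integrable lborel (\<lambda>z :: 'a. B * eta z)" using int\<eta> by simp
      show "AE z in lborel. norm (\<phi> (y + (- t n) *\<^sub>R z) * eta z) \<le> B * eta z" for n
        using \<phi>\<eta>_le by (intro AE_I2) simp
      show "AE z in lborel. (\<lambda>n. \<phi> (y + (- t n) *\<^sub>R z) * eta z) \<longlonglongrightarrow> \<phi> y * eta z"
      proof (rule AE_I2)
        fix z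
        have "(\<lambda>n. y + (- t n) *\<^sub>R z) \<longlonglongrightarrow> y + (- 0) *\<^sub>R z" by (intro tendsto_intros t0)
        then have "(\<lambda>n. \<phi> (y + (- t n) *\<^sub>R z)) \<longlonglongrightarrow> \<phi> y"
          by (intro continuous_on_tendsto_compose[OF smooth_continuous[OF test_functions_smooth[OF \<phi>], of UNIV]]) auto
        then show "(\<lambda>n. \<phi> (y + (- t n) *\<^sub>R z) * eta z) \<longlonglongrightarrow> \<phi> y * eta z" by (rule tendsto_mult_right)
      qed
    qed measurable
    then show ?thesis by (simp add: mult.commute)
  qed
  have avgU: "avg u n x = integral\<^sup>L lborel (\<lambda>y. U y * mol (t n) x y)" for n x
    using Uu[OF smooth_borel_measurable[OF smooth_mol]] by (simp add: avg_def t_def)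
  have avgb[measurable]: "avg u n \<in> borel_measurable borel" for n
    by (rule borel_measurable_continuous_onI[OF continuous_avg[OF u]])
  have Fub: "integral\<^sup>L (lebesgue_on \<Omega>) (\<lambda>x. avg u n x * \<phi> x) = integral\<^sup>L lborel (\<lambda>y. U y * m n y)" for n
  proof -
    obtain B' where B': "B' \<ge> 0" "\<And>x y :: 'a. \<bar>mol (t n) x y\<bar> \<le> B'" using mol_bounded[OF t] by blast
    have int: "integrable (lborel \<Otimes>\<^sub>M lborel) (\<lambda>(x, y). \<phi> x * (U y * (case (x, y) of (x, y) \<Rightarrow> mol (t n) x y)))"
    proof (rule pair_integrable_product[OF int\<phi> U])
      show "(\<lambda>(x, y). mol (t n) x y) \<in> borel_measurable (lborel \<Otimes>\<^sub>M (lborel :: 'a measure))"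
        unfolding mol_def rescale_def by measurable
      show "\<bar>case p of (x, y) \<Rightarrow> mol (t n) x y\<bar> \<le> B'" for p :: "'a \<times> 'a" using B'(2) by (auto split: prod.split)
    qed
    have "integral\<^sup>L (lebesgue_on \<Omega>) (\<lambda>x. avg u n x * \<phi> x) = integral\<^sup>L lborel (\<lambda>x. avg u n x * \<phi> x)"
      using test_functions_outside[OF \<phi>] by (intro integral_lebesgue_on_eq_lborel sets_\<Omega>) auto
    also have "\<dots> = integral\<^sup>L lborel (\<lambda>x. integral\<^sup>L lborel (\<lambda>y. \<phi> x * (U y * mol (t n) x y)))"
      by (simp add: avgU mult.commute)
    also have "\<dots> = integral\<^sup>L lborel (\<lambda>y. integral\<^sup>L lborel (\<lambda>x. \<phi> x * (U y * mol (t n) x y)))"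
      using lborel_pair.Fubini_integral[of "\<lambda>x y. \<phi> x * (U y * mol (t n) x y)"] int by simp
    also have "\<dots> = integral\<^sup>L lborel (\<lambda>y. integral\<^sup>L lborel (\<lambda>x. U y * (\<phi> x * mol (t n) x y)))"
      by (simp add: mult.left_commute)
    also have "\<dots> = integral\<^sup>L lborel (\<lambda>y. U y * m n y)" by (simp add: m_mol)
    finally show ?thesis .
  qed
  have rhs: "(\<lambda>n. integral\<^sup>L (lebesgue_on \<Omega>) (\<lambda>x. avg u n x * \<phi> x)) \<longlonglongrightarrow> ?mass * integral\<^sup>L (lebesgue_on \<Omega>) (\<lambda>x. u x * \<phi> x)"
  proof -
    have "(\<lambda>n. integral\<^sup>L lborel (\<lambda>y. U y * m n y)) \<longlonglongrightarrow> integral\<^sup>L lborel (\<lambda>y. U y * (?mass * \<phi> y))"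
    proof (rule integral_dominated_convergence[where w = "\<lambda>y. \<bar>U y\<bar> * (B * ?mass)"])
      show "integrable lborel (\<lambda>y. \<bar>U y\<bar> * (B * ?mass))" using U by simp
      show "AE y in lborel. (\<lambda>n. U y * m n y) \<longlonglongrightarrow> U y * (?mass * \<phi> y)"
        by (intro AE_I2 tendsto_mult_left m_lim)
      show "AE y in lborel. norm (U y * m n y) \<le> \<bar>U y\<bar> * (B * ?mass)" for n
        using m_le by (intro AE_I2) (simp add: abs_mult mult_left_mono)
      have "(\<lambda>y. integral\<^sup>L lborel (\<lambda>x. \<phi> x * mol (t n) x y)) \<in> borel_measurable borel" for n
        unfolding mol_def rescale_def by measurable
      then have [measurable]: "m n \<in> borel_measurable borel" for n
        by (simp add: m_mol[abs_def])
      show "(\<lambda>y. U y * m n y) \<in> borel_measurable lborel" for n by measurable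
    qed measurable
    also have "integral\<^sup>L lborel (\<lambda>y. U y * (?mass * \<phi> y)) = ?mass * integral\<^sup>L lborel (\<lambda>y. U y * \<phi> y)"
      unfolding mult.left_commute[of "U y" for y] by (rule integral_mult_right_zero)
    finally show ?thesis by (simp add: Fub Uu[OF \<phi>b])
  qed
  \<comment> \<open>A uniform margin around the support lets one \<open>N\<close> serve all its
    points; the sequence of averages is then started at \<open>N\<close>.\<close>
  obtain e where e: "e > 0" "(\<Union>x\<in>S. cball x e) \<subseteq> \<Omega>"
    using compact_subset_open_imp_cball_epsilon_subset[OF S(1) open_\<Omega> S(2)] by blast
  obtain N where N: "(1 / 2 :: real) ^ N < e" using real_arch_pow_inv[of e "1 / 2"] e(1) by auto
  have sub: "cball x ((1 / 2) ^ N) \<subseteq> \<Omega>" if "x \<in> S" for x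
    using e(2) that N subset_cball[of "(1 / 2) ^ N" e x] by force
  note Uc = continuous_limit_avg[OF f s]
  obtain K0 where K0: "\<And>x. x \<in> S \<Longrightarrow> \<bar>limit_avg u x\<bar> \<le> K0"
    using compact_imp_bounded[OF compact_continuous_image[OF continuous_on_subset[OF Uc S(2)] S(1)]]
    by (auto simp: bounded_iff)
  define D where "D = \<bar>L2_norm \<Omega> f * C\<^sub>W / (1 - q)\<bar>"
  have lhs: "(\<lambda>n. integral\<^sup>L (lebesgue_on \<Omega>) (\<lambda>x. avg u (n + N) x * \<phi> x)) \<longlonglongrightarrow> integral\<^sup>L (lebesgue_on \<Omega>) (\<lambda>x. limit_avg u x * \<phi> x)"
  proof (rule integral_dominated_convergence[where w = "\<lambda>x. (K0 + D) * \<bar>\<phi> x\<bar>"])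
    show "integrable (lebesgue_on \<Omega>) (\<lambda>x. (K0 + D) * \<bar>\<phi> x\<bar>)"
      using L2_integrable[OF open_\<Omega> bounded_\<Omega> test_L2[OF \<phi>]] by simp
    show "(\<lambda>x. limit_avg u x * \<phi> x) \<in> borel_measurable (lebesgue_on \<Omega>)"
      by (intro borel_measurable_times borel_meas[OF \<phi>b] continuous_imp_measurable_on_sets_lebesgue[OF Uc sets_\<Omega>])
    show "(\<lambda>x. avg u (n + N) x * \<phi> x) \<in> borel_measurable (lebesgue_on \<Omega>)" for n
      by (intro borel_measurable_times borel_meas[OF \<phi>b] borel_meas[OF avgb])
    show "AE x in lebesgue_on \<Omega>. (\<lambda>n. avg u (n + N) x * \<phi> x) \<longlonglongrightarrow> limit_avg u x * \<phi> x"
    proof (rule AE_I2)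
      fix x
      show "(\<lambda>n. avg u (n + N) x * \<phi> x) \<longlonglongrightarrow> limit_avg u x * \<phi> x"
      proof (cases "x \<in> S")
        case True
        show ?thesis
          by (intro tendsto_mult_right LIMSEQ_ignore_initial_segment avg_limit(1)[OF f s sub[OF True]])
      qed (simp add: S(3))
    qed
    show "AE x in lebesgue_on \<Omega>. norm (avg u (n + N) x * \<phi> x) \<le> (K0 + D) * \<bar>\<phi> x\<bar>" for n
    proof (rule AE_I2)
      fix x
      show "norm (avg u (n + N) x * \<phi> x) \<le> (K0 + D) * \<bar>\<phi> x\<bar>"
      proof (cases "x \<in> S")
        case True
        have "\<bar>limit_avg u x - avg u (n + N) x\<bar> \<le> (L2_norm \<Omega> f * C\<^sub>W / (1 - q)) * q ^ (n + N)"
          using avg_limit(2)[OF f s sub[OF True], of "n + N"] by simp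
        also have "\<dots> \<le> D * 1"
        proof (rule mult_mono)
          show "L2_norm \<Omega> f * C\<^sub>W / (1 - q) \<le> D" unfolding D_def by (rule abs_ge_self)
          show "q ^ (n + N) \<le> 1" "0 \<le> q ^ (n + N)" using q by (auto intro: power_le_one)
        qed (simp add: D_def)
        finally have "\<bar>avg u (n + N) x\<bar> \<le> K0 + D" using K0[OF True] by linarith
        then show ?thesis by (simp add: abs_mult mult_right_mono)
      qed (simp add: S(3))
    qed
  qed
  show ?thesis
    by (rule LIMSEQ_unique[OF lhs LIMSEQ_ignore_initial_segment[OF rhs]])
qed

text \<open>Only continuity on the open set \<Omega> is known, and nothing about boundedness near
  the boundary. On the compact support of a test function \<open>limit_avg u\<close> is
  bounded.\<close>

lemma integrable_limit_avg:
  assumes f: "f \<in> L2 \<Omega>" and s: "weak_solution f u g" and \<phi>: "\<phi> \<in> test_functions \<Omega>"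
  shows "integrable (lebesgue_on \<Omega>) (\<lambda>x. limit_avg u x * \<phi> x)"
proof -
  note Uc = continuous_limit_avg[OF f s]
  obtain S where S: "compact S" "S \<subseteq> \<Omega>" "\<And>x. x \<notin> S \<Longrightarrow> \<phi> x = 0" using test_functionsE[OF \<phi>] by metis
  obtain K0 where K0: "\<And>x. x \<in> S \<Longrightarrow> \<bar>limit_avg u x\<bar> \<le> K0"
    using compact_imp_bounded[OF compact_continuous_image[OF continuous_on_subset[OF Uc S(2)] S(1)]]
    by (auto simp: bounded_iff)
  have "integrable (lebesgue_on \<Omega>) (\<lambda>x. K0 * \<phi> x)"
    using L2_integrable[OF open_\<Omega> bounded_\<Omega> test_L2[OF \<phi>]] by simp
  then show ?thesis
  proof (rule Bochner_Integration.integrable_bound)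
    show "(\<lambda>x. limit_avg u x * \<phi> x) \<in> borel_measurable (lebesgue_on \<Omega>)"
      by (intro borel_measurable_times L2_measurable[OF test_L2[OF \<phi>]] continuous_imp_measurable_on_sets_lebesgue[OF Uc sets_\<Omega>])
    show "AE x in lebesgue_on \<Omega>. norm (limit_avg u x * \<phi> x) \<le> norm (K0 * \<phi> x)"
    proof (rule AE_I2)
      fix x
      show "norm (limit_avg u x * \<phi> x) \<le> norm (K0 * \<phi> x)"
        using K0[of x] S(3)[of x] by (cases "x \<in> S") (auto simp: abs_mult intro!: mult_right_mono)
    qed
  qed
qed

text \<open>Since integrability of \<open>limit_avg u\<close> itself is not known, the fundamental
  lemma is applied after multiplication by cutoffs \<psi> that converge to the indicator of
  \<Omega>. At each point of \<Omega> some cutoff is nonzero and can be cancelled.\<close>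

lemma limit_avg_AE:
  assumes f: "f \<in> L2 \<Omega>" and s: "weak_solution f u g"
  shows "AE x in lebesgue_on \<Omega>. limit_avg u x = integral\<^sup>L lborel (eta :: 'a \<Rightarrow> real) * u x"
proof -
  let ?m = "integral\<^sup>L lborel (eta :: 'a \<Rightarrow> real)"
  have u: "u \<in> L2 \<Omega>" using s H10_pair_L2 by (auto simp: weak_solution_def)
  obtain \<psi> where \<psi>: "\<And>n::nat. \<psi> n \<in> test_functions \<Omega>" "\<And>x. (\<lambda>n. \<psi> n x) \<longlonglongrightarrow> indicat_real \<Omega> x"
    using open_indicator_limit_test_functions[OF open_\<Omega>] by metis
  have int: "integrable (lebesgue_on \<Omega>) (\<lambda>x. limit_avg u x * \<phi> x)" "integrable (lebesgue_on \<Omega>) (\<lambda>x. u x * \<phi> x)"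
    if "\<phi> \<in> test_functions \<Omega>" for \<phi>
    using integrable_limit_avg[OF f s that] L2_integrable_inner[OF u test_L2[OF that]] by auto
  have AEn: "AE x in lebesgue_on \<Omega>. limit_avg u x * \<psi> n x - ?m * (u x * \<psi> n x) = 0" for n
  proof (rule fundamental_lemma[OF open_\<Omega>])
    show "integrable (lebesgue_on \<Omega>) (\<lambda>x. limit_avg u x * \<psi> n x - ?m * (u x * \<psi> n x))"
      using int[OF \<psi>(1)] by simp
    fix \<phi> assume \<phi>: "\<phi> \<in> test_functions \<Omega>"
    have \<psi>\<phi>: "(\<lambda>x. \<psi> n x * \<phi> x) \<in> test_functions \<Omega>"
      by (rule test_functions_mult[OF \<phi> test_functions_smooth[OF \<psi>(1)]])
    have "integral\<^sup>L (lebesgue_on \<Omega>) (\<lambda>x. (limit_avg u x * \<psi> n x - ?m * (u x * \<psi> n x)) * \<phi> x)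
        = integral\<^sup>L (lebesgue_on \<Omega>) (\<lambda>x. limit_avg u x * (\<psi> n x * \<phi> x) - ?m * (u x * (\<psi> n x * \<phi> x)))"
      by (simp add: algebra_simps)
    also have "\<dots> = 0"
      using int[OF \<psi>\<phi>] limit_avg_weak[OF f s \<psi>\<phi>] by simp
    finally show "integral\<^sup>L (lebesgue_on \<Omega>) (\<lambda>x. (limit_avg u x * \<psi> n x - ?m * (u x * \<psi> n x)) * \<phi> x) = 0" .
  qed
  have "AE x in lebesgue_on \<Omega>. \<forall>n. limit_avg u x * \<psi> n x - ?m * (u x * \<psi> n x) = 0"
    unfolding AE_all_countable by (intro allI AEn)
  then show ?thesis
    using AE_space
  proof eventually_elim
    case (elim x)
    then have "x \<in> \<Omega>" by (simp add: space_restrict_space)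
    have "\<exists>n. \<psi> n x \<noteq> 0"
    proof (rule ccontr)
      assume "\<not> (\<exists>n. \<psi> n x \<noteq> 0)"
      then show False using \<psi>(2)[of x] \<open>x \<in> \<Omega>\<close> by (simp add: LIMSEQ_const_iff)
    qed
    then obtain n where "\<psi> n x \<noteq> 0" by blast
    moreover have "(limit_avg u x - ?m * u x) * \<psi> n x = 0"
      using spec[OF elim(1), of n] by (simp only: left_diff_distrib mult.assoc)
    ultimately show ?case by simp
  qed
qed

text \<open>The witness for the choice in \<open>inv_neg_laplacian\<close>: the limit of the
  averages, divided by the mass of \<open>eta\<close>.\<close>

lemma continuous_solution:
  assumes f: "f \<in> L2 \<Omega>"
  shows "\<exists>u. weak_poisson_solution \<Omega> f u \<and> continuous_on \<Omega> u"
proof -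
  let ?m = "integral\<^sup>L lborel (eta :: 'a \<Rightarrow> real)"
  obtain u g where s: "weak_solution f u g" using weak_solution_exists[OF f] by blast
  then have p: "H10_pair u g" by (simp add: weak_solution_def)
  define v where "v x = limit_avg u x / ?m" for x
  have m: "?m > 0" by (rule integral_eta_pos)
  have c: "continuous_on \<Omega> v"
    unfolding v_def[abs_def] using m by (intro continuous_on_divide continuous_limit_avg[OF f s] continuous_on_const) auto
  have AE: "AE x in lebesgue_on \<Omega>. v x = u x"
    using limit_avg_AE[OF f s] by eventually_elim (use m in \<open>simp add: v_def\<close>)
  have "v \<in> L2 \<Omega>"
    by (rule L2_cong_AE[OF H10_pair_L2(1)[OF p] continuous_imp_measurable_on_sets_lebesgue[OF c sets_\<Omega>]])
      (use AE in \<open>simp add: eq_commute\<close>)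
  then have "H10_pair v g" by (rule H10_pair_cong[OF p _ AE])
  then have "weak_solution f v g" using s by (simp add: weak_solution_def)
  then show ?thesis using c weak_poisson_solution_iff[OF f] by blast
qed

text \<open>The value at \<open>x\<close> is compared with the average at one fixed scale that fits
  into \<Omega>. This average is an inner product with \<open>u\<close>, whose norm is controlled by
  \<open>weak_solution_bound\<close>; the rest is the tail of a geometric series.\<close>

lemma solution_pointwise_bound:
  assumes x: "x \<in> \<Omega>"
  obtains C where "\<And>f u g. f \<in> L2 \<Omega> \<Longrightarrow> weak_solution f u g \<Longrightarrow> continuous_on \<Omega> u \<Longrightarrow> \<bar>u x\<bar> \<le> C * L2_norm \<Omega> f"
proof -
  let ?m = "integral\<^sup>L lborel (eta :: 'a \<Rightarrow> real)"
  have m: "?m > 0" by (rule integral_eta_pos)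
  obtain e where e: "e > 0" "cball x e \<subseteq> \<Omega>" using open_contains_cball open_\<Omega> x by blast
  obtain N where N: "(1 / 2 :: real) ^ N < e" using real_arch_pow_inv[of e "1 / 2"] e(1) by auto
  have sub: "cball x ((1 / 2) ^ N) \<subseteq> \<Omega>" using e(2) N subset_cball[of "(1 / 2) ^ N" e x] by force
  obtain c where c: "c > 0" "\<And>f u g. f \<in> L2 \<Omega> \<Longrightarrow> weak_solution f u g \<Longrightarrow> L2_norm \<Omega> u \<le> c * L2_norm \<Omega> f"
    using weak_solution_bound by metis
  define l where "l = L2_norm \<Omega> (mol ((1 / 2) ^ N) x)"
  have "\<bar>u x\<bar> \<le> ((c * l + C\<^sub>W * q ^ N / (1 - q)) / ?m) * L2_norm \<Omega> f"
    if f: "f \<in> L2 \<Omega>" and s: "weak_solution f u g" and u: "continuous_on \<Omega> u" for f u g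
  proof -
    have uL: "u \<in> L2 \<Omega>" using s H10_pair_L2 by (auto simp: weak_solution_def)
    have "limit_avg u x = ?m * u x"
      by (rule continuous_AE_eq[OF open_\<Omega> continuous_limit_avg[OF f s] _ limit_avg_AE[OF f s] x])
        (intro continuous_on_mult continuous_on_const u)
    then have "?m * \<bar>u x\<bar> = \<bar>limit_avg u x\<bar>" using m by (simp add: abs_mult)
    also have "\<dots> \<le> \<bar>avg u N x\<bar> + L2_norm \<Omega> f * C\<^sub>W * q ^ N / (1 - q)"
      using avg_limit(2)[OF f s sub order_refl] by linarith
    also have "\<bar>avg u N x\<bar> \<le> L2_norm \<Omega> u * l"
      unfolding avg_def l_def by (intro L2_Cauchy_Schwarz uL mol_L2) simp
    also have "L2_norm \<Omega> u * l \<le> c * L2_norm \<Omega> f * l"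
      unfolding l_def by (intro mult_right_mono c(2)[OF f s] L2_norm_nonneg)
    finally have "?m * \<bar>u x\<bar> \<le> (c * l + C\<^sub>W * q ^ N / (1 - q)) * L2_norm \<Omega> f"
      by (simp add: algebra_simps)
    then show ?thesis using m by (simp add: pos_le_divide_eq mult.commute)
  qed
  then show thesis by (rule that)
qed

section \<open>The solution operator\<close>

abbreviation S :: "('a \<Rightarrow> real) \<Rightarrow> 'a \<Rightarrow> real" where
  "S \<equiv> inv_neg_laplacian \<Omega>"

lemma S_solution:
  assumes "f \<in> L2 \<Omega>"
  obtains g where "weak_solution f (S f) g" "continuous_on \<Omega> (S f)" "S f \<in> L2 \<Omega>"
proof -
  have "weak_poisson_solution \<Omega> f (S f) \<and> continuous_on \<Omega> (S f)"
    unfolding inv_neg_laplacian_def by (rule someI_ex[OF continuous_solution[OF assms]])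
  then show thesis using that weak_poisson_solution_iff[OF assms] H10_pair_L2(1)
    unfolding weak_solution_def by blast
qed

text \<open>The choices for the three sources are unrelated. Their linear defect is a continuous
  weak solution with source 0, and the pointwise bound makes it vanish.\<close>

lemma S_linear:
  assumes f: "f \<in> L2 \<Omega>" and h: "h \<in> L2 \<Omega>" and x: "x \<in> \<Omega>"
  shows "S (\<lambda>x. a * f x + b * h x) x = a * S f x + b * S h x"
proof -
  let ?k = "\<lambda>x. a * f x + b * h x"
  have k: "?k \<in> L2 \<Omega>" by (intro L2_add L2_cmult f h)
  obtain gf where gf: "weak_solution f (S f) gf" "continuous_on \<Omega> (S f)" "S f \<in> L2 \<Omega>" by (rule S_solution[OF f])
  obtain gh where gh: "weak_solution h (S h) gh" "continuous_on \<Omega> (S h)" "S h \<in> L2 \<Omega>" by (rule S_solution[OF h])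
  obtain gk where gk: "weak_solution ?k (S ?k) gk" "continuous_on \<Omega> (S ?k)" "S ?k \<in> L2 \<Omega>" by (rule S_solution[OF k])
  have 1: "(\<lambda>x. ?k x + (- a) * f x) \<in> L2 \<Omega>" by (intro L2_add[OF k] L2_cmult f)
  have 2: "(\<lambda>x. (?k x + (- a) * f x) + (- b) * h x) \<in> L2 \<Omega>" by (intro L2_add[OF 1] L2_cmult h)
  note w = weak_solution_combine[OF 1 weak_solution_combine[OF k gk(1) f gf(1), of "- a"] h gh(1), of "- b"]
  obtain C where C: "\<And>f u g. f \<in> L2 \<Omega> \<Longrightarrow> weak_solution f u g \<Longrightarrow> continuous_on \<Omega> u \<Longrightarrow> \<bar>u x\<bar> \<le> C * L2_norm \<Omega> f"
    using solution_pointwise_bound[OF x] by metis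
  have "continuous_on \<Omega> (\<lambda>x. (S ?k x + (- a) * S f x) + (- b) * S h x)"
    by (intro continuous_on_add continuous_on_mult continuous_on_const gk gf gh)
  from C[OF 2 w this] have "\<bar>(S ?k x + (- a) * S f x) + (- b) * S h x\<bar> \<le> 0"
    by (simp add: L2_norm_def)
  then show ?thesis by simp
qed

lemma S_bound:
  obtains c where "c > 0" "\<And>f. f \<in> L2 \<Omega> \<Longrightarrow> L2_norm \<Omega> (S f) \<le> c * L2_norm \<Omega> f"
proof -
  obtain c where c: "c > 0" "\<And>f u g. f \<in> L2 \<Omega> \<Longrightarrow> weak_solution f u g \<Longrightarrow> L2_norm \<Omega> u \<le> c * L2_norm \<Omega> f"
    using weak_solution_bound by metis
  show thesis
  proof (rule that[OF c(1)])
    fix f :: "'a \<Rightarrow> real" assume f: "f \<in> L2 \<Omega>"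
    obtain g where "weak_solution f (S f) g" by (rule S_solution[OF f])
    then show "L2_norm \<Omega> (S f) \<le> c * L2_norm \<Omega> f" by (rule c(2)[OF f])
  qed
qed

lemma S_tendsto:
  assumes F: "\<And>n. F n \<in> L2 \<Omega>" and f: "f \<in> L2 \<Omega>" and lim: "(\<lambda>n. L2_norm \<Omega> (\<lambda>x. F n x - f x)) \<longlonglongrightarrow> 0"
  shows "x \<in> \<Omega> \<Longrightarrow> (\<lambda>n. S (F n) x) \<longlonglongrightarrow> S f x"
    and "(\<lambda>n. L2_norm \<Omega> (\<lambda>x. S (F n) x - S f x)) \<longlonglongrightarrow> 0"
proof -
  have d: "(\<lambda>x. F n x - f x) \<in> L2 \<Omega>" for n by (intro L2_diff F f)
  have eq: "S (\<lambda>x. F n x - f x) x = S (F n) x - S f x" if "x \<in> \<Omega>" for n x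
    using S_linear[OF F[of n] f that, where a = 1 and b = "-1"] by simp
  show "(\<lambda>n. S (F n) x) \<longlonglongrightarrow> S f x" if x: "x \<in> \<Omega>"
  proof -
    obtain C where C: "\<And>f u g. f \<in> L2 \<Omega> \<Longrightarrow> weak_solution f u g \<Longrightarrow> continuous_on \<Omega> u \<Longrightarrow> \<bar>u x\<bar> \<le> C * L2_norm \<Omega> f"
      using solution_pointwise_bound[OF x] by metis
    have "\<bar>S (F n) x - S f x\<bar> \<le> C * L2_norm \<Omega> (\<lambda>x. F n x - f x)" for n
    proof -
      obtain g where g: "weak_solution (\<lambda>x. F n x - f x) (S (\<lambda>x. F n x - f x)) g" "continuous_on \<Omega> (S (\<lambda>x. F n x - f x))"
        by (rule S_solution[OF d])
      show ?thesis using C[OF d g] by (simp add: eq[OF x])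
    qed
    then have "(\<lambda>n. S (F n) x - S f x) \<longlonglongrightarrow> 0"
      by (intro Lim_null_comparison[OF _ tendsto_mult_right_zero[OF lim, of C]]) auto
    then show ?thesis by (simp add: LIM_zero_iff)
  qed
  obtain c where c: "c > 0" "\<And>f. f \<in> L2 \<Omega> \<Longrightarrow> L2_norm \<Omega> (S f) \<le> c * L2_norm \<Omega> f" using S_bound by metis
  have "L2_norm \<Omega> (\<lambda>x. S (F n) x - S f x) = L2_norm \<Omega> (S (\<lambda>x. F n x - f x))" for n
    by (rule L2_norm_cong) (simp add: eq)
  then have "L2_norm \<Omega> (\<lambda>x. S (F n) x - S f x) \<le> c * L2_norm \<Omega> (\<lambda>x. F n x - f x)" for n
    using c(2)[OF d] by simp
  then show "(\<lambda>n. L2_norm \<Omega> (\<lambda>x. S (F n) x - S f x)) \<longlonglongrightarrow> 0"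
    by (intro Lim_null_comparison[OF _ tendsto_mult_right_zero[OF lim, of c]]) (auto simp: L2_norm_nonneg)
qed

end

section \<open>Signed measures\<close>

locale signed_measure =
  fixes K :: "'b::topological_space set" and \<mu> :: "'b set \<Rightarrow> real"
  assumes signed: "\<mu> \<in> signed_measures K"
begin

abbreviation "\<A> \<equiv> borel_subsets K"

lemma sums_Union: "range A \<subseteq> \<A> \<Longrightarrow> disjoint_family A \<Longrightarrow> (\<lambda>n::nat. \<mu> (A n)) sums \<mu> (\<Union>n. A n)"
  using signed by (auto simp: signed_measures_def)

lemma empty [simp]: "\<mu> {} = 0"
proof -
  have "(\<lambda>n::nat. \<mu> {}) sums \<mu> {}"
    using sums_Union[of "\<lambda>_. {}"] by (auto simp: disjoint_family_on_def)
  then show ?thesis using sums_summable summable_LIMSEQ_zero LIMSEQ_const_iff by blast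
qed

lemma additive:
  assumes "A \<in> \<A>" "B \<in> \<A>" "A \<inter> B = {}"
  shows "\<mu> (A \<union> B) = \<mu> A + \<mu> B"
proof -
  have "(\<lambda>n. \<mu> (binaryset A B n)) sums \<mu> (\<Union>n. binaryset A B n)"
    using assms by (intro sums_Union)
      (auto simp: disjoint_family_on_def binaryset_def range_binaryset_eq)
  moreover have "(\<lambda>n. \<mu> (binaryset A B n)) sums (\<mu> A + \<mu> B)"
    by (rule binaryset_sums) simp
  ultimately show ?thesis by (simp add: UN_binaryset_eq sums_unique2)
qed

lemma Diff:
  assumes "A \<in> \<A>" "B \<in> \<A>" "B \<subseteq> A"
  shows "\<mu> (A - B) = \<mu> A - \<mu> B"
  using additive[of B "A - B"] assms by (simp add: Un_absorb1)

lemma split: "A \<in> \<A> \<Longrightarrow> P \<in> \<A> \<Longrightarrow> \<mu> A = \<mu> (A \<inter> P) + \<mu> (A - P)"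
  using additive[of "A \<inter> P" "A - P"] by (simp add: Int_Diff_disjoint Int_Diff_Un)

section \<open>The Hahn decomposition\<close>

definition pos_set :: "'b set \<Rightarrow> bool" where
  "pos_set A \<longleftrightarrow> A \<in> \<A> \<and> (\<forall>B\<in>\<A>. B \<subseteq> A \<longrightarrow> 0 \<le> \<mu> B)"

text \<open>The bound \<open>-1\<close> is needed because \<open>\<mu>\<close> is not yet known to be bounded below.\<close>

lemma nearly_minimal_subset:
  assumes "X \<in> \<A>"
  shows "\<exists>C. C \<in> \<A> \<and> C \<subseteq> X \<and> \<mu> C \<le> 0 \<and> (\<forall>D\<in>\<A>. D \<subseteq> X \<longrightarrow> \<mu> C \<le> max (\<mu> D / 2) (-1))"
proof (cases "\<exists>D\<in>\<A>. D \<subseteq> X \<and> \<mu> D \<le> -1")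
  case True
  then obtain D where "D \<in> \<A>" "D \<subseteq> X" "\<mu> D \<le> -1" by auto
  then show ?thesis by (intro exI[of _ D]) auto
next
  case False
  define S where "S = \<mu> ` {D \<in> \<A>. D \<subseteq> X}"
  have bdd: "bdd_below S" using False by (auto simp: S_def intro!: bdd_belowI[of _ "-1"])
  have 0: "0 \<in> S" by (auto simp: S_def image_iff intro!: exI[of _ "{}"])
  then have le: "Inf S \<le> 0" using bdd by (rule cInf_lower)
  have low: "Inf S \<le> \<mu> D" if "D \<in> \<A>" "D \<subseteq> X" for D
    using that bdd by (intro cInf_lower) (auto simp: S_def)
  show ?thesis
  proof (cases "Inf S = 0")
    case True
    then show ?thesis using low by (intro exI[of _ "{}"]) (auto simp: le_max_iff_disj)
  next
    case False
    then have "Inf S < Inf S / 2" using le by simp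
    then obtain C where C: "C \<in> \<A>" "C \<subseteq> X" "\<mu> C < Inf S / 2"
      using cInf_lessD[of S "Inf S / 2"] 0 by (auto simp: S_def)
    then show ?thesis using low le by (intro exI[of _ C]) (fastforce simp: max_def)
  qed
qed

text \<open>Keep removing a subset of nearly least measure. The removed pieces are disjoint, so
  their measures tend to 0, and by near-minimality no set of negative measure can remain. As each
  piece has measure at most 0, the removal does not lower the measure.\<close>

lemma exists_pos_subset:
  assumes A: "A \<in> \<A>"
  obtains B where "B \<subseteq> A" "pos_set B" "\<mu> A \<le> \<mu> B"
proof -
  obtain c where c: "\<And>X. X \<in> \<A> \<Longrightarrow> c X \<in> \<A>" "\<And>X. X \<in> \<A> \<Longrightarrow> c X \<subseteq> X" "\<And>X. X \<in> \<A> \<Longrightarrow> \<mu> (c X) \<le> 0"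
    "\<And>X D. X \<in> \<A> \<Longrightarrow> D \<in> \<A> \<Longrightarrow> D \<subseteq> X \<Longrightarrow> \<mu> (c X) \<le> max (\<mu> D / 2) (-1)"
    using nearly_minimal_subset by metis
  define X where "X = rec_nat A (\<lambda>_ Y. Y - c Y)"
  have X0: "X 0 = A" and XS: "X (Suc n) = X n - c (X n)" for n
    by (simp_all add: X_def)
  have XA: "X n \<in> \<A>" for n
    by (induction n) (use A c(1) in \<open>auto simp: X0 XS\<close>)
  have dec: "X n \<subseteq> X m" if "m \<le> n" for m n
    using that by (induction rule: dec_induct) (auto simp: XS)
  have disj: "c (X m) \<inter> c (X n) = {}" if "m < n" for m n
    using dec[of "Suc m" n] c(2)[OF XA] that by (fastforce simp: XS)
  have s: "(\<lambda>n. \<mu> (c (X n))) sums \<mu> (\<Union>n. c (X n))"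
  proof (intro sums_Union)
    show "disjoint_family (\<lambda>n. c (X n))"
      unfolding disjoint_family_on_def using disj by (metis inf_commute linorder_neqE_nat)
  qed (use c(1) XA in auto)
  have Un: "(\<Union>n. c (X n)) \<in> \<A>" "(\<Union>n. c (X n)) \<subseteq> A"
    using c(1) c(2)[OF XA] XA dec[of 0] by (fastforce simp: X0)+
  define B where "B = A - (\<Union>n. c (X n))"
  have BX: "B \<subseteq> X n" for n
    by (induction n) (auto simp: B_def X0 XS)
  show thesis
  proof
    show "B \<subseteq> A" by (auto simp: B_def)
    have "\<mu> (\<Union>n. c (X n)) \<le> 0"
      using sums_le[OF _ s sums_zero] c(3) XA by auto
    then show "\<mu> A \<le> \<mu> B"
      unfolding B_def using Diff[OF A Un] by simp
    have "0 \<le> \<mu> D" if D: "D \<in> \<A>" "D \<subseteq> B" for D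
    proof -
      have "(\<lambda>n. \<mu> (c (X n))) \<longlonglongrightarrow> 0" using s sums_summable summable_LIMSEQ_zero by blast
      moreover have "\<mu> (c (X n)) \<le> max (\<mu> D / 2) (-1)" for n
        using c(4)[OF XA D(1)] BX D(2) by blast
      ultimately have "0 \<le> max (\<mu> D / 2) (-1)" by (intro LIMSEQ_le_const2) auto
      then show ?thesis by (simp add: max_def split: if_splits)
    qed
    then show "pos_set B" using A Un by (auto simp: pos_set_def B_def)
  qed
qed

lemma pos_set_UN:
  assumes "\<And>n::nat. pos_set (B n)"
  shows "pos_set (\<Union>n. B n)"
  unfolding pos_set_def
proof (intro conjI ballI impI)
  show "(\<Union>n. B n) \<in> \<A>" using assms by (auto simp: pos_set_def)
  fix D assume D: "D \<in> \<A>" "D \<subseteq> (\<Union>n. B n)"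
  have dA: "disjointed B n \<in> \<A>" for n
    using sets.range_disjointed_sets[of B] assms by (auto simp: pos_set_def)
  have "(\<lambda>n. \<mu> (D \<inter> disjointed B n)) sums \<mu> (\<Union>n. D \<inter> disjointed B n)"
    using D dA disjoint_family_disjointed[of B]
    by (intro sums_Union) (fastforce simp: disjoint_family_on_def)+
  moreover have eq: "(\<Union>n. D \<inter> disjointed B n) = D" using D(2) UN_disjointed_eq[of B] by blast
  ultimately have s: "(\<lambda>n. \<mu> (D \<inter> disjointed B n)) sums \<mu> D" by (simp only: eq)
  have nn: "0 \<le> \<mu> (D \<inter> disjointed B n)" for n
    using assms[of n] disjointed_subset[of B n] D(1) dA[of n] unfolding pos_set_def
    by (metis inf.coboundedI2 sets.Int)
  show "0 \<le> \<mu> D" by (rule sums_le[OF nn sums_zero s])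
qed

lemma pos_set_mono: "pos_set P \<Longrightarrow> B \<in> \<A> \<Longrightarrow> B \<subseteq> P \<Longrightarrow> \<mu> B \<le> \<mu> P"
  using Diff[of P B] unfolding pos_set_def by (smt (verit) Diff_subset sets.Diff)

text \<open>The union of a sequence of positive sets is positive and has at least the measure of
  each member. Since \<mu> is real valued, such unions show both that the supremum is finite and
  that it is attained.\<close>

lemma maximal_pos_set: "\<exists>P. pos_set P \<and> (\<forall>B. pos_set B \<longrightarrow> \<mu> B \<le> \<mu> P)"
proof -
  define S where "S = \<mu> ` {B. pos_set B}"
  have e: "pos_set {}" by (auto simp: pos_set_def)
  have "bdd_above S"
  proof (rule ccontr)
    assume "\<not> bdd_above S"
    then have "\<exists>B. pos_set B \<and> \<mu> B \<ge> real n" for n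
      unfolding S_def bdd_above_def by (metis (mono_tags, lifting) imageE linorder_le_cases mem_Collect_eq)
    then obtain B where B: "\<And>n. pos_set (B n)" "\<And>n. \<mu> (B n) \<ge> real n" by metis
    have "real n \<le> \<mu> (\<Union>n. B n)" for n
      using pos_set_mono[OF pos_set_UN[of B, OF B(1)], of "B n"] B[of n] UN_upper[of n UNIV B] by (auto simp: pos_set_def simp del: UN_I)
    then show False using reals_Archimedean2 not_less by blast
  qed
  then have up: "\<mu> B \<le> Sup S" if "pos_set B" for B using that by (auto simp: S_def intro: cSup_upper)
  have "\<exists>B. pos_set B \<and> Sup S - 1 / real (Suc n) < \<mu> B" for n
    using less_cSupD[of S "Sup S - 1 / real (Suc n)"] e by (auto simp: S_def)
  then obtain B where B: "\<And>n. pos_set (B n)" "\<And>n. Sup S - 1 / real (Suc n) < \<mu> (B n)" by metis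
  have "Sup S - 1 / real (Suc n) \<le> \<mu> (\<Union>n. B n)" for n
    using pos_set_mono[OF pos_set_UN[of B, OF B(1)], of "B n"] B[of n] UN_upper[of n UNIV B] by (auto simp: pos_set_def simp del: UN_I)
  moreover have "(\<lambda>n. Sup S - 1 / real (Suc n)) \<longlonglongrightarrow> Sup S" by real_asymp
  ultimately have "Sup S \<le> \<mu> (\<Union>n. B n)" by (intro LIMSEQ_le_const2) auto
  then show ?thesis using pos_set_UN[of B, OF B(1)] up by (intro exI[of _ "\<Union>n. B n"]) fastforce
qed

text \<open>A set of positive measure outside a maximal \<open>P\<close> would contain a positive
  set of positive measure, and adding that to \<open>P\<close> would contradict maximality.\<close>

lemma Hahn_decomposition:
  obtains P where "P \<in> \<A>" "\<And>A. A \<in> \<A> \<Longrightarrow> 0 \<le> \<mu> (A \<inter> P)" "\<And>A. A \<in> \<A> \<Longrightarrow> \<mu> (A - P) \<le> 0"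
proof -
  obtain P where P: "pos_set P" "\<And>B. pos_set B \<Longrightarrow> \<mu> B \<le> \<mu> P" using maximal_pos_set by blast
  have PA: "P \<in> \<A>" using P(1) by (simp add: pos_set_def)
  have e: "pos_set {}" by (simp add: pos_set_def)
  show thesis
  proof
    show "0 \<le> \<mu> (A \<inter> P)" if "A \<in> \<A>" for A using P(1) that by (auto simp: pos_set_def)
    show "\<mu> (A - P) \<le> 0" if "A \<in> \<A>" for A
    proof -
      have "A - P \<in> \<A>" using that PA by auto
      then obtain B where B: "B \<subseteq> A - P" "pos_set B" "\<mu> (A - P) \<le> \<mu> B"
        by (rule exists_pos_subset)
      have "pos_set (\<Union>n. binaryset P B n)"
        by (rule pos_set_UN) (use P(1) B(2) e in \<open>simp add: binaryset_def\<close>)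
      then have "pos_set (P \<union> B)" by (simp only: UN_binaryset_eq)
      then have "\<mu> (P \<union> B) \<le> \<mu> P" by (rule P(2))
      moreover have "\<mu> (P \<union> B) = \<mu> P + \<mu> B"
        using B PA by (intro additive) (auto simp: pos_set_def)
      ultimately show ?thesis using B(3) by simp
    qed
  qed fact
qed

section \<open>Variation and the Jordan parts\<close>

definition hahn :: "'b set" where
  "hahn = (SOME P. P \<in> \<A> \<and> (\<forall>A\<in>\<A>. 0 \<le> \<mu> (A \<inter> P) \<and> \<mu> (A - P) \<le> 0))"

lemma hahn: "hahn \<in> \<A>" "A \<in> \<A> \<Longrightarrow> 0 \<le> \<mu> (A \<inter> hahn)" "A \<in> \<A> \<Longrightarrow> \<mu> (A - hahn) \<le> 0"
proof -
  have "\<exists>P. P \<in> \<A> \<and> (\<forall>A\<in>\<A>. 0 \<le> \<mu> (A \<inter> P) \<and> \<mu> (A - P) \<le> 0)"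
    using Hahn_decomposition by metis
  from someI_ex[OF this] show "hahn \<in> \<A>" "A \<in> \<A> \<Longrightarrow> 0 \<le> \<mu> (A \<inter> hahn)" "A \<in> \<A> \<Longrightarrow> \<mu> (A - hahn) \<le> 0"
    by (auto simp: hahn_def)
qed

lemma sum_partition:
  assumes "finite Q" "Q \<subseteq> \<A>" "disjoint Q" "E \<in> \<A>"
  shows "(\<Sum>B\<in>Q. \<mu> (B \<inter> E)) = \<mu> (\<Union>Q \<inter> E)"
  using assms(1-3)
proof (induction Q)
  case (insert X Q)
  have "\<mu> ((X \<inter> E) \<union> (\<Union>Q \<inter> E)) = \<mu> (X \<inter> E) + \<mu> (\<Union>Q \<inter> E)"
    using insert assms(4)
    by (intro additive) (auto simp: disjoint_def intro!: sets.Int sets.finite_Union)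
  moreover have "(X \<inter> E) \<union> (\<Union>Q \<inter> E) = \<Union>(insert X Q) \<inter> E" by auto
  ultimately show ?case using insert by (auto simp: disjoint_def)
qed simp

text \<open>For a cell \<open>B\<close> of any partition, |\<mu> B| is at most \<mu> of its part
  inside the Hahn set minus \<mu> of its part outside, and these bounds add up to the right-hand
  side. Cutting \<open>A\<close> along the Hahn set attains it.\<close>

lemma variation_eq:
  assumes A: "A \<in> \<A>"
  shows "variation K \<mu> A = \<mu> (A \<inter> hahn) - \<mu> (A - hahn)"
  unfolding variation_def
proof (rule cSup_eq_maximum)
  \<comment> \<open>\<open>partition_on\<close> excludes empty cells, so an empty half is dropped;
    it contributes 0 to the sum anyway.\<close>
  define Q where "Q = {A \<inter> hahn, A - hahn} - {{}}"
  have "partition_on A Q" by (rule partition_onI) (auto simp: Q_def disjnt_def)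
  moreover have "finite Q" "Q \<subseteq> \<A>" using A hahn(1) by (auto simp: Q_def)
  moreover have "(\<Sum>B\<in>Q. \<bar>\<mu> B\<bar>) = \<bar>\<mu> (A \<inter> hahn)\<bar> + \<bar>\<mu> (A - hahn)\<bar>"
  proof (cases "A \<inter> hahn = A - hahn")
    case True
    then have e: "A \<inter> hahn = {}" "A - hahn = {}" by auto
    show ?thesis unfolding Q_def e by simp
  next
    case False
    have "(\<Sum>B\<in>Q. \<bar>\<mu> B\<bar>) = (\<Sum>B\<in>{A \<inter> hahn, A - hahn}. \<bar>\<mu> B\<bar>)"
      unfolding Q_def by (rule sum.mono_neutral_left) auto
    then show ?thesis using False by simp
  qed
  ultimately show "\<mu> (A \<inter> hahn) - \<mu> (A - hahn)
      \<in> (\<lambda>P. \<Sum>B\<in>P. \<bar>\<mu> B\<bar>) ` {P. finite P \<and> P \<subseteq> \<A> \<and> partition_on A P}"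
    using hahn(2,3)[OF A] by (intro image_eqI[of _ _ Q]) auto
next
  fix x assume "x \<in> (\<lambda>P. \<Sum>B\<in>P. \<bar>\<mu> B\<bar>) ` {P. finite P \<and> P \<subseteq> \<A> \<and> partition_on A P}"
  then obtain Q where Q: "x = (\<Sum>B\<in>Q. \<bar>\<mu> B\<bar>)" "finite Q" "Q \<subseteq> \<A>" "partition_on A Q" by auto
  have K: "K \<in> \<A>" using sets.top[of "restrict_space borel K"] by (simp add: space_restrict_space)
  \<comment> \<open>The outside appears as \<open>K - hahn\<close> because
    \<open>sum_partition\<close> intersects the cells with a measurable set.\<close>
  have "x \<le> (\<Sum>B\<in>Q. \<mu> (B \<inter> hahn) - \<mu> (B \<inter> (K - hahn)))"
    unfolding Q(1)
  proof (rule sum_mono)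
    fix B assume "B \<in> Q"
    then have B: "B \<in> \<A>" using Q by auto
    then have "B \<inter> (K - hahn) = B - hahn" using sets.sets_into_space[OF B] by (auto simp: space_restrict_space)
    then show "\<bar>\<mu> B\<bar> \<le> \<mu> (B \<inter> hahn) - \<mu> (B \<inter> (K - hahn))"
      using split[OF B hahn(1)] hahn(2,3)[OF B] by auto
  qed
  also have "\<dots> = \<mu> (A \<inter> hahn) - \<mu> (A \<inter> (K - hahn))"
    using Q(4) sum_partition[OF Q(2,3), of hahn] sum_partition[OF Q(2,3), of "K - hahn"] hahn(1) K
    by (simp add: sum_subtractf partition_on_def)
  also have "A \<inter> (K - hahn) = A - hahn"
    using sets.sets_into_space[OF A] by (auto simp: space_restrict_space)
  finally show "x \<le> \<mu> (A \<inter> hahn) - \<mu> (A - hahn)" .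
qed

lemma K_in: "K \<in> \<A>"
  using sets.top[of "restrict_space borel K"] by (simp add: space_restrict_space)

text \<open>Serves both parts at once: \<open>s = 1\<close> with the Hahn set, and
  \<open>s = -1\<close> with its complement in \<open>K\<close>.\<close>

lemma Jordan_measure:
  assumes "\<And>A. A \<in> \<A> \<Longrightarrow> \<nu> A = s * \<mu> (A \<inter> E)" "\<And>A. A \<in> \<A> \<Longrightarrow> 0 \<le> \<nu> A" "E \<in> \<A>"
  defines "N \<equiv> measure_of K \<A> (\<lambda>A. ennreal (\<nu> A))"
  shows "sets N = \<A>" "space N = K" "A \<in> \<A> \<Longrightarrow> emeasure N A = ennreal (\<nu> A)"
proof -
  have sa: "sigma_algebra K \<A>"
    using sets.sigma_algebra_axioms[of "restrict_space borel K"] by (simp add: space_restrict_space)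
  have sub: "\<A> \<subseteq> Pow K" using sets.space_closed[of "restrict_space borel K"] by (simp add: space_restrict_space)
  show 1: "sets N = \<A>" "space N = K"
    unfolding N_def using sub sa by (simp_all add: sigma_algebra.sigma_sets_eq)
  show "emeasure N A = ennreal (\<nu> A)" if "A \<in> \<A>"
  proof (rule emeasure_measure_of[OF N_def[THEN meta_eq_to_obj_eq]])
    show "positive (sets N) (\<lambda>A. ennreal (\<nu> A))"
      using assms(1)[of "{}"] by (simp add: positive_def)
    show "countably_additive (sets N) (\<lambda>A. ennreal (\<nu> A))"
      unfolding countably_additive_def 1
    proof (intro allI impI)
      fix A :: "nat \<Rightarrow> 'b set" assume A: "range A \<subseteq> \<A>" "disjoint_family A" "\<Union> (range A) \<in> \<A>"
      have "(\<lambda>n. s * \<mu> (A n \<inter> E)) sums (s * \<mu> (\<Union>n. A n \<inter> E))"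
        using A assms(3) by (intro sums_mult sums_Union) (auto simp: disjoint_family_on_def)
      then have "(\<lambda>n. \<nu> (A n)) sums \<nu> (\<Union>n. A n)"
        using A assms(1) by (simp add: image_subset_iff)
      then have "(\<lambda>n. ennreal (\<nu> (A n))) sums ennreal (\<nu> (\<Union>n. A n))"
        using A assms(2) by (subst sums_ennreal) (auto simp: image_subset_iff)
      then show "(\<Sum>i. ennreal (\<nu> (A i))) = ennreal (\<nu> (\<Union> (range A)))"
        by (rule sums_unique[symmetric])
    qed
  qed (use that sub 1 in auto)
qed

lemma pos_part:
  shows sets_pos_part: "sets (pos_part K \<mu>) = \<A>" and space_pos_part: "space (pos_part K \<mu>) = K"
    and emeasure_pos_part: "A \<in> \<A> \<Longrightarrow> emeasure (pos_part K \<mu>) A = ennreal (\<mu> (A \<inter> hahn))"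
proof -
  have "(variation K \<mu> A + \<mu> A) / 2 = \<mu> (A \<inter> hahn)" if "A \<in> \<A>" for A
    using variation_eq[OF that] split[OF that hahn(1)] by simp
  then show "sets (pos_part K \<mu>) = \<A>" "space (pos_part K \<mu>) = K"
    "A \<in> \<A> \<Longrightarrow> emeasure (pos_part K \<mu>) A = ennreal (\<mu> (A \<inter> hahn))"
    unfolding pos_part_def using hahn
      Jordan_measure[where \<nu> = "\<lambda>A. (variation K \<mu> A + \<mu> A) / 2" and s = 1 and E = hahn] by auto
qed

lemma neg_part:
  shows sets_neg_part: "sets (neg_part K \<mu>) = \<A>" and space_neg_part: "space (neg_part K \<mu>) = K"
    and emeasure_neg_part: "A \<in> \<A> \<Longrightarrow> emeasure (neg_part K \<mu>) A = ennreal (- \<mu> (A - hahn))"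
proof -
  have 1: "(variation K \<mu> A - \<mu> A) / 2 = - \<mu> (A - hahn)" if "A \<in> \<A>" for A
    using variation_eq[OF that] split[OF that hahn(1)] by simp
  have 2: "A - hahn = A \<inter> (K - hahn)" if "A \<in> \<A>" for A
    using sets.sets_into_space[OF that] by (auto simp: space_restrict_space)
  have a: "(variation K \<mu> A - \<mu> A) / 2 = -1 * \<mu> (A \<inter> (K - hahn))" if "A \<in> \<A>" for A
    unfolding 1[OF that] 2[OF that] by simp
  have b: "0 \<le> (variation K \<mu> A - \<mu> A) / 2" if "A \<in> \<A>" for A
    unfolding 1[OF that] using hahn(3)[OF that] by simp
  have c: "K - hahn \<in> \<A>" using hahn(1) K_in by auto
  note J = Jordan_measure[where \<nu> = "\<lambda>A. (variation K \<mu> A - \<mu> A) / 2", OF a b c]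
  show "sets (neg_part K \<mu>) = \<A>" "space (neg_part K \<mu>) = K"
    unfolding neg_part_def by (rule J; assumption)+
  show "emeasure (neg_part K \<mu>) A = ennreal (- \<mu> (A - hahn))" if "A \<in> \<A>"
    unfolding neg_part_def 1[OF that, symmetric] by (rule J) (assumption | rule that)+
qed

lemma finite_pos_part: "finite_measure (pos_part K \<mu>)"
  by (rule finite_measureI) (simp add: space_pos_part emeasure_pos_part K_in)

lemma finite_neg_part: "finite_measure (neg_part K \<mu>)"
  by (rule finite_measureI) (simp add: space_neg_part emeasure_neg_part K_in)

lemma measure_pos_part: "A \<in> \<A> \<Longrightarrow> measure (pos_part K \<mu>) A = \<mu> (A \<inter> hahn)"
  and measure_neg_part: "A \<in> \<A> \<Longrightarrow> measure (neg_part K \<mu>) A = - \<mu> (A - hahn)"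
  using hahn(2,3) by (simp_all add: measure_def emeasure_pos_part emeasure_neg_part)

lemma Jordan_decomposition: "A \<in> \<A> \<Longrightarrow> \<mu> A = measure (pos_part K \<mu>) A - measure (neg_part K \<mu>) A"
  using split[of A hahn] hahn(1) by (simp add: measure_pos_part measure_neg_part)

lemma TV_norm_eq: "TV_norm K \<mu> = measure (pos_part K \<mu>) K + measure (neg_part K \<mu>) K"
  by (simp add: TV_norm_def variation_eq K_in measure_pos_part measure_neg_part)

lemma TV_norm_attained: "TV_norm K \<mu> = \<mu> (K \<inter> hahn) - \<mu> (K - hahn)"
  by (simp add: TV_norm_def variation_eq K_in)

text \<open>Together with \<open>TV_norm_attained\<close> this presents the norm as a maximum of
  expressions linear in \<mu>, from which convexity is immediate.\<close>

lemma TV_norm_ge: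
  assumes "A \<in> \<A>"
  shows "\<mu> (K \<inter> A) - \<mu> (K - A) \<le> TV_norm K \<mu>"
proof -
  interpret P: finite_measure "pos_part K \<mu>" by (rule finite_pos_part)
  interpret N: finite_measure "neg_part K \<mu>" by (rule finite_neg_part)
  have "K - A \<in> \<A>" "K \<inter> A \<in> \<A>" using assms K_in by auto
  moreover have "measure (pos_part K \<mu>) (K \<inter> A) \<le> measure (pos_part K \<mu>) K"
    "measure (neg_part K \<mu>) (K - A) \<le> measure (neg_part K \<mu>) K"
    by (intro P.finite_measure_mono N.finite_measure_mono; simp add: sets_pos_part sets_neg_part K_in)+
  ultimately show ?thesis
    using measure_nonneg[of "pos_part K \<mu>" "K - A"] measure_nonneg[of "neg_part K \<mu>" "K \<inter> A"]
    by (simp only: TV_norm_eq Jordan_decomposition)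
qed

lemma TV_norm_nonneg: "0 \<le> TV_norm K \<mu>"
  by (simp add: TV_norm_eq)

end

section \<open>Linearity in the measure\<close>

lemma signed_measures_midpoint:
  assumes "\<mu> \<in> signed_measures K" "\<nu> \<in> signed_measures K"
  shows "(\<lambda>A. (\<mu> A + \<nu> A) / 2) \<in> signed_measures K"
  using assms by (auto simp: signed_measures_def intro!: sums_divide sums_add)

lemma TV_norm_midpoint:
  assumes \<mu>: "\<mu> \<in> signed_measures K" and \<nu>: "\<nu> \<in> signed_measures K"
  shows "TV_norm K (\<lambda>A. (\<mu> A + \<nu> A) / 2) \<le> (TV_norm K \<mu> + TV_norm K \<nu>) / 2"
proof -
  interpret M: signed_measure K \<mu> using \<mu> by unfold_locales
  interpret N: signed_measure K \<nu> using \<nu> by unfold_locales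
  interpret S: signed_measure K "\<lambda>A. (\<mu> A + \<nu> A) / 2"
    using signed_measures_midpoint[OF assms] by unfold_locales
  show ?thesis
    using M.TV_norm_ge[OF S.hahn(1)] N.TV_norm_ge[OF S.hahn(1)] S.TV_norm_attained
    by (simp add: field_simps)
qed

text \<open>The two measures need not be mutually singular. Common mass cancels, so their total is
  only an upper bound for the norm.\<close>

lemma signed_measures_diff_measure:
  assumes M: "finite_measure M" "sets M = borel_subsets K" and N: "finite_measure N" "sets N = borel_subsets K"
  shows "(\<lambda>A. measure M A - measure N A) \<in> signed_measures K"
    and "TV_norm K (\<lambda>A. measure M A - measure N A) \<le> measure M K + measure N K"
proof -
  interpret M: finite_measure M by fact
  interpret N: finite_measure N by fact
  show *: "(\<lambda>A. measure M A - measure N A) \<in> signed_measures K"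
    unfolding signed_measures_def using M(2) N(2)
    by (auto simp: measure_notin_sets intro!: sums_diff M.finite_measure_UNION N.finite_measure_UNION)
  then interpret S: signed_measure K "\<lambda>A. measure M A - measure N A"
    by unfold_locales
  have "measure M (K \<inter> S.hahn) \<le> measure M K" "measure N (K - S.hahn) \<le> measure N K"
    using S.K_in by (intro M.finite_measure_mono N.finite_measure_mono; simp add: M(2) N(2))+
  then show "TV_norm K (\<lambda>A. measure M A - measure N A) \<le> measure M K + measure N K"
    using measure_nonneg[of N "K \<inter> S.hahn"] measure_nonneg[of M "K - S.hahn"]
    unfolding S.TV_norm_attained by linarith
qed

text \<open>\<open>signed_integral\<close> goes through the Jordan decomposition, which is not
  additive in the signed measure. A linear relation between finite measures on sets, however, passes
  to integrals by the usual induction from indicators, and a list of weighted measures covers every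
  relation needed.\<close>

lemma integral_linear_relation:
  fixes h :: "'b \<Rightarrow> real" and L :: "(real \<times> 'b measure) list"
  assumes L: "\<And>c N. (c, N) \<in> set L \<Longrightarrow> finite_measure N \<and> sets N = sets M"
    and rel: "\<And>A. A \<in> sets M \<Longrightarrow> (\<Sum>(c, N)\<leftarrow>L. c * measure N A) = 0"
    and h: "h \<in> borel_measurable M" "\<And>x. 0 \<le> h x" "\<And>x. x \<in> space M \<Longrightarrow> h x \<le> B"
  shows "(\<Sum>(c, N)\<leftarrow>L. c * integral\<^sup>L N h) = 0"
proof -
  have sp: "space N = space M" if "(c, N) \<in> set L" for c N
    using L[OF that] sets_eq_imp_space_eq by blast
  have meas: "f \<in> borel_measurable N" if "(c, N) \<in> set L" "f \<in> borel_measurable M" for c N and f :: "'b \<Rightarrow> real"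
    using L[OF that(1)] that(2) measurable_cong_sets by blast
  have int: "integrable N f" if "(c, N) \<in> set L" "f \<in> borel_measurable M" "\<And>x. 0 \<le> f x"
    "\<And>x. x \<in> space M \<Longrightarrow> f x \<le> B" for c N and f :: "'b \<Rightarrow> real" and B
  proof -
    interpret finite_measure N using L[OF that(1)] by simp
    show ?thesis
    proof (rule integrable_const_bound[where B = B])
      show "AE x in N. norm (f x) \<le> B"
        using that(3,4) by (intro AE_I2) (simp add: sp[OF that(1)])
    qed (rule meas[OF that(1,2)])
  qed
  have congL: "(\<Sum>(c, N)\<leftarrow>L. F c N) = (\<Sum>(c, N)\<leftarrow>L. G c N)"
    if "\<And>c N. (c, N) \<in> set L \<Longrightarrow> F c N = G c N" for F G :: "real \<Rightarrow> 'b measure \<Rightarrow> real"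
    using that by (intro arg_cong[of _ _ sum_list] map_cong) auto
  \<comment> \<open>The bound is quantified inside the induction, because scaling changes
    it.\<close>
  have "\<forall>B. (\<forall>x\<in>space M. h x \<le> B) \<longrightarrow> (\<Sum>(c, N)\<leftarrow>L. c * integral\<^sup>L N h) = 0"
    using h(1,2)
  proof (induction h rule: borel_measurable_induct_real)
    case (set A)
    have "(\<Sum>(c, N)\<leftarrow>L. c * integral\<^sup>L N (indicator A)) = (\<Sum>(c, N)\<leftarrow>L. c * measure N A)"
    proof (rule congL)
      fix c N assume cN: "(c, N) \<in> set L"
      have "A \<subseteq> space N" using sets.sets_into_space[OF set] sp[OF cN] by simp
      then show "c * integral\<^sup>L N (indicator A) = c * measure N A"
        by (simp add: Int_absorb2)
    qed
    then show ?case using rel[OF set] by simp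
  next
    case (mult u c)
    show ?case
    proof (intro allI impI)
      fix B assume B: "\<forall>x\<in>space M. c * u x \<le> B"
      show "(\<Sum>(d, N)\<leftarrow>L. d * integral\<^sup>L N (\<lambda>x. c * u x)) = 0"
      proof (cases "c = 0")
        case False
        then have "\<forall>x\<in>space M. u x \<le> B / c" using B mult(1) by (auto simp: field_simps)
        then have "(\<Sum>(d, N)\<leftarrow>L. d * integral\<^sup>L N u) = 0" using mult by blast
        moreover have "(\<Sum>(d, N)\<leftarrow>L. d * integral\<^sup>L N (\<lambda>x. c * u x)) = c * (\<Sum>(d, N)\<leftarrow>L. d * integral\<^sup>L N u)"
          by (simp add: sum_list_const_mult[symmetric] case_prod_beta' mult.left_commute)
        ultimately show ?thesis by simp
      qed (simp add: case_prod_beta')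
    qed
  next
    case (add u v)
    show ?case
    proof (intro allI impI)
      fix B assume B: "\<forall>x\<in>space M. v x + u x \<le> B"
      then have b: "\<forall>x\<in>space M. u x \<le> B" "\<forall>x\<in>space M. v x \<le> B" using add
        by (metis add_increasing add_increasing2 order_refl order_trans)+
      have "(\<Sum>(d, N)\<leftarrow>L. d * integral\<^sup>L N (\<lambda>x. v x + u x))
        = (\<Sum>(d, N)\<leftarrow>L. d * integral\<^sup>L N v + d * integral\<^sup>L N u)"
      proof (rule congL)
        fix c N assume cN: "(c, N) \<in> set L"
        have "integrable N u" "integrable N v" using add b by (auto intro!: int[OF cN, where B = B])
        then show "c * integral\<^sup>L N (\<lambda>x. v x + u x) = c * integral\<^sup>L N v + c * integral\<^sup>L N u"
          by (simp add: algebra_simps)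
      qed
      also have "\<dots> = (\<Sum>(d, N)\<leftarrow>L. d * integral\<^sup>L N v) + (\<Sum>(d, N)\<leftarrow>L. d * integral\<^sup>L N u)"
        by (simp add: sum_list_addf case_prod_beta')
      also have "\<dots> = 0" using add b by auto
      finally show "(\<Sum>(d, N)\<leftarrow>L. d * integral\<^sup>L N (\<lambda>x. v x + u x)) = 0" .
    qed
  next
    case (seq U)
    show ?case
    proof (intro allI impI)
      fix B assume B: "\<forall>x\<in>space M. h x \<le> B"
      have Ub: "U i x \<le> B" if "x \<in> space M" for i x
      proof -
        have "incseq (\<lambda>i. U i x)" using seq.hyps(3) by (auto simp: incseq_def le_fun_def)
        then have "U i x \<le> h x" by (rule incseq_le[OF _ seq.hyps(4)[OF that]])
        then show ?thesis using B that by force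
      qed
      have *: "(\<lambda>i. c * integral\<^sup>L N (U i)) \<longlonglongrightarrow> c * integral\<^sup>L N h" if cN: "(c, N) \<in> set L" for c N
      proof (intro tendsto_mult_left integral_dominated_convergence[where w = "\<lambda>_. B"])
        interpret finite_measure N using L[OF cN] by simp
        show "integrable N (\<lambda>_. B)" by simp
        show "h \<in> borel_measurable N" "\<And>i. U i \<in> borel_measurable N"
          by (intro meas[OF cN] h(1) seq.hyps(1))+
        show "AE x in N. (\<lambda>i. U i x) \<longlonglongrightarrow> h x" by (intro AE_I2) (simp add: sp[OF cN] seq.hyps(4))
        show "AE x in N. norm (U i x) \<le> B" for i by (intro AE_I2) (simp add: sp[OF cN] seq.hyps(2) Ub)
      qed
      have lim: "(\<lambda>i. \<Sum>(c, N)\<leftarrow>L'. c * integral\<^sup>L N (U i)) \<longlonglongrightarrow> (\<Sum>(c, N)\<leftarrow>L'. c * integral\<^sup>L N h)"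
        if "set L' \<subseteq> set L" for L' :: "(real \<times> 'b measure) list"
        using that
      proof (induction L')
        case (Cons a L')
        then show ?case using *[of "fst a" "snd a"] by (auto simp: case_prod_beta' intro!: tendsto_add)
      qed simp
      have "(\<Sum>(c, N)\<leftarrow>L. c * integral\<^sup>L N (U i)) = 0" for i
        using seq.IH[of i] Ub by blast
      then show "(\<Sum>(c, N)\<leftarrow>L. c * integral\<^sup>L N h) = 0"
        using lim[OF order_refl] by (simp add: LIMSEQ_const_iff)
    qed
  qed
  then show ?thesis using h(3) by blast
qed

text \<open>\<open>M\<close> and \<open>N\<close> need not be the Jordan parts of their difference,
  but the four measures satisfy one linear relation on sets.\<close>

lemma signed_integral_diff_measure:
  assumes M: "finite_measure M" "sets M = borel_subsets K" and N: "finite_measure N" "sets N = borel_subsets K"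
    and h: "h \<in> borel_measurable (restrict_space borel K)" "\<And>x. 0 \<le> h x" "\<And>x. x \<in> K \<Longrightarrow> h x \<le> B"
  shows "signed_integral K (\<lambda>A. measure M A - measure N A) h = integral\<^sup>L M h - integral\<^sup>L N h"
proof -
  let ?\<mu> = "\<lambda>A. measure M A - measure N A"
  interpret S: signed_measure K ?\<mu>
    using signed_measures_diff_measure(1)[OF M N] by unfold_locales
  have "(\<Sum>(c, N)\<leftarrow>[(1, pos_part K ?\<mu>), (-1, neg_part K ?\<mu>), (-1, M), (1, N)]. c * integral\<^sup>L N h) = 0"
  proof (rule integral_linear_relation[where M = "restrict_space borel K" and B = B])
    fix A assume A: "A \<in> borel_subsets K"
    then show "(\<Sum>(c, N)\<leftarrow>[(1, pos_part K ?\<mu>), (-1, neg_part K ?\<mu>), (-1, M), (1, N)]. c * measure N A) = 0"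
      using S.Jordan_decomposition[OF A] by simp
  qed (use assms S.finite_pos_part S.finite_neg_part S.sets_pos_part S.sets_neg_part in
        \<open>auto simp: space_restrict_space\<close>)
  then show ?thesis by (simp add: signed_integral_def)
qed

lemma signed_integral_midpoint:
  assumes \<mu>: "\<mu> \<in> signed_measures K" and \<nu>: "\<nu> \<in> signed_measures K"
    and h: "h \<in> borel_measurable (restrict_space borel K)" "\<And>x. 0 \<le> h x" "\<And>x. x \<in> K \<Longrightarrow> h x \<le> B"
  shows "signed_integral K (\<lambda>A. (\<mu> A + \<nu> A) / 2) h = (signed_integral K \<mu> h + signed_integral K \<nu> h) / 2"
proof -
  let ?\<sigma> = "\<lambda>A. (\<mu> A + \<nu> A) / 2"
  interpret M: signed_measure K \<mu> using \<mu> by unfold_locales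
  interpret N: signed_measure K \<nu> using \<nu> by unfold_locales
  interpret S: signed_measure K ?\<sigma>
    using signed_measures_midpoint[OF assms(1,2)] by unfold_locales
  \<comment> \<open>The relation for the midpoint, multiplied by 2 to clear the denominator.\<close>
  let ?L = "[(2, pos_part K ?\<sigma>), (-2, neg_part K ?\<sigma>), (-1, pos_part K \<mu>), (1, neg_part K \<mu>),
    (-1, pos_part K \<nu>), (1, neg_part K \<nu>)]"
  have "(\<Sum>(c, N)\<leftarrow>?L. c * integral\<^sup>L N h) = 0"
  proof (rule integral_linear_relation[where M = "restrict_space borel K" and B = B])
    fix A assume A: "A \<in> borel_subsets K"
    show "(\<Sum>(c, N)\<leftarrow>?L. c * measure N A) = 0"
      using S.Jordan_decomposition[OF A] M.Jordan_decomposition[OF A] N.Jordan_decomposition[OF A]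
      by simp
  qed (use h S.finite_pos_part S.finite_neg_part S.sets_pos_part S.sets_neg_part
       M.finite_pos_part M.finite_neg_part M.sets_pos_part M.sets_neg_part
       N.finite_pos_part N.finite_neg_part N.sets_pos_part N.sets_neg_part in
        \<open>auto simp: space_restrict_space\<close>)
  then show ?thesis by (simp add: signed_integral_def field_simps)
qed

section \<open>Weak-star sequential compactness\<close>

lemma binary_expansion:
  fixes y :: real
  assumes "0 \<le> y" "y < 1"
  obtains d :: "nat \<Rightarrow> real" where "\<And>k. d k = 0 \<or> d k = 1" "(\<lambda>k. d k / 2 ^ Suc k) sums y"
proof
  \<comment> \<open>Each digit is a difference of successive floors, so the partial sums telescope
    to \<open>\<lfloor>2 ^ n * y\<rfloor> / 2 ^ n\<close>.\<close>
  define d where "d k = real_of_int (\<lfloor>2 ^ Suc k * y\<rfloor> - 2 * \<lfloor>2 ^ k * y\<rfloor>)" for k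
  show "d k = 0 \<or> d k = 1" for k
  proof -
    have "\<lfloor>2 ^ Suc k * y\<rfloor> - 2 * \<lfloor>2 ^ k * y\<rfloor> = 0 \<or> \<lfloor>2 ^ Suc k * y\<rfloor> - 2 * \<lfloor>2 ^ k * y\<rfloor> = 1"
      unfolding power_Suc mult.assoc by linarith
    then show ?thesis unfolding d_def by (metis of_int_0 of_int_1)
  qed
  have part: "(\<Sum>k<n. d k / 2 ^ Suc k) = real_of_int \<lfloor>2 ^ n * y\<rfloor> / 2 ^ n" for n
  proof (induction n)
    case 0
    have "\<lfloor>y\<rfloor> = 0" using assms by linarith
    then show ?case by simp
  next
    case (Suc n)
    have *: "A / 2 ^ n + (B - 2 * A) / 2 ^ Suc n = B / 2 ^ Suc n" for A B :: real
      by (simp add: field_simps)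
    show ?case unfolding sum.lessThan_Suc Suc.IH unfolding d_def of_int_diff of_int_mult of_int_numeral by (rule *)
  qed
  have "(\<lambda>n. real_of_int \<lfloor>2 ^ n * y\<rfloor> / 2 ^ n) \<longlonglongrightarrow> y"
  proof (rule tendsto_sandwich[OF _ _ _ tendsto_const])
    have "y - (1 / 2) ^ n \<le> real_of_int \<lfloor>2 ^ n * y\<rfloor> / 2 ^ n" for n
    proof -
      have "2 ^ n * y - 1 \<le> real_of_int \<lfloor>2 ^ n * y\<rfloor>" by linarith
      moreover have "y - (1 / 2) ^ n \<le> A / 2 ^ n" if "2 ^ n * y - 1 \<le> A" for A
        using divide_right_mono[OF that, of "2 ^ n"] by (simp add: diff_divide_distrib power_one_over)
      ultimately show ?thesis by blast
    qed
    then show "\<forall>\<^sub>F n in sequentially. y - (1 / 2) ^ n \<le> real_of_int \<lfloor>2 ^ n * y\<rfloor> / 2 ^ n"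
      by simp
    have "real_of_int \<lfloor>2 ^ n * y\<rfloor> / 2 ^ n \<le> y" for n
      using of_int_floor_le[of "2 ^ n * y"] by (subst pos_divide_le_eq) (auto simp: mult.commute)
    then show "\<forall>\<^sub>F n in sequentially. real_of_int \<lfloor>2 ^ n * y\<rfloor> / 2 ^ n \<le> y" by simp
    have "(\<lambda>n. y - (1 / 2) ^ n) \<longlonglongrightarrow> y - 0"
      by (intro tendsto_intros LIMSEQ_power_zero) auto
    then show "(\<lambda>n. y - (1 / 2) ^ n) \<longlonglongrightarrow> y" by simp
  qed
  then show "(\<lambda>k. d k / 2 ^ Suc k) sums y"
    unfolding sums_def part .
qed

text \<open>The construction is Schoenberg's: a continuous \<open>2\<close>-periodic function that is \<open>0\<close> on
  \<open>[0, 1/3]\<close> and \<open>1\<close> on \<open>[2/3, 1]\<close> reads off the ternary digits of \<open>t\<close> (all of them \<open>0\<close> or \<open>2\<close>)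
  from the multiples \<open>3\<^sup>k t\<close>.\<close>

definition digit_wave :: "real \<Rightarrow> real" where
  "digit_wave t = max 0 (min 1 (1 / 2 - cos (pi * t)))"

lemma digit_wave_bounds: "0 \<le> digit_wave t" "digit_wave t \<le> 1"
  by (auto simp: digit_wave_def)

lemma continuous_digit_wave: "continuous_on UNIV digit_wave"
  unfolding digit_wave_def by (intro continuous_intros)

lemma digit_wave_periodic: "digit_wave (2 * real n + s) = digit_wave s"
proof -
  have "cos (pi * (2 * real n + s)) = cos (pi * s)"
  proof (induction n)
    case (Suc n)
    have "pi * (2 * real (Suc n) + s) = pi * (2 * real n + s) + 2 * pi" by (simp add: algebra_simps)
    then show ?case using Suc by (metis cos_periodic)
  qed simp
  then show ?thesis by (simp add: digit_wave_def)
qed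

lemma digit_wave_low: "0 \<le> s \<Longrightarrow> s \<le> 1 / 3 \<Longrightarrow> digit_wave s = 0"
proof -
  assume s: "0 \<le> s" "s \<le> 1 / 3"
  have "cos (pi * s) \<ge> cos (pi / 3)"
    using s mult_left_mono[of s "1 / 3" pi] mult_left_mono[of s 1 pi] by (intro cos_monotone_0_pi_le) auto
  then show ?thesis by (simp add: digit_wave_def cos_60)
qed

lemma digit_wave_high: "2 / 3 \<le> s \<Longrightarrow> s \<le> 1 \<Longrightarrow> digit_wave s = 1"
proof -
  assume s: "2 / 3 \<le> s" "s \<le> 1"
  have "cos (pi * s) \<le> cos (pi * (2 / 3))"
    using s mult_left_mono[of "2 / 3" s pi] mult_left_mono[of s 1 pi] by (intro cos_monotone_0_pi_le) auto
  also have "cos (pi * (2 / 3)) = - 1 / 2"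
    using cos_120 by (simp add: mult.commute)
  finally show ?thesis by (simp add: digit_wave_def)
qed

text \<open>Take the number with ternary digits 2 a_k. Multiplication by 3^m leaves an even integer,
  invisible to the 2-periodic wave, plus the tail \<open>T m\<close>, which lies in the lower or
  upper third of [0, 1] according to its first digit.\<close>

lemma ternary_digits:
  fixes a :: "nat \<Rightarrow> real"
  assumes a: "\<And>k. a k = 0 \<or> a k = 1"
  obtains t where "0 \<le> t" "t \<le> 1" "\<And>k. digit_wave (3 ^ k * t) = a k"
proof -
  define T where "T m = (\<Sum>j. 2 * a (m + j) / 3 ^ Suc j)" for m
  have g: "(\<lambda>j. 2 * (1 / 3) * (1 / 3 :: real) ^ j) sums (2 * (1 / 3) * (1 / (1 - 1 / 3)))"
    by (intro sums_mult geometric_sums) auto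
  have le: "2 * a (m + j) / 3 ^ Suc j \<le> 2 * (1 / 3) * (1 / 3) ^ j" and ge: "0 \<le> 2 * a (m + j) / 3 ^ Suc j" for m j
    using a[of "m + j"] by (auto simp: field_simps)
  have sm: "summable (\<lambda>j. 2 * a (m + j) / 3 ^ Suc j)" for m
    by (rule summable_comparison_test'[OF sums_summable[OF g], of 0])
      (simp only: real_norm_def abs_of_nonneg[OF ge] le)
  have T01: "0 \<le> T m" "T m \<le> 1" for m
    unfolding T_def using suminf_nonneg[OF sm ge] suminf_le[OF le sm sums_summable[OF g]] sums_unique[OF g] by auto
  have rec: "3 * T m = 2 * a m + T (Suc m)" for m
  proof -
    have "T m = 2 * a (m + 0) / 3 ^ Suc 0 + (\<Sum>j. 2 * a (m + Suc j) / 3 ^ Suc (Suc j))"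
      unfolding T_def using suminf_split_head[OF sm[of m]] by simp
    also have "(\<Sum>j. 2 * a (m + Suc j) / 3 ^ Suc (Suc j)) = (\<Sum>j. (1 / 3) * (2 * a (Suc m + j) / 3 ^ Suc j))"
      by (intro suminf_cong) simp
    also have "\<dots> = (1 / 3) * T (Suc m)"
      unfolding T_def by (rule suminf_mult[OF sm])
    finally show ?thesis by simp
  qed
  have "\<exists>N. 3 ^ m * T 0 = 2 * real N + T m" for m
  proof (induction m)
    case (Suc m)
    then obtain N where "3 ^ m * T 0 = 2 * real N + T m" by blast
    then have "3 ^ Suc m * T 0 = 6 * real N + 2 * a m + T (Suc m)" using rec[of m] by simp
    moreover have "2 * real (3 * N + nat \<lfloor>a m\<rfloor>) = 6 * real N + 2 * a m" using a[of m] by auto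
    ultimately show ?case by metis
  qed (auto intro: exI[of _ 0])
  then have w: "digit_wave (3 ^ m * T 0) = digit_wave (T m)" for m
    by (metis digit_wave_periodic)
  have "digit_wave (T m) = a m" for m
  proof (cases "a m = 0")
    case True
    then show ?thesis using rec[of m] T01[of "Suc m"] T01[of m] by (simp add: digit_wave_low)
  next
    case False
    then have "a m = 1" using a by blast
    then show ?thesis using rec[of m] T01[of "Suc m"] T01[of m] by (simp add: digit_wave_high)
  qed
  then show thesis using that[of "T 0"] T01 w by simp
qed

text \<open>The coordinates read interleaved digit sequences: \<open>c j\<close> uses the digits at
  the positions n k + j as binary digits. As all digits can be prescribed at once, every point of
  the half-open cube [-r, r)^n is reached.\<close>

lemma continuous_surjection_onto_compact:
  fixes K :: "'b::euclidean_space set"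
  assumes "compact K"
  obtains q :: "real \<Rightarrow> 'b" where "continuous_on UNIV q" "K \<subseteq> q ` {0..1}"
proof -
  \<comment> \<open>The strict bound keeps the normalised coordinates below 1, as
    \<open>binary_expansion\<close> requires.\<close>
  obtain r where r: "r > 0" "\<And>x. x \<in> K \<Longrightarrow> norm x < r"
    using compact_imp_bounded[OF assms] by (metis bounded_pos_less)
  define n where "n = card (Basis :: 'b set)"
  have n0: "n > 0" by (simp add: n_def)
  obtain idx where idx: "bij_betw idx (Basis :: 'b set) {0..<n}"
    unfolding n_def using ex_bij_betw_finite_nat[OF finite_Basis] by blast
  define c where "c j t = (\<Sum>k. digit_wave (3 ^ (n * k + j) * t) / 2 ^ Suc k)" for j t
  have ccont: "continuous_on UNIV (c j)" for j
  proof -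
    have "uniform_limit UNIV (\<lambda>m t. \<Sum>k<m. digit_wave (3 ^ (n * k + j) * t) / 2 ^ Suc k) (c j) sequentially"
      unfolding c_def
    proof (rule Weierstrass_m_test)
      show "norm (digit_wave (3 ^ (n * k + j) * t) / 2 ^ Suc k) \<le> (1 / 2) ^ k" for k t
        using digit_wave_bounds[of "3 ^ (n * k + j) * t"] by (simp add: field_simps)
      show "summable (\<lambda>k. (1 / 2 :: real) ^ k)" by (rule summable_geometric) simp
    qed
    then show ?thesis
    proof (rule uniform_limit_theorem[rotated])
      show "\<forall>\<^sub>F m in sequentially. continuous_on UNIV (\<lambda>t. \<Sum>k<m. digit_wave (3 ^ (n * k + j) * t) / 2 ^ Suc k)"
        by (intro always_eventually allI continuous_intros continuous_on_compose2[OF continuous_digit_wave]) auto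
    qed simp
  qed
  define q where "q t = (\<Sum>i\<in>Basis. (2 * r * c (idx i) t - r) *\<^sub>R i)" for t
  show thesis
  proof
    show "continuous_on UNIV q"
      unfolding q_def by (intro continuous_intros ccont)
    show "K \<subseteq> q ` {0..1}"
    proof
      fix x assume x: "x \<in> K"
      define y where "y i = (x \<bullet> i + r) / (2 * r)" for i
      have y: "0 \<le> y i" "y i < 1" if "i \<in> Basis" for i
        using r Basis_le_norm[OF that, of x] r(2)[OF x] by (auto simp: y_def field_simps abs_le_iff)
      have "\<exists>d. (\<forall>k. d k = 0 \<or> d k = (1::real)) \<and> (\<lambda>k. d k / 2 ^ Suc k) sums y i" if "i \<in> Basis" for i
        using binary_expansion[OF y[OF that]] by metis
      then obtain d where d: "\<And>i k. i \<in> Basis \<Longrightarrow> d i k = 0 \<or> d i k = (1::real)"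
        "\<And>i. i \<in> Basis \<Longrightarrow> (\<lambda>k. d i k / 2 ^ Suc k) sums y i"
        by metis
      \<comment> \<open>Interleaving: position \<open>m\<close> carries digit \<open>m div n\<close>
        of the coordinate numbered \<open>m mod n\<close>.\<close>
      define a where "a m = d (inv_into Basis idx (m mod n)) (m div n)" for m
      have "inv_into Basis idx (m mod n) \<in> Basis" for m
        using idx n0 by (intro inv_into_into) (auto simp: bij_betw_def)
      then have "a m = 0 \<or> a m = 1" for m
        unfolding a_def using d(1) by blast
      then obtain t where t: "0 \<le> t" "t \<le> 1" "\<And>k. digit_wave (3 ^ k * t) = a k"
        using ternary_digits by blast
      have ct: "c (idx i) t = y i" if i: "i \<in> Basis" for i
      proof -
        have lt: "idx i < n" using idx i by (auto simp: bij_betw_def)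
        have "inv_into Basis idx (idx i) = i" using idx i by (simp add: bij_betw_def)
        then have "a (n * k + idx i) = d i k" for k
          using lt by (simp add: a_def)
        then show ?thesis
          unfolding c_def t(3) using sums_unique[OF d(2)[OF i]] by simp
      qed
      have "q t = (\<Sum>i\<in>Basis. (x \<bullet> i) *\<^sub>R i)"
        unfolding q_def using r(1) by (intro sum.cong) (auto simp: ct y_def)
      then have "q t = x" by (simp add: euclidean_representation)
      then show "x \<in> q ` {0..1}" using t by auto
    qed
  qed
qed

text \<open>Take the least preimage in [0, 1]. Its sublevel sets are images of compact intervals,
  cut with \<open>K\<close>, hence closed.\<close>

lemma borel_section:
  fixes q :: "real \<Rightarrow> 'b::euclidean_space"
  assumes K: "compact K" and q: "continuous_on UNIV q" "K \<subseteq> q ` {0..1}"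
  obtains s where "s \<in> borel_measurable (restrict_space borel K)" "\<And>k. k \<in> K \<Longrightarrow> s k \<in> {0..1}"
    "\<And>k. k \<in> K \<Longrightarrow> q (s k) = k"
proof
  define s where "s k = Inf {t \<in> {0..1}. q t = k}" for k
  have cl: "closed {t \<in> {0..1}. q t = k}" for k
    using continuous_closed_preimage_constant[OF continuous_on_subset[OF q(1)], of "{0..1}" k] by simp
  have bdd: "bdd_below {t \<in> {0..1}. q t = k}" for k by (rule bdd_belowI[of _ 0]) auto
  have s: "s k \<in> {t \<in> {0..1}. q t = k}" if k: "k \<in> K" for k
  proof -
    obtain t where "t \<in> {0..1}" "q t = k" using q(2) k by blast
    then have "{t \<in> {0..1}. q t = k} \<noteq> {}" by blast
    then show ?thesis unfolding s_def by (intro closed_contains_Inf bdd cl)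
  qed
  then show "s k \<in> {0..1}" "q (s k) = k" if "k \<in> K" for k using that by auto
  show "s \<in> borel_measurable (restrict_space borel K)"
    unfolding borel_measurable_iff_le
  proof
    fix a
    have "{w \<in> K. s w \<le> a} = K \<inter> q ` ({0..1} \<inter> {..a})"
    proof (intro set_eqI iffI)
      fix w assume "w \<in> {w \<in> K. s w \<le> a}"
      then show "w \<in> K \<inter> q ` ({0..1} \<inter> {..a})" using s[of w] by (auto intro!: image_eqI[of _ _ "s w"])
    next
      fix w assume w: "w \<in> K \<inter> q ` ({0..1} \<inter> {..a})"
      then obtain t where t: "t \<in> {0..1}" "t \<le> a" "w = q t" by auto
      then have "s w \<le> t" unfolding s_def by (intro cInf_lower bdd) auto
      then show "w \<in> {w \<in> K. s w \<le> a}" using w t by auto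
    qed
    moreover have "compact (q ` ({0..1} \<inter> {..a}))"
      by (intro compact_continuous_image continuous_on_subset[OF q(1)] compact_Int_closed) auto
    ultimately have "{w \<in> K. s w \<le> a} \<in> sets borel"
      using K by (simp add: borel_closed compact_imp_closed)
    then show "{w \<in> space (restrict_space borel K). s w \<le> a} \<in> sets (restrict_space borel K)"
      by (auto simp: space_restrict_space sets_restrict_space_iff K borel_closed compact_imp_closed)
  qed
qed

text \<open>The section moves the measures to the line, where they live on [0, 1] and so are tight;
  Helly yields a limit \<open>N\<close>, and \<open>q\<close> carries it back. Integrals of
  \<open>h\<close> over \<open>K\<close> become integrals of h composed with q, which is continuous
  even though the section is not.\<close>

lemma prob_weak_star_compact:
  fixes K :: "'b::euclidean_space set"
  assumes K: "compact K" "K \<noteq> {}" and P: "\<And>n::nat. prob_space (P n)" "\<And>n. sets (P n) = borel_subsets K"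
  obtains r Q where "strict_mono (r :: nat \<Rightarrow> nat)" "prob_space Q" "sets Q = borel_subsets K"
    "\<And>h :: 'b \<Rightarrow> real. continuous_on K h \<Longrightarrow> (\<lambda>n. integral\<^sup>L (P (r n)) h) \<longlonglongrightarrow> integral\<^sup>L Q h"
proof -
  interpret P: prob_space "P n" for n by (rule P)
  have spP: "space (P n) = K" for n using sets_eq_imp_space_eq[OF P(2)] by (simp add: space_restrict_space)
  obtain q :: "real \<Rightarrow> 'b" where q: "continuous_on UNIV q" "K \<subseteq> q ` {0..1}"
    using continuous_surjection_onto_compact[OF K(1)] .
  obtain s where s: "s \<in> borel_measurable (restrict_space borel K)" "\<And>k. k \<in> K \<Longrightarrow> s k \<in> {0..1}"
    "\<And>k. k \<in> K \<Longrightarrow> q (s k) = k"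
    using borel_section[OF K(1) q] by metis
  have smeas[measurable]: "s \<in> borel_measurable (P n)" for n
    using s(1) measurable_cong_sets[OF P(2) refl] by blast
  define \<nu> where "\<nu> n = distr (P n) borel s" for n
  have rd: "real_distribution (\<nu> n)" for n
    unfolding \<nu>_def by (rule P.real_distribution_distr) simp
  \<comment> \<open>Tightness is phrased with intervals open on the left, so the left end has to lie
    below 0.\<close>
  have Icc: "measure (\<nu> n) {-1<..1} = 1" for n
  proof -
    have "measure (\<nu> n) {-1<..1} = measure (P n) (s -` {-1<..1} \<inter> space (P n))"
      unfolding \<nu>_def by (rule measure_distr) auto
    also have "s -` {-1<..1} \<inter> space (P n) = space (P n)" using s(2) spP by fastforce
    finally show ?thesis by (simp add: P.prob_space)
  qed
  have "tight \<nu>"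
    unfolding tight_def
  proof (intro conjI allI impI rd)
    fix \<epsilon> :: real assume "0 < \<epsilon>"
    then have "(-1::real) < 1 \<and> (\<forall>n. 1 - \<epsilon> < measure (\<nu> n) {-1<..1})" by (simp add: Icc)
    then show "\<exists>a b. a < b \<and> (\<forall>n. 1 - \<epsilon> < measure (\<nu> n) {a<..b})" by blast
  qed
  then obtain r N where r: "strict_mono r" and N: "real_distribution N" and w: "weak_conv_m (\<nu> \<circ> id \<circ> r) N"
    using tight_imp_convergent_subsubsequence[of \<nu> id] strict_mono_id by blast
  interpret N: real_distribution N by fact
  have conv: "(\<lambda>n. integral\<^sup>L (\<nu> (r n)) f) \<longlonglongrightarrow> integral\<^sup>L N f"
    if "continuous_on UNIV f" "\<And>x. norm (f x) \<le> B" for f :: "real \<Rightarrow> real" and B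
  proof -
    have "(\<lambda>n. integral\<^sup>L ((\<nu> \<circ> id \<circ> r) n) f) \<longlonglongrightarrow> integral\<^sup>L N f"
      by (rule weak_conv_imp_integral_bdd_continuous_conv[OF _ N w, where B = B])
        (use rd that in \<open>simp_all add: continuous_on_eq_continuous_at\<close>)
    then show ?thesis by simp
  qed
  have int\<nu>: "integral\<^sup>L (\<nu> n) f = integral\<^sup>L (P n) (\<lambda>k. f (s k))"
    if "continuous_on UNIV f" for f :: "real \<Rightarrow> real" and n
    unfolding \<nu>_def using that by (intro integral_distr borel_measurable_continuous_onI) auto
  \<comment> \<open>The limit might charge points that \<open>q\<close> sends outside
    \<open>K\<close>. Testing with the truncated distance to the closed set \<open>Z\<close>, whose
    integral is 0 along the sequence, excludes this.\<close>
  define Z where "Z = q -` K"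
  have Zc: "closed Z"
    unfolding Z_def using closed_vimage[OF compact_imp_closed[OF K(1)] q(1)] .
  obtain k0 where k0: "k0 \<in> K" using K(2) by blast
  have Zne: "Z \<noteq> {}" using s(3)[OF k0] k0 by (auto simp: Z_def)
  have sZ: "s k \<in> Z" if "k \<in> K" for k using s(3)[OF that] that by (simp add: Z_def)
  define g where "g t = min 1 (infdist t Z)" for t
  have gc: "continuous_on UNIV g" unfolding g_def by (intro continuous_intros)
  have gb: "norm (g t) \<le> 1" and g0: "0 \<le> g t" for t by (auto simp: g_def infdist_nonneg)
  have "integral\<^sup>L (\<nu> n) g = 0" for n
  proof -
    have "integral\<^sup>L (P n) (\<lambda>k. g (s k)) = integral\<^sup>L (P n) (\<lambda>k. 0)"
      using sZ by (intro Bochner_Integration.integral_cong) (auto simp: spP g_def)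
    then show ?thesis by (simp add: int\<nu>[OF gc])
  qed
  then have "integral\<^sup>L N g = 0"
    using conv[OF gc gb] by (simp add: LIMSEQ_const_iff)
  moreover have gm: "g \<in> borel_measurable N"
    using borel_measurable_continuous_onI[OF gc] by simp
  moreover have "integrable N g"
    using gb gm by (intro N.integrable_const_bound[where B = 1]) auto
  ultimately have "AE t in N. g t = 0"
    using g0 by (subst (asm) integral_nonneg_eq_0_iff_AE) auto
  then have AEZ: "AE t in N. t \<in> Z"
  proof eventually_elim
    case (elim t)
    then have "infdist t Z = 0" by (auto simp: g_def min_def split: if_splits)
    then show ?case using in_closed_iff_infdist_zero[OF Zc Zne] by blast
  qed
  \<comment> \<open>Redirected to a point of \<open>K\<close> off \<open>Z\<close>, so that the
    values lie in \<open>K\<close> everywhere and not just almost everywhere.\<close>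
  define q' where "q' t = (if t \<in> Z then q t else k0)" for t
  have qm: "q \<in> borel_measurable borel" by (rule borel_measurable_continuous_onI[OF q(1)])
  have q'm: "q' \<in> measurable N (restrict_space borel K)"
  proof (rule measurable_restrict_space2)
    show "q' \<in> space N \<rightarrow> K" using k0 by (auto simp: q'_def Z_def)
    have "q' \<in> borel_measurable borel"
      unfolding q'_def using qm Zc by (intro measurable_If) auto
    then show "q' \<in> borel_measurable N" by simp
  qed
  define Q where "Q = distr N (restrict_space borel K) q'"
  show thesis
  proof
    show "strict_mono r" by fact
    show "prob_space Q" unfolding Q_def by (rule N.prob_space_distr[OF q'm])
    show "sets Q = borel_subsets K" by (simp add: Q_def)
    fix h :: "'b \<Rightarrow> real" assume h: "continuous_on K h"
    obtain B where B: "B \<ge> 0" "\<And>x. x \<in> K \<Longrightarrow> norm (h x) \<le> B"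
      using compact_imp_bounded[OF compact_continuous_image[OF h K(1)]] by (auto simp: bounded_pos) (metis less_imp_le)
    \<comment> \<open>\<open>h\<close> is continuous on \<open>K\<close> only, while weak
      convergence on the line needs a bounded continuous function on all of it.\<close>
    obtain H where H: "continuous_on UNIV H" "\<And>x. x \<in> K \<Longrightarrow> H x = h x" "\<And>x. norm (H x) \<le> B"
      using Tietze[of K h UNIV B] h B K(1) by (auto simp: compact_imp_closed)
    have Hq: "continuous_on UNIV (\<lambda>t. H (q t))"
      by (rule continuous_on_compose2[OF H(1) q(1)]) auto
    have hm: "h \<in> borel_measurable (restrict_space borel K)"
      using borel_measurable_continuous_on_restrict[OF h] .
    have "integral\<^sup>L Q h = integral\<^sup>L N (\<lambda>t. h (q' t))"
      unfolding Q_def by (rule integral_distr[OF q'm hm])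
    also have "\<dots> = integral\<^sup>L N (\<lambda>t. H (q t))"
    proof (rule integral_cong_AE)
      show "(\<lambda>t. h (q' t)) \<in> borel_measurable N" by (rule measurable_compose[OF q'm hm])
      show "(\<lambda>t. H (q t)) \<in> borel_measurable N"
        using borel_measurable_continuous_onI[OF Hq] by simp
      show "AE t in N. h (q' t) = H (q t)"
        using AEZ by eventually_elim (auto simp: q'_def Z_def H(2))
    qed
    finally have Qh: "integral\<^sup>L Q h = integral\<^sup>L N (\<lambda>t. H (q t))" .
    have "integral\<^sup>L (P n) h = integral\<^sup>L (\<nu> n) (\<lambda>t. H (q t))" for n
      unfolding int\<nu>[OF Hq] using s(3) H(2)
      by (intro Bochner_Integration.integral_cong) (auto simp: spP)
    then show "(\<lambda>n. integral\<^sup>L (P (r n)) h) \<longlonglongrightarrow> integral\<^sup>L Q h"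
      using conv[OF Hq H(3)] by (simp add: Qh)
  qed
qed

text \<open>Masses and normalised measures have convergent subsequences separately; the limiting
  mass times the limiting probability is the limit.\<close>

lemma finite_weak_star_compact:
  fixes K :: "'b::euclidean_space set"
  assumes K: "compact K" and P: "\<And>n::nat. finite_measure (P n)" "\<And>n. sets (P n) = borel_subsets K"
    and b: "\<And>n. measure (P n) K \<le> R"
  obtains r Q where "strict_mono (r :: nat \<Rightarrow> nat)" "finite_measure Q" "sets Q = borel_subsets K"
    "\<And>h :: 'b \<Rightarrow> real. continuous_on K h \<Longrightarrow> (\<lambda>n. integral\<^sup>L (P (r n)) h) \<longlonglongrightarrow> integral\<^sup>L Q h"
proof (cases "K = {}")
  case True
  have spP: "space (P n) = {}" for n
    using sets_eq_imp_space_eq[OF P(2)] True by (simp add: space_restrict_space)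
  show thesis
    by (rule that[of id "P 0"]) (use P spP in \<open>auto simp: strict_mono_def Bochner_Integration.integral_empty\<close>)
next
  case False
  then obtain k0 where k0: "k0 \<in> K" by blast
  interpret P: finite_measure "P n" for n by (rule P)
  have spP: "space (P n) = K" for n using sets_eq_imp_space_eq[OF P(2)] by (simp add: space_restrict_space)
  define m where "m n = measure (P n) K" for n
  have m0: "0 \<le> m n" for n by (simp add: m_def)
  have em: "emeasure (P n) K = ennreal (m n)" for n by (simp add: m_def P.emeasure_eq_measure)
  \<comment> \<open>A measure of mass 0 cannot be normalised. A point mass stands in for it and is
    multiplied by 0 in \<open>intD\<close>.\<close>
  define D where "D n = (if m n = 0 then return (restrict_space borel K) k0
    else density (P n) (\<lambda>_. ennreal (1 / m n)))" for n
  have setsD: "sets (D n) = borel_subsets K" for n by (simp add: D_def P(2))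
  have probD: "prob_space (D n)" for n
  proof (cases "m n = 0")
    case True
    then show ?thesis using k0 by (simp add: D_def prob_space_return space_restrict_space)
  next
    case False
    have "emeasure (D n) (space (D n)) = ennreal (1 / m n) * emeasure (P n) K"
      using False sets.top[of "P n"] by (simp add: D_def emeasure_density_const spP)
    also have "\<dots> = 1" using False m0[of n] by (simp add: em flip: ennreal_mult')
    finally show ?thesis by (rule prob_spaceI)
  qed
  have intD: "integral\<^sup>L (P n) h = m n * integral\<^sup>L (D n) h" if "continuous_on K h" for h :: "'b \<Rightarrow> real" and n
  proof -
    have hm: "h \<in> borel_measurable (P n)"
      using borel_measurable_continuous_on_restrict[OF that] measurable_cong_sets[OF P(2) refl] by blast
    show ?thesis
    proof (cases "m n = 0")
      case True
      then have "emeasure (P n) (space (P n)) = 0" by (simp add: spP em)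
      then have "AE x in P n. h x = 0" by (metis AE_iff_null_sets ae_filter_eq_bot_iff trivial_limit_def eventually_bot)
      then have "integral\<^sup>L (P n) h = 0" using integral_eq_zero_AE by blast
      then show ?thesis using True by simp
    next
      case False
      then show ?thesis using hm m0[of n] by (simp add: D_def integral_real_density)
    qed
  qed
  obtain r1 Q where r1: "strict_mono (r1 :: nat \<Rightarrow> nat)" "prob_space Q" "sets Q = borel_subsets K"
    "\<And>h :: 'b \<Rightarrow> real. continuous_on K h \<Longrightarrow> (\<lambda>n. integral\<^sup>L (D (r1 n)) h) \<longlonglongrightarrow> integral\<^sup>L Q h"
    using prob_weak_star_compact[of K D, OF K False probD setsD] by metis
  have "\<forall>n. m (r1 n) \<in> {0..R}" using m0 b by (auto simp: m_def)
  then obtain l r2 where l: "l \<in> {0..R}" and r2: "strict_mono (r2 :: nat \<Rightarrow> nat)" "((\<lambda>n. m (r1 n)) \<circ> r2) \<longlonglongrightarrow> l"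
    using compact_Icc[of 0 R] unfolding compact_eq_seq_compact_metric seq_compact_def by meson
  interpret Q: prob_space Q by fact
  have spQ: "space Q = K" using sets_eq_imp_space_eq[OF r1(3)] by (simp add: space_restrict_space)
  show thesis
  proof
    show "strict_mono (r1 \<circ> r2)" using r1(1) r2(1) by (rule strict_mono_o)
    show "finite_measure (density Q (\<lambda>_. ennreal l))"
      by (rule finite_measureI) (use sets.top[of Q] in \<open>simp add: emeasure_density_const ennreal_mult_eq_top_iff\<close>)
    show "sets (density Q (\<lambda>_. ennreal l)) = borel_subsets K" by (simp add: r1(3))
    fix h :: "'b \<Rightarrow> real" assume h: "continuous_on K h"
    have hm: "h \<in> borel_measurable Q"
      using borel_measurable_continuous_on_restrict[OF h] measurable_cong_sets[OF r1(3) refl] by blast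
    have "(\<lambda>n. m (r1 (r2 n)) * integral\<^sup>L (D (r1 (r2 n))) h) \<longlonglongrightarrow> l * integral\<^sup>L Q h"
      using r2(2) LIMSEQ_subseq_LIMSEQ[OF r1(4)[OF h] r2(1)]
      by (intro tendsto_mult) (auto simp: comp_def)
    then show "(\<lambda>n. integral\<^sup>L (P ((r1 \<circ> r2) n)) h) \<longlonglongrightarrow> integral\<^sup>L (density Q (\<lambda>_. ennreal l)) h"
      using l hm by (simp add: intD[OF h] integral_real_density)
  qed
qed

text \<open>The limits of the Jordan parts need not be mutually singular, so the norm of \<nu> may
  be smaller than the limit \<open>T\<close> of the norms: the norm is only lower semicontinuous.
  The test functions are nonnegative, as the features of a network are.\<close>

lemma signed_weak_star_compact:
  fixes K :: "'b::euclidean_space set"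
  assumes K: "compact K" and \<mu>: "\<And>n::nat. \<mu> n \<in> strategies2 K R"
  obtains r \<nu> T where "strict_mono (r :: nat \<Rightarrow> nat)" "\<nu> \<in> strategies2 K R"
    "(\<lambda>n. TV_norm K (\<mu> (r n))) \<longlonglongrightarrow> T" "TV_norm K \<nu> \<le> T"
    "\<And>h :: 'b \<Rightarrow> real. continuous_on K h \<Longrightarrow> (\<And>x. 0 \<le> h x) \<Longrightarrow>
      (\<lambda>n. signed_integral K (\<mu> (r n)) h) \<longlonglongrightarrow> signed_integral K \<nu> h"
proof -
  have sm: "signed_measure K (\<mu> n)" for n
    using \<mu> by unfold_locales (auto simp: strategies2_def)
  define P where "P n = pos_part K (\<mu> n)" for n
  define N where "N n = neg_part K (\<mu> n)" for n
  have TV: "TV_norm K (\<mu> n) = measure (P n) K + measure (N n) K" for n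
    unfolding P_def N_def by (rule signed_measure.TV_norm_eq[OF sm])
  have TVR: "measure (P n) K + measure (N n) K \<le> R" for n
    using \<mu>[of n] unfolding TV[symmetric] by (simp add: strategies2_def)
  have P: "finite_measure (P n)" "sets (P n) = borel_subsets K" "measure (P n) K \<le> R" for n
    using TVR[of n] measure_nonneg[of "N n" K]
    by (simp add: P_def signed_measure.finite_pos_part[OF sm], simp add: P_def signed_measure.sets_pos_part[OF sm], linarith)
  have N: "finite_measure (N n)" "sets (N n) = borel_subsets K" "measure (N n) K \<le> R" for n
    using TVR[of n] measure_nonneg[of "P n" K]
    by (simp add: N_def signed_measure.finite_neg_part[OF sm], simp add: N_def signed_measure.sets_neg_part[OF sm], linarith)
  obtain r1 P' where r1: "strict_mono (r1 :: nat \<Rightarrow> nat)" and P': "finite_measure P'" "sets P' = borel_subsets K"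
    "\<And>h :: 'b \<Rightarrow> real. continuous_on K h \<Longrightarrow> (\<lambda>n. integral\<^sup>L (P (r1 n)) h) \<longlonglongrightarrow> integral\<^sup>L P' h"
    using finite_weak_star_compact[of K P R, OF K P] by metis
  obtain r2 N' where r2: "strict_mono (r2 :: nat \<Rightarrow> nat)" and N': "finite_measure N'" "sets N' = borel_subsets K"
    "\<And>h :: 'b \<Rightarrow> real. continuous_on K h \<Longrightarrow> (\<lambda>n. integral\<^sup>L (N (r1 (r2 n))) h) \<longlonglongrightarrow> integral\<^sup>L N' h"
    using finite_weak_star_compact[of K "\<lambda>n. N (r1 n)" R, OF K N] by metis
  have P'2: "(\<lambda>n. integral\<^sup>L (P (r1 (r2 n))) h) \<longlonglongrightarrow> integral\<^sup>L P' h" if "continuous_on K h" for h :: "'b \<Rightarrow> real"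
    using LIMSEQ_subseq_LIMSEQ[OF P'(3)[OF that] r2] by (simp add: comp_def)
  have total: "integral\<^sup>L M (\<lambda>_. 1) = measure M K" if "sets M = borel_subsets K" for M :: "'b measure"
    using sets_eq_imp_space_eq[OF that] by (simp add: space_restrict_space)
  let ?\<nu> = "\<lambda>A. measure P' A - measure N' A"
  have T: "(\<lambda>n. TV_norm K (\<mu> (r1 (r2 n)))) \<longlonglongrightarrow> measure P' K + measure N' K"
    using tendsto_add[OF P'2 N'(3), of "\<lambda>_. 1" "\<lambda>_. 1"] by (simp only: total[OF P(2)] total[OF N(2)] total[OF P'(2)] total[OF N'(2)] TV continuous_on_const)
  have TV\<nu>: "TV_norm K ?\<nu> \<le> measure P' K + measure N' K"
    by (rule signed_measures_diff_measure(2)[OF P'(1,2) N'(1,2)])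
  show thesis
  proof
    show "strict_mono (r1 \<circ> r2)" using r1 r2 by (rule strict_mono_o)
    show "(\<lambda>n. TV_norm K (\<mu> ((r1 \<circ> r2) n))) \<longlonglongrightarrow> measure P' K + measure N' K" using T by simp
    show "TV_norm K ?\<nu> \<le> measure P' K + measure N' K" by fact
    have "measure P' K + measure N' K \<le> R"
      using T by (rule LIMSEQ_le_const2) (use TV TVR in auto)
    then show "?\<nu> \<in> strategies2 K R"
      using TV\<nu> signed_measures_diff_measure(1)[OF P'(1,2) N'(1,2)] by (auto simp: strategies2_def)
    fix h :: "'b \<Rightarrow> real" assume h: "continuous_on K h" "\<And>x. 0 \<le> h x"
    obtain B where B: "\<And>x. x \<in> K \<Longrightarrow> h x \<le> B"
      using compact_imp_bounded[OF compact_continuous_image[OF h(1) K(1)]] h(2) by (auto simp: bounded_pos)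
    have "signed_integral K ?\<nu> h = integral\<^sup>L P' h - integral\<^sup>L N' h"
      by (rule signed_integral_diff_measure[OF P'(1,2) N'(1,2) borel_measurable_continuous_on_restrict[OF h(1)] h(2) B])
    then show "(\<lambda>n. signed_integral K (\<mu> ((r1 \<circ> r2) n)) h) \<longlonglongrightarrow> signed_integral K ?\<nu> h"
      using tendsto_diff[OF P'2[OF h(1)] N'(3)[OF h(1)]] by (simp add: signed_integral_def P_def N_def)
  qed
qed

section \<open>The game\<close>

lemma signed_measures_zero: "(\<lambda>A. 0) \<in> signed_measures K"
  by (simp add: signed_measures_def)

lemma TV_norm_zero: "TV_norm K (\<lambda>A. 0) = 0"
  by (subst signed_measure.TV_norm_attained[OF signed_measure.intro[OF signed_measures_zero]]) (rule diff_self)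

section \<open>Networks over a compact parameter set\<close>

locale compact_parameters =
  fixes K :: "('a::euclidean_space \<times> real) set"
  assumes compact_K: "compact K"
begin

abbreviation feature :: "'a \<Rightarrow> 'a \<times> real \<Rightarrow> real" where
  "feature y \<equiv> (\<lambda>(a, b). relu (a \<bullet> y + b))"

lemma feature_nonneg: "0 \<le> feature y p"
  by (simp add: relu_def split: prod.split)

lemma feature_continuous: "continuous_on S (feature y)"
  unfolding relu_def case_prod_beta by (intro continuous_intros)

lemma feature_measurable: "feature y \<in> borel_measurable (restrict_space borel K)"
  by (rule borel_measurable_continuous_on_restrict[OF feature_continuous])

lemma feature_bound:
  obtains B where "B \<ge> 0" "\<And>y p. p \<in> K \<Longrightarrow> feature y p \<le> B * (norm y + 1)"
proof -
  obtain r where r: "r > 0" "\<And>p. p \<in> K \<Longrightarrow> norm p \<le> r"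
    using compact_imp_bounded[OF compact_K] by (auto simp: bounded_pos)
  have "feature y p \<le> r * (norm y + 1)" if "p \<in> K" for y p
  proof (cases p)
    case (Pair a b)
    have n: "norm a \<le> r" "\<bar>b\<bar> \<le> r"
      using r(2)[OF that] norm_fst_le[of a b] norm_snd_le[of b a] by (auto simp: Pair)
    have "a \<bullet> y + b \<le> norm a * norm y + \<bar>b\<bar>"
      using norm_cauchy_schwarz[of a y] by linarith
    also have "\<dots> \<le> r * norm y + r" by (intro add_mono mult_right_mono n) auto
    finally show ?thesis using r(1) by (simp add: Pair relu_def distrib_left)
  qed
  then show thesis using r(1) that less_imp_le by blast
qed

lemma feature_bound_at:
  obtains B where "\<And>p. p \<in> K \<Longrightarrow> feature y p \<le> B"
  using feature_bound by metis

lemma network_midpoint: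
  assumes "\<mu> \<in> signed_measures K" "\<nu> \<in> signed_measures K"
  shows "network K (\<lambda>A. (\<mu> A + \<nu> A) / 2) y = (network K \<mu> y + network K \<nu> y) / 2"
proof -
  obtain B where "\<And>p. p \<in> K \<Longrightarrow> feature y p \<le> B" using feature_bound_at by blast
  then show ?thesis unfolding network_def
    by (intro signed_integral_midpoint[OF assms feature_measurable feature_nonneg])
qed

text \<open>One bound for the whole strategy set, so that dominated convergence applies along
  sequences of measures.\<close>

lemma network_bound:
  obtains B where "\<And>\<mu> y. \<mu> \<in> strategies2 K R \<Longrightarrow> \<bar>network K \<mu> y\<bar> \<le> R * (B * (norm y + 1))"
proof -
  obtain B where B: "B \<ge> 0" "\<And>y p. p \<in> K \<Longrightarrow> feature y p \<le> B * (norm y + 1)" using feature_bound by metis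
  have "\<bar>network K \<mu> y\<bar> \<le> R * (B * (norm y + 1))" if "\<mu> \<in> strategies2 K R" for \<mu> y
  proof -
    interpret signed_measure K \<mu> using that by unfold_locales (simp add: strategies2_def)
    have TV: "TV_norm K \<mu> \<le> R" using that by (simp add: strategies2_def)
    define b where "b = B * (norm y + 1)"
    have b0: "b \<ge> 0" using B(1) by (simp add: b_def)
    have le: "integral\<^sup>L M (feature y) \<le> measure M K * b" "0 \<le> integral\<^sup>L M (feature y)"
      if M: "finite_measure M" "sets M = \<A>" "space M = K" for M
    proof -
      interpret M: finite_measure M by fact
      have m: "feature y \<in> borel_measurable M" using feature_measurable measurable_cong_sets[OF M(2) refl] by blast
      have le: "feature y p \<le> b" if "p \<in> K" for p using B(2)[OF that] by (simp add: b_def)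
      have "integrable M (feature y)"
        by (rule M.integrable_const_bound[OF _ m, where B = b]) (use le feature_nonneg in \<open>auto intro!: AE_I2 simp: M(3) abs_of_nonneg[OF feature_nonneg]\<close>)
      then have "integral\<^sup>L M (feature y) \<le> integral\<^sup>L M (\<lambda>_. b)"
        by (rule integral_mono) (use le M(3) in auto)
      then show "integral\<^sup>L M (feature y) \<le> measure M K * b" by (simp add: M(3))
      show "0 \<le> integral\<^sup>L M (feature y)" by (intro integral_nonneg_AE AE_I2 feature_nonneg)
    qed
    note P = le[OF finite_pos_part sets_pos_part space_pos_part] and N = le[OF finite_neg_part sets_neg_part space_neg_part]
    have "\<bar>network K \<mu> y\<bar> \<le> measure (pos_part K \<mu>) K * b + measure (neg_part K \<mu>) K * b"
      unfolding network_def signed_integral_def using P N by linarith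
    also have "\<dots> = TV_norm K \<mu> * b" by (simp add: TV_norm_eq distrib_right)
    also have "\<dots> \<le> R * b" by (rule mult_right_mono[OF TV b0])
    finally show ?thesis by (simp add: b_def)
  qed
  then show thesis by (rule that)
qed

lemma network_continuous:
  assumes "\<mu> \<in> signed_measures K"
  shows "continuous_on UNIV (network K \<mu>)"
proof (rule continuous_on_sequentiallyI)
  interpret signed_measure K \<mu> using assms by unfold_locales
  fix Y :: "nat \<Rightarrow> 'a" and y assume Y: "Y \<longlonglongrightarrow> y"
  obtain B where B: "B \<ge> 0" "\<And>y p. p \<in> K \<Longrightarrow> feature y p \<le> B * (norm y + 1)" using feature_bound by metis
  obtain r where r: "\<And>n. norm (Y n) \<le> r" using convergent_imp_bounded[OF Y] by (auto simp: bounded_iff)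
  have lim: "(\<lambda>n. integral\<^sup>L M (feature (Y n))) \<longlonglongrightarrow> integral\<^sup>L M (feature y)"
    if M: "finite_measure M" "sets M = \<A>" "space M = K" for M
  proof (rule integral_dominated_convergence[where w = "\<lambda>_. B * (r + 1)"])
    interpret M: finite_measure M by fact
    show "integrable M (\<lambda>_. B * (r + 1))" by simp
    show "feature y \<in> borel_measurable M" "\<And>n. feature (Y n) \<in> borel_measurable M"
      using feature_measurable measurable_cong_sets[OF M(2) refl] by blast+
    show "AE p in M. (\<lambda>n. feature (Y n) p) \<longlonglongrightarrow> feature y p"
      unfolding relu_def case_prod_beta by (intro AE_I2 tendsto_intros Y)
    show "AE p in M. norm (feature (Y n) p) \<le> B * (r + 1)" for n
    proof (rule AE_I2)
      fix p assume "p \<in> space M"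
      then have "feature (Y n) p \<le> B * (norm (Y n) + 1)" using B(2) M(3) by blast
      also have "\<dots> \<le> B * (r + 1)" using B(1) r[of n] by (intro mult_left_mono) auto
      finally show "norm (feature (Y n) p) \<le> B * (r + 1)" by (simp add: abs_of_nonneg[OF feature_nonneg])
    qed
  qed
  show "(\<lambda>n. network K \<mu> (Y n)) \<longlonglongrightarrow> network K \<mu> y"
    unfolding network_def signed_integral_def
    by (intro tendsto_diff lim finite_pos_part sets_pos_part space_pos_part finite_neg_part sets_neg_part space_neg_part)
qed

end

section \<open>Convexity and minimisation of the potential\<close>

lemma square_midpoint_le: "((a + b) / 2)\<^sup>2 \<le> (a\<^sup>2 + b\<^sup>2) / (2::real)"
  using sum_squares_bound[of a b] by (simp add: power2_eq_square field_simps)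

lemma L2_norm_midpoint:
  assumes f: "f \<in> L2 \<Omega>" and g: "g \<in> L2 \<Omega>"
  shows "(L2_norm \<Omega> (\<lambda>x. (1 / 2) *\<^sub>R (f x + g x)))\<^sup>2 \<le> ((L2_norm \<Omega> f)\<^sup>2 + (L2_norm \<Omega> g)\<^sup>2) / 2"
proof -
  have "L2_norm \<Omega> (\<lambda>x. (1 / 2) *\<^sub>R (f x + g x)) \<le> (L2_norm \<Omega> f + L2_norm \<Omega> g) / 2"
    using L2_triangle[OF f g] by (simp only: L2_norm_scaleR) simp
  then have "(L2_norm \<Omega> (\<lambda>x. (1 / 2) *\<^sub>R (f x + g x)))\<^sup>2 \<le> ((L2_norm \<Omega> f + L2_norm \<Omega> g) / 2)\<^sup>2"
    by (rule power_mono) (rule L2_norm_nonneg)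
  also have "\<dots> \<le> ((L2_norm \<Omega> f)\<^sup>2 + (L2_norm \<Omega> g)\<^sup>2) / 2" by (rule square_midpoint_le)
  finally show ?thesis .
qed

lemma L2_parallelogram:
  assumes f: "f \<in> L2 \<Omega>" and g: "g \<in> L2 \<Omega>"
  shows "(L2_norm \<Omega> (\<lambda>x. f x - g x))\<^sup>2
    = 2 * (L2_norm \<Omega> f)\<^sup>2 + 2 * (L2_norm \<Omega> g)\<^sup>2 - 4 * (L2_norm \<Omega> (\<lambda>x. (1 / 2) *\<^sub>R (f x + g x)))\<^sup>2"
proof -
  have 1: "(L2_norm \<Omega> (\<lambda>x. f x + g x))\<^sup>2 = ip \<Omega> f f + 2 * ip \<Omega> f g + ip \<Omega> g g"
    using ip_add_expand[OF f g, of 1] by (simp add: L2_norm_sq)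
  have 2: "(L2_norm \<Omega> (\<lambda>x. f x - g x))\<^sup>2 = ip \<Omega> f f - 2 * ip \<Omega> f g + ip \<Omega> g g"
    using ip_add_expand[OF f g, of "-1"] by (simp add: L2_norm_sq)
  have 3: "4 * (L2_norm \<Omega> (\<lambda>x. (1 / 2) *\<^sub>R (f x + g x)))\<^sup>2 = (L2_norm \<Omega> (\<lambda>x. f x + g x))\<^sup>2"
    unfolding L2_norm_scaleR by (simp add: power_mult_distrib power2_eq_square)
  show ?thesis unfolding 3 1 2 using L2_norm_sq[of \<Omega> f] L2_norm_sq[of \<Omega> g] by linarith
qed

text \<open>Both losses differ from \<open>potential\<close> by a term that does not depend on the player's own strategy,
  so a minimiser of \<open>potential\<close> is an equilibrium.\<close>

locale poisson_game = poisson_domain \<Omega> W + compact_parameters K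
  for \<Omega> :: "'a::euclidean_space set" and W and K :: "('a \<times> real) set" +
  fixes M :: nat and x :: "nat \<Rightarrow> 'a" and ustar :: "'a \<Rightarrow> real" and \<alpha> \<beta> lam C R :: real
  assumes points: "\<And>i. i \<in> {1..M} \<Longrightarrow> x i \<in> \<Omega>"
    and pos: "\<alpha> > 0" "\<beta> > 0" "lam > 0" "C > 0" "R > 0"
begin

definition misfit :: "('a \<Rightarrow> real) \<Rightarrow> real" where
  "misfit v = (\<Sum>i=1..M. \<bar>v (x i) - ustar (x i)\<bar>\<^sup>2)"

definition gap :: "('a \<Rightarrow> real) \<Rightarrow> (('a \<times> real) set \<Rightarrow> real) \<Rightarrow> real" where
  "gap f \<mu> = (L2_norm \<Omega> (\<lambda>y. S f y - network K \<mu> y))\<^sup>2"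

definition potential :: "('a \<Rightarrow> real) \<Rightarrow> (('a \<times> real) set \<Rightarrow> real) \<Rightarrow> real" where
  "potential f \<mu> = \<beta> / real M * misfit (S f) + lam * TV_norm K \<mu> + \<alpha> / real M * misfit (network K \<mu>) + gap f \<mu>"

lemma strategiesD:
  assumes "f \<in> strategies1 \<Omega> C" "\<mu> \<in> strategies2 K R"
  shows "f \<in> L2 \<Omega>" "L2_norm \<Omega> f \<le> C" "\<mu> \<in> signed_measures K"
  using assms by (auto simp: strategies1_def strategies2_def)

lemma network_L2:
  assumes "\<mu> \<in> strategies2 K R"
  shows "network K \<mu> \<in> L2 \<Omega>"
proof -
  obtain B where B: "\<And>\<mu> y. \<mu> \<in> strategies2 K R \<Longrightarrow> \<bar>network K \<mu> y\<bar> \<le> R * (B * (norm y + 1))" using network_bound by metis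
  obtain r where r: "\<And>y. y \<in> \<Omega> \<Longrightarrow> norm y \<le> r" using bounded_\<Omega> by (auto simp: bounded_iff)
  show ?thesis
  proof (rule L2_bounded[OF open_\<Omega> bounded_\<Omega>, where B = "R * (\<bar>B\<bar> * (r + 1))"])
    show "network K \<mu> \<in> borel_measurable (lebesgue_on \<Omega>)"
      using assms by (intro borel_meas borel_measurable_continuous_onI network_continuous) (simp add: strategies2_def)
    fix y assume "y \<in> \<Omega>"
    have "B * (norm y + 1) \<le> \<bar>B\<bar> * (r + 1)" using r[OF \<open>y \<in> \<Omega>\<close>] by (intro mult_mono) auto
    then have "R * (B * (norm y + 1)) \<le> R * (\<bar>B\<bar> * (r + 1))" using pos(5) by (intro mult_left_mono) auto
    then show "norm (network K \<mu> y) \<le> R * (\<bar>B\<bar> * (r + 1))" using B[OF assms, of y] by simp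
  qed
qed

lemma misfit_midpoint: "misfit (\<lambda>y. (v y + w y) / 2) \<le> (misfit v + misfit w) / 2"
proof -
  have "\<bar>(v y + w y) / 2 - ustar y\<bar>\<^sup>2 \<le> (\<bar>v y - ustar y\<bar>\<^sup>2 + \<bar>w y - ustar y\<bar>\<^sup>2) / 2" for y
    using square_midpoint_le[of "v y - ustar y" "w y - ustar y"] by (simp add: add_divide_distrib diff_divide_distrib algebra_simps)
  then have "misfit (\<lambda>y. (v y + w y) / 2) \<le> (\<Sum>i=1..M. (\<bar>v (x i) - ustar (x i)\<bar>\<^sup>2 + \<bar>w (x i) - ustar (x i)\<bar>\<^sup>2) / 2)"
    unfolding misfit_def by (intro sum_mono)
  then show ?thesis by (simp add: misfit_def sum.distrib sum_divide_distrib add_divide_distrib)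
qed

lemma S_midpoint: "f \<in> L2 \<Omega> \<Longrightarrow> h \<in> L2 \<Omega> \<Longrightarrow> y \<in> \<Omega> \<Longrightarrow> S (\<lambda>x. (1 / 2) *\<^sub>R (f x + h x)) y = (S f y + S h y) / 2"
  using S_linear[where a = "1 / 2" and b = "1 / 2", of f h y] by (simp add: distrib_left add_divide_distrib)

lemma midpoint_strategies:
  assumes "f \<in> strategies1 \<Omega> C" "\<mu> \<in> strategies2 K R" "h \<in> strategies1 \<Omega> C" "\<nu> \<in> strategies2 K R"
  shows "(\<lambda>x. (1 / 2) *\<^sub>R (f x + h x)) \<in> strategies1 \<Omega> C" "(\<lambda>A. (\<mu> A + \<nu> A) / 2) \<in> strategies2 K R"
proof -
  note f = strategiesD[OF assms(1,2)] and h = strategiesD[OF assms(3,4)]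
  have "L2_norm \<Omega> (\<lambda>x. (1 / 2) *\<^sub>R (f x + h x)) \<le> C"
    unfolding L2_norm_scaleR using L2_triangle[OF f(1) h(1)] f(2) h(2) by simp
  then show "(\<lambda>x. (1 / 2) *\<^sub>R (f x + h x)) \<in> strategies1 \<Omega> C"
    unfolding strategies1_def using L2_scaleR[OF L2_add[OF f(1) h(1)]] by blast
  show "(\<lambda>A. (\<mu> A + \<nu> A) / 2) \<in> strategies2 K R"
    using TV_norm_midpoint[OF f(3) h(3)] signed_measures_midpoint[OF f(3) h(3)] assms(2,4)
    by (simp add: strategies2_def)
qed

text \<open>\<open>S\<close> and \<open>network\<close> respect midpoints, so every term is a norm,
  or the square of a norm or modulus, of something affine in the pair
  \<open>(f, \<mu>)\<close>.\<close>

lemma potential_midpoint: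
  assumes "f \<in> strategies1 \<Omega> C" "\<mu> \<in> strategies2 K R" "h \<in> strategies1 \<Omega> C" "\<nu> \<in> strategies2 K R"
  shows "potential (\<lambda>x. (1 / 2) *\<^sub>R (f x + h x)) (\<lambda>A. (\<mu> A + \<nu> A) / 2) \<le> (potential f \<mu> + potential h \<nu>) / 2"
proof -
  let ?f = "\<lambda>x. (1 / 2) *\<^sub>R (f x + h x)" and ?\<mu> = "\<lambda>A. (\<mu> A + \<nu> A) / 2"
  note f = strategiesD[OF assms(1,2)] and h = strategiesD[OF assms(3,4)]
  have net: "network K ?\<mu> y = (network K \<mu> y + network K \<nu> y) / 2" for y by (rule network_midpoint[OF f(3) h(3)])
  have Sf: "S f \<in> L2 \<Omega>" "S h \<in> L2 \<Omega>" using S_solution[OF f(1)] S_solution[OF h(1)] by metis+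
  have 1: "misfit (S ?f) \<le> (misfit (S f) + misfit (S h)) / 2"
  proof -
    have "misfit (S ?f) = misfit (\<lambda>y. (S f y + S h y) / 2)"
      unfolding misfit_def by (intro sum.cong refl) (simp only: S_midpoint[OF f(1) h(1) points])
    then show ?thesis using misfit_midpoint[of "S f" "S h"] by simp
  qed
  have 2: "misfit (network K ?\<mu>) \<le> (misfit (network K \<mu>) + misfit (network K \<nu>)) / 2"
    unfolding net[abs_def] by (rule misfit_midpoint)
  have 3: "gap ?f ?\<mu> \<le> (gap f \<mu> + gap h \<nu>) / 2"
  proof -
    have "L2_norm \<Omega> (\<lambda>y. S ?f y - network K ?\<mu> y)
      = L2_norm \<Omega> (\<lambda>y. (1 / 2) *\<^sub>R ((S f y - network K \<mu> y) + (S h y - network K \<nu> y)))"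
      by (rule L2_norm_cong) (simp only: S_midpoint[OF f(1) h(1)] net, simp add: field_simps)
    then show ?thesis
      unfolding gap_def
      using L2_norm_midpoint[OF L2_diff[OF Sf(1) network_L2[OF assms(2)]] L2_diff[OF Sf(2) network_L2[OF assms(4)]]]
      by simp
  qed
  have 4: "TV_norm K ?\<mu> \<le> (TV_norm K \<mu> + TV_norm K \<nu>) / 2" by (rule TV_norm_midpoint[OF f(3) h(3)])
  have "\<beta> / real M * misfit (S ?f) \<le> \<beta> / real M * ((misfit (S f) + misfit (S h)) / 2)"
    "lam * TV_norm K ?\<mu> \<le> lam * ((TV_norm K \<mu> + TV_norm K \<nu>) / 2)"
    "\<alpha> / real M * misfit (network K ?\<mu>) \<le> \<alpha> / real M * ((misfit (network K \<mu>) + misfit (network K \<nu>)) / 2)"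
    using pos by (intro mult_left_mono 1 2 4; simp)+
  then have "potential ?f ?\<mu> \<le> \<beta> / real M * ((misfit (S f) + misfit (S h)) / 2) + lam * ((TV_norm K \<mu> + TV_norm K \<nu>) / 2)
      + \<alpha> / real M * ((misfit (network K \<mu>) + misfit (network K \<nu>)) / 2) + (gap f \<mu> + gap h \<nu>) / 2"
    unfolding potential_def using 3 by (intro add_mono)
  also have "\<dots> = (potential f \<mu> + potential h \<nu>) / 2"
    unfolding potential_def by (simp add: distrib_left add_divide_distrib)
  finally show ?thesis .
qed

lemma potential_nonneg:
  assumes "\<mu> \<in> strategies2 K R"
  shows "0 \<le> potential f \<mu>"
proof -
  interpret signed_measure K \<mu> using assms by unfold_locales (simp add: strategies2_def)
  show ?thesis unfolding potential_def misfit_def gap_def using pos TV_norm_nonneg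
    by (intro add_nonneg_nonneg mult_nonneg_nonneg sum_nonneg) auto
qed

text \<open>Among near-minimisers of the potential those with almost minimal \<open>L2_norm \<Omega> f\<close> form a strongly convergent
  sequence in the first component, by the parallelogram law; so no weak compactness in \<open>L2 \<Omega>\<close> is needed.\<close>

lemma minimising_sequence:
  obtains F \<mu> f m where "\<And>n::nat. F n \<in> strategies1 \<Omega> C" "\<And>n. \<mu> n \<in> strategies2 K R"
    "f \<in> strategies1 \<Omega> C" "(\<lambda>n. L2_norm \<Omega> (\<lambda>x. F n x - f x)) \<longlonglongrightarrow> 0"
    "(\<lambda>n. potential (F n) (\<mu> n)) \<longlonglongrightarrow> m"
    "\<And>h \<nu>. h \<in> strategies1 \<Omega> C \<Longrightarrow> \<nu> \<in> strategies2 K R \<Longrightarrow> m \<le> potential h \<nu>"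
proof -
  define A where "A = strategies1 \<Omega> C \<times> strategies2 K R"
  define P where "P = (\<lambda>(f, \<mu>). potential f \<mu>)"
  have z: "((\<lambda>_. 0), (\<lambda>_. 0)) \<in> A"
    using pos by (auto simp: A_def strategies1_def strategies2_def L2_zero L2_norm_def signed_measures_zero TV_norm_zero)
  define m where "m = Inf (P ` A)"
  have bdd: "bdd_below (P ` A)"
    by (rule bdd_belowI[of _ 0]) (auto simp: P_def A_def potential_nonneg)
  have m_le: "m \<le> potential h \<nu>" if "h \<in> strategies1 \<Omega> C" "\<nu> \<in> strategies2 K R" for h \<nu>
    unfolding m_def using that bdd by (intro cInf_lower) (auto simp: P_def A_def image_iff)
  define X where "X n = {p \<in> A. P p \<le> m + 1 / real (Suc n)}" for n
  define n2 where "n2 = (\<lambda>p :: ('a \<Rightarrow> real) \<times> (('a \<times> real) set \<Rightarrow> real). (L2_norm \<Omega> (fst p))\<^sup>2)"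
  have Xne: "X n \<noteq> {}" for n
    using cInf_lessD[of "P ` A" "m + 1 / real (Suc n)"] z unfolding m_def X_def by (fastforce simp: less_imp_le)
  have Xdec: "X k \<subseteq> X n" if "n \<le> k" for n k
  proof -
    have "1 / real (Suc k) \<le> 1 / real (Suc n)" using that by (intro divide_left_mono) auto
    then show ?thesis by (auto simp: X_def)
  qed
  \<comment> \<open>The least squared norm over a shrinking set grows with \<open>n\<close> and
    stays below C^2, so it converges. The gap to its limit measures how far apart two near-minimal
    sources can be.\<close>
  define N where "N n = Inf (n2 ` X n)" for n
  have bN: "bdd_below (n2 ` X n)" for n by (rule bdd_belowI[of _ 0]) (auto simp: n2_def)
  have N_le: "N n \<le> n2 p" if "p \<in> X n" for n p
    unfolding N_def using that bN by (intro cInf_lower) auto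
  have N_mono: "incseq N"
    unfolding N_def incseq_def using Xdec Xne bN by (auto intro!: cInf_superset_mono)
  have N_le_C: "N n \<le> C\<^sup>2" for n
  proof -
    obtain p where p: "p \<in> X n" using Xne by blast
    then have "L2_norm \<Omega> (fst p) \<le> C" by (auto simp: X_def A_def strategies1_def)
    then have "n2 p \<le> C\<^sup>2" unfolding n2_def using L2_norm_nonneg by (intro power_mono)
    then show ?thesis using N_le[OF p] by linarith
  qed
  obtain L where L: "N \<longlonglongrightarrow> L" "\<And>n. N n \<le> L"
    using incseq_convergent[OF N_mono] N_le_C by metis
  have "\<exists>p. p \<in> X n \<and> n2 p < N n + 1 / real (Suc n)" for n
    using cInf_lessD[of "n2 ` X n" "N n + 1 / real (Suc n)"] Xne[of n] unfolding N_def by auto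
  then obtain p where p: "\<And>n. p n \<in> X n" "\<And>n. n2 (p n) < N n + 1 / real (Suc n)" by metis
  define F where "F n = fst (p n)" for n
  define \<mu> where "\<mu> n = snd (p n)" for n
  have Fs: "F n \<in> strategies1 \<Omega> C" and \<mu>s: "\<mu> n \<in> strategies2 K R" for n
    using p(1)[of n] by (auto simp: X_def A_def F_def \<mu>_def)
  have FL: "F n \<in> L2 \<Omega>" for n using Fs by (simp add: strategies1_def)
  have Ple: "potential (F n) (\<mu> n) \<le> m + 1 / real (Suc n)" for n
    using p(1)[of n] by (auto simp: X_def P_def F_def \<mu>_def case_prod_beta)
  \<comment> \<open>The midpoint of the strategies numbered \<open>j\<close> and \<open>k\<close>
    stays in \<open>X n\<close> by convexity, so its squared norm is at least \<open>N n\<close>; in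
    the parallelogram law only small terms survive.\<close>
  have dist: "(L2_norm \<Omega> (\<lambda>x. F j x - F k x))\<^sup>2 \<le> 2 * (L - N n) + 4 / real (Suc n) + 2 * (L - N n)" if jk: "j \<ge> n" "k \<ge> n" for j k n
  proof -
    let ?f = "\<lambda>x. (1 / 2) *\<^sub>R (F j x + F k x)" and ?\<mu> = "\<lambda>A. (\<mu> j A + \<mu> k A) / 2"
    have inv: "1 / real (Suc j) \<le> 1 / real (Suc n)" "1 / real (Suc k) \<le> 1 / real (Suc n)"
      using jk by (auto intro!: divide_left_mono)
    have "potential ?f ?\<mu> \<le> (potential (F j) (\<mu> j) + potential (F k) (\<mu> k)) / 2"
      by (rule potential_midpoint[OF Fs \<mu>s Fs \<mu>s])
    then have "potential ?f ?\<mu> \<le> m + 1 / real (Suc n)"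
      using Ple[of j] Ple[of k] inv by argo
    then have "(?f, ?\<mu>) \<in> X n"
      using midpoint_strategies[OF Fs[of j] \<mu>s[of j] Fs[of k] \<mu>s[of k]] by (simp add: X_def A_def P_def)
    from N_le[OF this] have 1: "N n \<le> (L2_norm \<Omega> ?f)\<^sup>2" by (simp add: n2_def)
    have 2: "(L2_norm \<Omega> (F i))\<^sup>2 < N i + 1 / real (Suc i)" for i using p(2)[of i] by (simp add: n2_def F_def)
    have gen: "d \<le> 2 * (l - n) + 4 * e + 2 * (l - n)"
      if "d = 2 * a + 2 * b - 4 * c" "n \<le> c" "a < nj + ej" "b < nk + ek" "ej \<le> e" "ek \<le> e" "nj \<le> l" "nk \<le> l"
      for d a b c n nj nk ej ek e l :: real
      using that by argo
    show ?thesis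
      using gen[OF L2_parallelogram[OF FL FL] 1 2 2 inv L(2) L(2)] by simp
  qed
  have Cauchy: "\<exists>n. \<forall>j\<ge>n. \<forall>k\<ge>n. L2_norm \<Omega> (\<lambda>x. F j x - F k x) \<le> e" if e: "e > 0" for e
  proof -
    have "(\<lambda>n. 2 * (L - N n) + 4 / real (Suc n) + 2 * (L - N n)) \<longlonglongrightarrow> 2 * (L - L) + 0 + 2 * (L - L)"
    proof (intro tendsto_intros L(1))
      show "(\<lambda>n. 4 / real (Suc n)) \<longlonglongrightarrow> 0" by real_asymp
    qed
    then have "\<forall>\<^sub>F n in sequentially. 2 * (L - N n) + 4 / real (Suc n) + 2 * (L - N n) < e\<^sup>2"
      using e by (intro order_tendstoD(2)) auto
    then obtain n where n: "2 * (L - N n) + 4 / real (Suc n) + 2 * (L - N n) < e\<^sup>2"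
      by (auto simp: eventually_sequentially)
    have "L2_norm \<Omega> (\<lambda>x. F j x - F k x) \<le> e" if "j \<ge> n" "k \<ge> n" for j k
      by (rule power2_le_imp_le) (use dist[OF that] n e in linarith)+
    then show ?thesis by blast
  qed
  obtain f where f: "f \<in> L2 \<Omega>" "(\<lambda>n. L2_norm \<Omega> (\<lambda>x. F n x - f x)) \<longlonglongrightarrow> 0"
    by (rule L2_complete[OF open_\<Omega> bounded_\<Omega>, of F, OF FL Cauchy])
  have "L2_norm \<Omega> f \<le> C"
    by (rule LIMSEQ_le_const2[OF L2_norm_tendsto[OF FL f]]) (use Fs in \<open>auto simp: strategies1_def\<close>)
  then have fs: "f \<in> strategies1 \<Omega> C" using f(1) by (simp add: strategies1_def)
  have "(\<lambda>n. potential (F n) (\<mu> n)) \<longlonglongrightarrow> m"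
  proof (rule tendsto_sandwich[OF _ _ tendsto_const])
    show "(\<lambda>n. m + 1 / real (Suc n)) \<longlonglongrightarrow> m" by real_asymp
  qed (use m_le[OF Fs \<mu>s] Ple in auto)
  then show thesis using that Fs \<mu>s fs f(2) m_le by blast
qed

text \<open>Strong convergence of the sources and weak-star convergence of the measures carry every
  term of the potential to its value at the limit, except the total variation, which can only
  drop.\<close>

lemma potential_minimum:
  obtains f \<mu> where "f \<in> strategies1 \<Omega> C" "\<mu> \<in> strategies2 K R"
    "\<And>h \<nu>. h \<in> strategies1 \<Omega> C \<Longrightarrow> \<nu> \<in> strategies2 K R \<Longrightarrow> potential f \<mu> \<le> potential h \<nu>"
proof -
  obtain F \<mu> f m where F: "\<And>n::nat. F n \<in> strategies1 \<Omega> C" and \<mu>: "\<And>n. \<mu> n \<in> strategies2 K R"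
    and f: "f \<in> strategies1 \<Omega> C" "(\<lambda>n. L2_norm \<Omega> (\<lambda>x. F n x - f x)) \<longlonglongrightarrow> 0"
    and m: "(\<lambda>n. potential (F n) (\<mu> n)) \<longlonglongrightarrow> m"
      "\<And>h \<nu>. h \<in> strategies1 \<Omega> C \<Longrightarrow> \<nu> \<in> strategies2 K R \<Longrightarrow> m \<le> potential h \<nu>"
    by (rule minimising_sequence) blast
  obtain r \<nu> T where r: "strict_mono (r :: nat \<Rightarrow> nat)" and \<nu>: "\<nu> \<in> strategies2 K R"
    and T: "(\<lambda>n. TV_norm K (\<mu> (r n))) \<longlonglongrightarrow> T" "TV_norm K \<nu> \<le> T"
    and weak: "\<And>h. continuous_on K h \<Longrightarrow> (\<And>x. 0 \<le> h x) \<Longrightarrow>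
      (\<lambda>n. signed_integral K (\<mu> (r n)) h) \<longlonglongrightarrow> signed_integral K \<nu> h"
    by (rule signed_weak_star_compact[of K \<mu> R, OF compact_K \<mu>]) blast
  have FL: "F n \<in> L2 \<Omega>" and fL: "f \<in> L2 \<Omega>" for n using F f(1) by (auto simp: strategies1_def)
  have Fr: "(\<lambda>n. L2_norm \<Omega> (\<lambda>x. F (r n) x - f x)) \<longlonglongrightarrow> 0"
    using LIMSEQ_subseq_LIMSEQ[OF f(2) r] by (simp add: comp_def)
  note St = S_tendsto[of "\<lambda>n. F (r n)", OF FL fL Fr]
  have SL: "S (F n) \<in> L2 \<Omega>" "S f \<in> L2 \<Omega>" for n using S_solution[OF FL[of n]] S_solution[OF fL] by metis+
  have net: "(\<lambda>n. network K (\<mu> (r n)) y) \<longlonglongrightarrow> network K \<nu> y" for y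
    unfolding network_def by (rule weak[OF feature_continuous feature_nonneg])
  \<comment> \<open>The features are admissible integrands, so weak-star convergence gives pointwise
    convergence of the networks. They are uniformly bounded on the bounded set \<Omega>, hence they
    converge in \<open>L2\<close>.\<close>
  have netL2: "(\<lambda>n. L2_norm \<Omega> (\<lambda>y. network K (\<mu> (r n)) y - network K \<nu> y)) \<longlonglongrightarrow> 0"
  proof -
    obtain B where B: "\<And>\<mu> y. \<mu> \<in> strategies2 K R \<Longrightarrow> \<bar>network K \<mu> y\<bar> \<le> R * (B * (norm y + 1))" using network_bound by metis
    obtain b where b: "\<And>y. y \<in> \<Omega> \<Longrightarrow> norm y \<le> b" using bounded_\<Omega> by (auto simp: bounded_iff)
    define D where "D = R * (\<bar>B\<bar> * (b + 1))"
    have le: "\<bar>network K \<mu> y\<bar> \<le> D" if "\<mu> \<in> strategies2 K R" "y \<in> \<Omega>" for \<mu> y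
    proof -
      have "B * (norm y + 1) \<le> \<bar>B\<bar> * (b + 1)" using b[OF that(2)] by (intro mult_mono) auto
      then have "R * (B * (norm y + 1)) \<le> D" unfolding D_def using pos(5) by (intro mult_left_mono) auto
      then show ?thesis using B[OF that(1), of y] by linarith
    qed
    interpret fm: finite_measure "lebesgue_on \<Omega>" by (rule finite_measure_lebesgue_on_bounded[OF open_\<Omega> bounded_\<Omega>])
    have [measurable]: "network K (\<mu> n) \<in> borel_measurable (lebesgue_on \<Omega>)" "network K \<nu> \<in> borel_measurable (lebesgue_on \<Omega>)" for n
      by (intro L2_measurable network_L2 \<mu> \<nu>)+
    have "(\<lambda>n. integral\<^sup>L (lebesgue_on \<Omega>) (\<lambda>y. (norm (network K (\<mu> (r n)) y - network K \<nu> y))\<^sup>2))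
        \<longlonglongrightarrow> integral\<^sup>L (lebesgue_on \<Omega>) (\<lambda>y. 0)"
    proof (rule integral_dominated_convergence[where w = "\<lambda>_. (2 * D)\<^sup>2"])
      show "integrable (lebesgue_on \<Omega>) (\<lambda>_. (2 * D)\<^sup>2)" by simp
      show "AE y in lebesgue_on \<Omega>. (\<lambda>n. (norm (network K (\<mu> (r n)) y - network K \<nu> y))\<^sup>2) \<longlonglongrightarrow> 0"
      proof (rule AE_I2)
        fix y
        have "(\<lambda>n. (norm (network K (\<mu> (r n)) y - network K \<nu> y))\<^sup>2) \<longlonglongrightarrow> (norm (network K \<nu> y - network K \<nu> y))\<^sup>2"
          by (intro tendsto_intros net)
        then show "(\<lambda>n. (norm (network K (\<mu> (r n)) y - network K \<nu> y))\<^sup>2) \<longlonglongrightarrow> 0" by simp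
      qed
      show "AE y in lebesgue_on \<Omega>. norm ((norm (network K (\<mu> (r n)) y - network K \<nu> y))\<^sup>2) \<le> (2 * D)\<^sup>2" for n
      proof (rule AE_I2)
        fix y assume "y \<in> space (lebesgue_on \<Omega>)"
        then have "y \<in> \<Omega>" by (simp add: space_restrict_space)
        then have "\<bar>network K (\<mu> (r n)) y - network K \<nu> y\<bar> \<le> 2 * D"
          using le[OF \<mu>[of "r n"]] le[OF \<nu>] by fastforce
        then have "\<bar>network K (\<mu> (r n)) y - network K \<nu> y\<bar>\<^sup>2 \<le> (2 * D)\<^sup>2" by (intro power_mono) auto
        then show "norm ((norm (network K (\<mu> (r n)) y - network K \<nu> y))\<^sup>2) \<le> (2 * D)\<^sup>2" by simp
      qed
    qed measurable
    then have "(\<lambda>n. sqrt (integral\<^sup>L (lebesgue_on \<Omega>) (\<lambda>y. (norm (network K (\<mu> (r n)) y - network K \<nu> y))\<^sup>2))) \<longlonglongrightarrow> sqrt 0"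
      by (intro tendsto_real_sqrt) simp
    then show ?thesis unfolding L2_norm_def by simp
  qed
  have gapL: "(\<lambda>n. gap (F (r n)) (\<mu> (r n))) \<longlonglongrightarrow> gap f \<nu>"
    unfolding gap_def
  proof (intro tendsto_power L2_norm_tendsto L2_diff SL network_L2 \<mu> \<nu>)
    have e1: "(\<lambda>n. L2_norm \<Omega> (\<lambda>y. S (F (r n)) y - S f y) + L2_norm \<Omega> (\<lambda>y. network K (\<mu> (r n)) y - network K \<nu> y)) \<longlonglongrightarrow> 0 + 0"
      by (intro tendsto_add St(2) netL2)
    have e2: "L2_norm \<Omega> (\<lambda>y. S (F (r n)) y - network K (\<mu> (r n)) y - (S f y - network K \<nu> y))
        \<le> L2_norm \<Omega> (\<lambda>y. S (F (r n)) y - S f y) + L2_norm \<Omega> (\<lambda>y. network K (\<mu> (r n)) y - network K \<nu> y)" for n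
    proof -
      have e: "(\<lambda>y. S (F (r n)) y - network K (\<mu> (r n)) y - (S f y - network K \<nu> y))
          = (\<lambda>y. (S (F (r n)) y - S f y) + (network K \<nu> y - network K (\<mu> (r n)) y))"
        by (simp add: algebra_simps)
      show ?thesis
        unfolding e L2_norm_minus_commute[of \<Omega> "network K (\<mu> (r n))" "network K \<nu>"]
        by (intro L2_triangle L2_diff SL network_L2 \<mu> \<nu>)
    qed
    show "(\<lambda>n. L2_norm \<Omega> (\<lambda>y. S (F (r n)) y - network K (\<mu> (r n)) y - (S f y - network K \<nu> y))) \<longlonglongrightarrow> 0"
      by (rule Lim_null_comparison[OF always_eventually[OF allI] e1[unfolded add_0_left]])
        (simp only: real_norm_def abs_of_nonneg[OF L2_norm_nonneg] e2)
  qed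
  have "(\<lambda>n. potential (F (r n)) (\<mu> (r n)))
      \<longlonglongrightarrow> \<beta> / real M * misfit (S f) + lam * T + \<alpha> / real M * misfit (network K \<nu>) + gap f \<nu>"
    unfolding potential_def misfit_def
    by (intro tendsto_add tendsto_mult_left tendsto_sum tendsto_power tendsto_rabs tendsto_diff tendsto_const
        St(1) points net T(1) gapL)
  moreover have "(\<lambda>n. potential (F (r n)) (\<mu> (r n))) \<longlonglongrightarrow> m"
    using LIMSEQ_subseq_LIMSEQ[OF m(1) r] by (simp add: comp_def)
  ultimately have "\<beta> / real M * misfit (S f) + lam * T + \<alpha> / real M * misfit (network K \<nu>) + gap f \<nu> = m"
    by (rule LIMSEQ_unique)
  moreover have "lam * TV_norm K \<nu> \<le> lam * T" using T(2) pos(3) by (intro mult_left_mono) auto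
  ultimately have "potential f \<nu> \<le> m" unfolding potential_def by linarith
  then show thesis using that[OF f(1) \<nu>] m(2) order_trans by blast
qed

lemma loss1_eq: "loss1 \<Omega> K M x ustar \<beta> f \<mu> = potential f \<mu> - (lam * TV_norm K \<mu> + \<alpha> / real M * misfit (network K \<mu>))"
  by (simp add: loss1_def potential_def misfit_def gap_def)

lemma loss2_eq: "loss2 \<Omega> K M x ustar lam \<alpha> f \<mu> = potential f \<mu> - \<beta> / real M * misfit (S f)"
  by (simp add: loss2_def potential_def misfit_def gap_def)

lemma Nash_equilibrium:
  "\<exists>fstar\<in>strategies1 \<Omega> C. \<exists>\<mu>star\<in>strategies2 K R.
     (\<forall>f\<in>strategies1 \<Omega> C. loss1 \<Omega> K M x ustar \<beta> fstar \<mu>star \<le> loss1 \<Omega> K M x ustar \<beta> f \<mu>star) \<and>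
     (\<forall>\<mu>\<in>strategies2 K R. loss2 \<Omega> K M x ustar lam \<alpha> fstar \<mu>star \<le> loss2 \<Omega> K M x ustar lam \<alpha> fstar \<mu>)"
proof -
  obtain f \<mu> where f: "f \<in> strategies1 \<Omega> C" and \<mu>: "\<mu> \<in> strategies2 K R"
    and min: "\<And>h \<nu>. h \<in> strategies1 \<Omega> C \<Longrightarrow> \<nu> \<in> strategies2 K R \<Longrightarrow> potential f \<mu> \<le> potential h \<nu>"
    using potential_minimum by metis
  show ?thesis
    by (intro bexI[OF _ f] bexI[OF _ \<mu>] conjI ballI) (simp_all add: loss1_eq loss2_eq min f \<mu>)
qed

end

theorem theorem8p3:
  fixes \<Omega> :: "(real ^ 'd) set"
    and K :: "((real ^ 'd) \<times> real) set"
    and M :: nat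
    and x :: "nat \<Rightarrow> real ^ 'd"
    and ustar :: "real ^ 'd \<Rightarrow> real"
    and \<alpha> \<beta> lam C R :: real
  assumes "CARD('d) \<le> 3"
    and "bounded_C11_domain \<Omega>"
    and "M \<ge> 1"
    and "\<forall>i\<in>{1..M}. x i \<in> \<Omega>"
    and "compact K"
    and "\<alpha> > 0" and "\<beta> > 0" and "lam > 0" and "C > 0" and "R > 0"
  shows "\<exists>fstar\<in>strategies1 \<Omega> C. \<exists>\<mu>star\<in>strategies2 K R.
           (\<forall>f\<in>strategies1 \<Omega> C.
              loss1 \<Omega> K M x ustar \<beta> fstar \<mu>star \<le> loss1 \<Omega> K M x ustar \<beta> f \<mu>star) \<and>
           (\<forall>\<mu>\<in>strategies2 K R.
              loss2 \<Omega> K M x ustar lam \<alpha> fstar \<mu>star \<le> loss2 \<Omega> K M x ustar lam \<alpha> fstar \<mu>)"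
proof -
  obtain W :: "real ^ 'd \<Rightarrow> real" where W: "smooth W" "\<And>z. 1 \<le> norm z \<Longrightarrow> W z = 0"
    "\<And>z. laplacian W z = eta z - 2 ^ DIM(real ^ 'd) * eta (2 *\<^sub>R z)"
    using dyadic_potential by metis
  interpret poisson_game \<Omega> W K M x ustar \<alpha> \<beta> lam C R
  proof unfold_locales
    show "open \<Omega>" "bounded \<Omega>" using assms(2) by (auto simp: bounded_C11_domain_def)
    show "DIM(real ^ 'd) \<le> 3" using assms(1) by simp
  qed (use assms W in auto)
  show ?thesis by (rule Nash_equilibrium)
qed

end
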